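(* Let $d\geq 2$, $N\geq 1$, let $A,B\in\mathbb{C}^{N,N}$ be simultaneously diagonalizable (over $\mathbb{C}$) with transformation matrix $Y\in\mathbb{C}^{N,N}$, let every eigenvalue of $A$ have positive real part, and let $S\in\mathbb{R}^{d,d}$ be skew-symmetric. Let $1\leq p<\infty$ and let $\theta\in C(\mathbb{R}^d,\mathbb{R})$ be a radial weight function of exponential growth rate $\eta\geq 0$ (with constant $C_\theta$) satisfying $$\lim_{|\psi|\to0}\sup_{x\in\mathbb{R}^d}\left|\frac{\theta(x+\psi)-\theta(x)}{\theta(x)}\right|=0.$$ Let $\varepsilon>0$, let $\omega_{p,\theta}=-b_0+(1+\varepsilon)\frac{a_{\max}^2\eta^2p}{a_0}$ and $M_{p,\theta}=C_\theta\,\kappa\,a_1^{d/2}\,C_*$ (constants as defined in the context), and let $\lambda\in\mathbb{C}$ with $\mathrm{Re}\,\lambda>\omega_{p,\theta}$. Let $(A_{p,\theta},\mathcal{D}(A_{p,\theta}))$ be the infinitesimal generator of the $C_0$-semigroup $(T(t))_{t\geq0}$ on $L^p_\theta(\mathbb{R}^d,\mathbb{C}^N)$ defined in the context. Then for every $g\in L^p_\theta(\mathbb{R}^d,\mathbb{C}^N)$ the resolvent equation $$(\lambda I-A_{p,\theta})v=g$$ admits a unique solution $v_\star\in\mathcal{D}(A_{p,\theta})$, which is given by $$v_\star=(\lambda I-A_{p,\theta})^{-1}g=\int_0^\infty e^{-\lambda t}T(t)g\,dt=\int_0^\infty e^{-\lambda t}\int_{\mathbb{R}^d}H(\cdot,\xi,t)g(\xi)\,d\xi\,dt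 .$$ Moreover, $$\|v_\star\|_{L^p_\theta(\mathbb{R}^d,\mathbb{C}^N)}\leq\frac{M_{p,\theta}}{\mathrm{Re}\,\lambda-\omega_{p,\theta}}\,\|g\|_{L^p_\theta(\mathbb{R}^d,\mathbb{C}^N)}.$$
   Context: Weight functions: $\theta\in C(\mathbb{R}^d,\mathbb{R})$ is a weight function of exponential growth rate $\eta\geq0$ if $\theta>0$ and there is $C_\theta>0$ with $\theta(x+y)\leq C_\theta\theta(x)e^{\eta|y|}$ for all $x,y$; it is radial if $\theta(x)=\phi(|x|)$ for some $\phi:[0,\infty)\to\mathbb{R}$. $L^p_\theta(\mathbb{R}^d,\mathbb{C}^N)=\{v\in L^1_{\mathrm{loc}}:\|\theta v\|_{L^p}<\infty\}$, $\|v\|_{L^p_\theta}=\|\theta v\|_{L^p}$. Semigroup: $T(0)=I$ and $[T(t)v](x)=\int_{\mathbb{R}^d}H(x,\xi,t)v(\xi)\,d\xi$ for $t>0$, where $H(x,\xi,t)=(4\pi tA)^{-d/2}\exp(-Bt-(4tA)^{-1}|e^{tS}x-\xi|^2)$. Matrix powers: if $A=Y\,\mathrm{diag}(\lambda_k)\,Y^{-1}$ then $(4\pi tA)^{-d/2}=Y\,\mathrm{diag}((4\pi t\lambda_k)^{-d/2})\,Y^{-1}$, with $z^{-d/2}=\exp(-\frac d2\mathrm{Log}\,z)$, $\mathrm{Log}$ the principal logarithm. Under the hypotheses of the claim, $(T(t))_{t\ge0}$ is a $C_0$-semigroup on $L^p_\theta(\mathbb{R}^d,\mathbb{C}^N)$;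 its generator is $A_{p,\theta}v=\lim_{t\downarrow0}\frac{T(t)v-v}{t}$ on the domain $\mathcal{D}(A_{p,\theta})$ of all $v\in L^p_\theta$ for which this limit exists in $L^p_\theta$. Constants: $\sigma(\cdot)$ is the spectrum; $a_{\min}=\min_{\lambda\in\sigma(A)}|\lambda|$, $a_{\max}=\max_{\lambda\in\sigma(A)}|\lambda|$, $a_0=\min_{\lambda\in\sigma(A)}\mathrm{Re}\,\lambda$, $b_0=\min_{\mu\in\sigma(B)}\mathrm{Re}\,\mu$, $a_1=\frac{a_{\max}^2}{a_{\min}a_0}$, $\nu=\frac{a_{\max}^2\eta^2p^2}{a_0}$, $\kappa=|Y||Y^{-1}|$ (spectral norm), where $Y^{-1}AY$ and $Y^{-1}BY$ are diagonal. $C_*=C_*(d,A,\eta,p,\varepsilon)>0$ is a constant (which exists) such that for all $t\geq0$ $$\left[{}_1F_1\left(\tfrac d2;\tfrac12;\nu t\right)+2\tfrac{\Gamma(\frac{d+1}2)}{\Gamma(\frac d2)}(\nu t)^{\frac12}\,{}_1F_1\left(\tfrac{d+1}2;\tfrac32;\nu t\right)\right]^{\frac1p}\leq C_*\,e^{(1+\varepsilon)\frac{\nu}{p}t},$$ with ${}_1F_1$ the Kummer confluent hypergeometric function. *)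

theory Defs
  imports "HOL-Analysis.Analysis"
begin

section \<open>Matrices\<close>

definition diag_mat :: "('n \<Rightarrow> 'a) \<Rightarrow> 'a::zero ^ 'n ^ 'n" where
  "diag_mat l = (\<chi> i j. if i = j then l i else 0)"

definition diagonalizes :: "complex ^ 'n ^ 'n \<Rightarrow> complex ^ 'n ^ 'n \<Rightarrow> bool" where
  "diagonalizes Y M \<longleftrightarrow> invertible Y \<and> (\<exists>l. matrix_inv Y ** M ** Y = diag_mat l)"

definition mat_spectrum :: "complex ^ 'n ^ 'n \<Rightarrow> complex set" where
  "mat_spectrum M = {l. \<not> invertible (mat l - M)}"

definition spectral_norm :: "complex ^ 'n ^ 'n \<Rightarrow> real" where
  "spectral_norm M = onorm (\<lambda>x. M *v x)"

text \<open>Square matrices are not an instance of the Banach algebra classes, so \<open>exp\<close> is not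
  available and the exponential series is written out.\<close>

definition mat_exp :: "'a::real_normed_field ^ 'n ^ 'n \<Rightarrow> 'a ^ 'n ^ 'n" where
  "mat_exp M = (\<Sum>k. (1 / fact k) *\<^sub>R (((\<lambda>X. M ** X) ^^ k) (mat 1)))"

text \<open>Power of a diagonalizable matrix with nonzero eigenvalues. On nonzero complex numbers,
  \<open>powr\<close> is the power defined by the principal logarithm. By the lemma
  \<open>mat_powr_diag\<close> below, the value does not depend on the diagonalization.\<close>

definition mat_powr :: "complex ^ 'n ^ 'n \<Rightarrow> real \<Rightarrow> complex ^ 'n ^ 'n" where
  "mat_powr M s = (THE R. \<exists>(Y :: complex ^ 'n ^ 'n) l. invertible Y \<and> M = Y ** diag_mat l ** matrix_inv Y \<and>
      R = Y ** diag_mat (\<lambda>k. l k powr complex_of_real s) ** matrix_inv Y)"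

lemma diag_mat_mult_left: "(diag_mat l ** (X::'a::semiring_1 ^ 'n ^ 'n)) $ i $ j = l i * X $ i $ j"
  by (simp add: diag_mat_def matrix_matrix_mult_def if_distrib[of "\<lambda>c. c * _"] cong: if_cong)

lemma diag_mat_mult_right: "((X::'a::semiring_1 ^ 'n ^ 'n) ** diag_mat l) $ i $ j = X $ i $ j * l j"
  by (simp add: diag_mat_def matrix_matrix_mult_def if_distrib[of "\<lambda>c. _ * c"] cong: if_cong)

lemma matrix_inv_cancel:
  fixes Y :: "'a::semiring_1 ^ 'n ^ 'n"
  assumes "invertible Y"
  shows "Y ** matrix_inv Y = mat 1" "matrix_inv Y ** Y = mat 1"
  using someI_ex[OF assms[unfolded invertible_def]] unfolding matrix_inv_def by auto

lemma mat_powr_diag: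
  fixes Y :: "complex ^ 'n ^ 'n"
  assumes "invertible Y"
  shows "mat_powr (Y ** diag_mat l ** matrix_inv Y) s =
           Y ** diag_mat (\<lambda>k. l k powr complex_of_real s) ** matrix_inv Y"
  unfolding mat_powr_def
proof (rule the_equality)
  show "\<exists>(Y' :: complex ^ 'n ^ 'n) l'. invertible Y' \<and>
      Y ** diag_mat l ** matrix_inv Y = Y' ** diag_mat l' ** matrix_inv Y' \<and>
      Y ** diag_mat (\<lambda>k. l k powr complex_of_real s) ** matrix_inv Y =
      Y' ** diag_mat (\<lambda>k. l' k powr complex_of_real s) ** matrix_inv Y'"
    using assms by blast
next
  fix R
  assume "\<exists>(Y' :: complex ^ 'n ^ 'n) l'. invertible Y' \<and>
      Y ** diag_mat l ** matrix_inv Y = Y' ** diag_mat l' ** matrix_inv Y' \<and>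
      R = Y' ** diag_mat (\<lambda>k. l' k powr complex_of_real s) ** matrix_inv Y'"
  then obtain Z :: "complex ^ 'n ^ 'n" and m where Z: "invertible Z"
    and eq: "Y ** diag_mat l ** matrix_inv Y = Z ** diag_mat m ** matrix_inv Z"
    and R: "R = Z ** diag_mat (\<lambda>k. m k powr complex_of_real s) ** matrix_inv Z"
    by blast
  have Zi: "matrix_inv Z ** Z = mat 1" "Z ** matrix_inv Z = mat 1"
    and Yi: "matrix_inv Y ** Y = mat 1" "Y ** matrix_inv Y = mat 1"
    by (simp_all add: matrix_inv_cancel Z assms)
  define W where "W = matrix_inv Z ** Y"
  have W: "Y = Z ** W"
    by (simp add: W_def matrix_mul_assoc Zi)
  have "W ** diag_mat l = matrix_inv Z ** (Y ** diag_mat l ** matrix_inv Y) ** Y"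
    by (simp add: W_def Yi flip: matrix_mul_assoc)
  also have "\<dots> = diag_mat m ** W"
    unfolding eq by (simp add: W_def matrix_mul_assoc Zi)
  finally have "W $ i $ j * l j = m i * W $ i $ j" for i j
    by (metis diag_mat_mult_left diag_mat_mult_right)
  then have "W $ i $ j = 0 \<or> l j = m i" for i j
    by (metis mult.commute mult_cancel_left)
  then have "W ** diag_mat (\<lambda>k. l k powr complex_of_real s) =
      diag_mat (\<lambda>k. m k powr complex_of_real s) ** W"
    by (simp add: vec_eq_iff diag_mat_mult_left diag_mat_mult_right) (metis mult.commute mult_zero_left)
  then have "Y ** diag_mat (\<lambda>k. l k powr complex_of_real s) ** matrix_inv Y =
      Z ** (diag_mat (\<lambda>k. m k powr complex_of_real s) ** W) ** matrix_inv Y"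
    by (subst W) (simp flip: matrix_mul_assoc)
  also have "\<dots> = R"
    by (simp add: R W_def Yi flip: matrix_mul_assoc)
  finally show "R = Y ** diag_mat (\<lambda>k. l k powr complex_of_real s) ** matrix_inv Y" ..
qed


section \<open>Weighted Lebesgue spaces\<close>

definition weight_function :: "('a::euclidean_space \<Rightarrow> real) \<Rightarrow> real \<Rightarrow> real \<Rightarrow> bool" where
  "weight_function \<theta> \<eta> C \<longleftrightarrow> continuous_on UNIV \<theta> \<and> (\<forall>x. \<theta> x > 0) \<and> \<eta> \<ge> 0 \<and> C > 0 \<and>
     (\<forall>x y. \<theta> (x + y) \<le> C * \<theta> x * exp (\<eta> * norm y))"

definition radial :: "('a::euclidean_space \<Rightarrow> real) \<Rightarrow> bool" where
  "radial \<theta> \<longleftrightarrow> (\<exists>\<phi>::real \<Rightarrow> real. \<forall>x. \<theta> x = \<phi> (norm x))"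

definition locally_L1 :: "('a::euclidean_space \<Rightarrow> 'b::euclidean_space) \<Rightarrow> bool" where
  "locally_L1 v \<longleftrightarrow> v \<in> borel_measurable lebesgue \<and> (\<forall>K. compact K \<longrightarrow> set_integrable lebesgue K v)"

text \<open>Elements of \<open>L\<^sup>p\<^sub>\<theta>\<close> are represented by functions; equality in
  \<open>L\<^sup>p\<^sub>\<theta>\<close> is equality almost everywhere. Outside of \<open>Lp_space p \<theta>\<close> the
  value of \<open>Lp_norm\<close> is meaningless.\<close>

definition Lp_space :: "real \<Rightarrow> ('a::euclidean_space \<Rightarrow> real) \<Rightarrow> ('a \<Rightarrow> 'b::euclidean_space) set" where
  "Lp_space p \<theta> = {v. locally_L1 v \<and> integrable lebesgue (\<lambda>x. (\<theta> x * norm (v x)) powr p)}"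

definition Lp_norm :: "real \<Rightarrow> ('a::euclidean_space \<Rightarrow> real) \<Rightarrow> ('a \<Rightarrow> 'b::euclidean_space) \<Rightarrow> real" where
  "Lp_norm p \<theta> v = (LINT x|lebesgue. (\<theta> x * norm (v x)) powr p) powr (1 / p)"

definition Lp_tendsto :: "real \<Rightarrow> ('a::euclidean_space \<Rightarrow> real) \<Rightarrow> ('i \<Rightarrow> 'a \<Rightarrow> 'b::euclidean_space) \<Rightarrow>
    ('a \<Rightarrow> 'b) \<Rightarrow> 'i filter \<Rightarrow> bool" where
  "Lp_tendsto p \<theta> f w F \<longleftrightarrow> w \<in> Lp_space p \<theta> \<and> (\<forall>\<^sub>F i in F. f i \<in> Lp_space p \<theta>) \<and>
     ((\<lambda>i. Lp_norm p \<theta> (\<lambda>x. f i x - w x)) \<longlongrightarrow> 0) F"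

text \<open>\<open>L\<^sup>p\<^sub>\<theta>\<close>-valued Riemann integral over \<open>[a, b]\<close> (gauges of constant
  radius), and improper Riemann integral over \<open>[0, \<infinity>)\<close>.\<close>

definition Lp_has_riemann_integral :: "real \<Rightarrow> ('a::euclidean_space \<Rightarrow> real) \<Rightarrow>
    (real \<Rightarrow> 'a \<Rightarrow> 'b::euclidean_space) \<Rightarrow> ('a \<Rightarrow> 'b) \<Rightarrow> real \<Rightarrow> real \<Rightarrow> bool" where
  "Lp_has_riemann_integral p \<theta> f V a b \<longleftrightarrow>
     V \<in> Lp_space p \<theta> \<and> (\<forall>t\<in>{a..b}. f t \<in> Lp_space p \<theta>) \<and>
     (\<forall>e>0. \<exists>r>0. \<forall>D. D tagged_division_of {a..b} \<and> (\<lambda>t. ball t r) fine D \<longrightarrow>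
        Lp_norm p \<theta> (\<lambda>x. (\<Sum>(t, K)\<in>D. measure lborel K *\<^sub>R f t x) - V x) < e)"

definition Lp_has_improper_integral :: "real \<Rightarrow> ('a::euclidean_space \<Rightarrow> real) \<Rightarrow>
    (real \<Rightarrow> 'a \<Rightarrow> 'b::euclidean_space) \<Rightarrow> ('a \<Rightarrow> 'b) \<Rightarrow> bool" where
  "Lp_has_improper_integral p \<theta> f V \<longleftrightarrow>
     (\<exists>J. (\<forall>\<tau>\<ge>0. Lp_has_riemann_integral p \<theta> f (J \<tau>) 0 \<tau>) \<and> Lp_tendsto p \<theta> J V at_top)"


section \<open>The Ornstein--Uhlenbeck semigroup and its generator\<close>

definition heat_kernel :: "complex ^ 'n ^ 'n \<Rightarrow> complex ^ 'n ^ 'n \<Rightarrow> real ^ 'd ^ 'd \<Rightarrow>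
    real ^ 'd \<Rightarrow> real ^ 'd \<Rightarrow> real \<Rightarrow> complex ^ 'n ^ 'n" where
  "heat_kernel A B S x \<xi> t =
     mat_powr ((4 * pi * t) *\<^sub>R A) (- (real CARD('d) / 2)) **
     mat_exp (- (t *\<^sub>R B) - (norm (mat_exp (t *\<^sub>R S) *v x - \<xi>))\<^sup>2 *\<^sub>R matrix_inv ((4 * t) *\<^sub>R A))"

definition OU_semigroup :: "complex ^ 'n ^ 'n \<Rightarrow> complex ^ 'n ^ 'n \<Rightarrow> real ^ 'd ^ 'd \<Rightarrow> real \<Rightarrow>
    (real ^ 'd \<Rightarrow> complex ^ 'n) \<Rightarrow> real ^ 'd \<Rightarrow> complex ^ 'n" where
  "OU_semigroup A B S t v x =
     (if t = 0 then v x else (LINT \<xi>|lebesgue. heat_kernel A B S x \<xi> t *v v \<xi>))"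

definition OU_difference_quotient :: "complex ^ 'n ^ 'n \<Rightarrow> complex ^ 'n ^ 'n \<Rightarrow> real ^ 'd ^ 'd \<Rightarrow>
    (real ^ 'd \<Rightarrow> complex ^ 'n) \<Rightarrow> real \<Rightarrow> real ^ 'd \<Rightarrow> complex ^ 'n" where
  "OU_difference_quotient A B S v t x = (1 / t) *\<^sub>R (OU_semigroup A B S t v x - v x)"

definition OU_domain :: "complex ^ 'n ^ 'n \<Rightarrow> complex ^ 'n ^ 'n \<Rightarrow> real ^ 'd ^ 'd \<Rightarrow> real \<Rightarrow>
    (real ^ 'd \<Rightarrow> real) \<Rightarrow> (real ^ 'd \<Rightarrow> complex ^ 'n) set" where
  "OU_domain A B S p \<theta> =
     {v \<in> Lp_space p \<theta>. \<exists>w. Lp_tendsto p \<theta> (OU_difference_quotient A B S v) w (at_right 0)}"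

text \<open>The limit is determined up to a null set; the choice picks a representative.\<close>

definition OU_generator :: "complex ^ 'n ^ 'n \<Rightarrow> complex ^ 'n ^ 'n \<Rightarrow> real ^ 'd ^ 'd \<Rightarrow> real \<Rightarrow>
    (real ^ 'd \<Rightarrow> real) \<Rightarrow> (real ^ 'd \<Rightarrow> complex ^ 'n) \<Rightarrow> real ^ 'd \<Rightarrow> complex ^ 'n" where
  "OU_generator A B S p \<theta> v =
     (SOME w. Lp_tendsto p \<theta> (OU_difference_quotient A B S v) w (at_right 0))"

definition solves_resolvent_eq :: "complex ^ 'n ^ 'n \<Rightarrow> complex ^ 'n ^ 'n \<Rightarrow> real ^ 'd ^ 'd \<Rightarrow> real \<Rightarrow>
    (real ^ 'd \<Rightarrow> real) \<Rightarrow> complex \<Rightarrow> (real ^ 'd \<Rightarrow> complex ^ 'n) \<Rightarrow> (real ^ 'd \<Rightarrow> complex ^ 'n) \<Rightarrow> bool" where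
  "solves_resolvent_eq A B S p \<theta> z g v \<longleftrightarrow> v \<in> OU_domain A B S p \<theta> \<and>
     (AE x in lebesgue. z *s v x - OU_generator A B S p \<theta> v x = g x)"

text \<open>A representative of the image of \<open>g\<close> under the inverse of \<open>z I - OU_generator A B S p \<theta>\<close>.\<close>

definition OU_resolvent :: "complex ^ 'n ^ 'n \<Rightarrow> complex ^ 'n ^ 'n \<Rightarrow> real ^ 'd ^ 'd \<Rightarrow> real \<Rightarrow>
    (real ^ 'd \<Rightarrow> real) \<Rightarrow> complex \<Rightarrow> (real ^ 'd \<Rightarrow> complex ^ 'n) \<Rightarrow> real ^ 'd \<Rightarrow> complex ^ 'n" where
  "OU_resolvent A B S p \<theta> z g = (SOME v. solves_resolvent_eq A B S p \<theta> z g v)"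


section \<open>Constants\<close>

definition a_min :: "complex ^ 'n ^ 'n \<Rightarrow> real" where
  "a_min A = Min (cmod ` mat_spectrum A)"

definition a_max :: "complex ^ 'n ^ 'n \<Rightarrow> real" where
  "a_max A = Max (cmod ` mat_spectrum A)"

text \<open>This is \<open>a\<^sub>0\<close> when applied to \<open>A\<close> and \<open>b\<^sub>0\<close> when applied to \<open>B\<close>.\<close>

definition min_Re_spectrum :: "complex ^ 'n ^ 'n \<Rightarrow> real" where
  "min_Re_spectrum M = Min (Re ` mat_spectrum M)"

definition a_one :: "complex ^ 'n ^ 'n \<Rightarrow> real" where
  "a_one A = (a_max A)\<^sup>2 / (a_min A * min_Re_spectrum A)"

definition nu_const :: "complex ^ 'n ^ 'n \<Rightarrow> real \<Rightarrow> real \<Rightarrow> real" where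
  "nu_const A \<eta> p = (a_max A)\<^sup>2 * \<eta>\<^sup>2 * p\<^sup>2 / min_Re_spectrum A"

definition kappa :: "complex ^ 'n ^ 'n \<Rightarrow> real" where
  "kappa Y = spectral_norm Y * spectral_norm (matrix_inv Y)"

definition kummer_1F1 :: "real \<Rightarrow> real \<Rightarrow> real \<Rightarrow> real" where
  "kummer_1F1 a b z = (\<Sum>n. pochhammer a n / pochhammer b n * z ^ n / fact n)"

text \<open>Here \<open>C\<close> is an admissible choice of the constant \<open>C\<^sub>*\<close>.\<close>

definition kummer_growth_const :: "nat \<Rightarrow> complex ^ 'n ^ 'n \<Rightarrow> real \<Rightarrow> real \<Rightarrow> real \<Rightarrow> real \<Rightarrow> bool" where
  "kummer_growth_const d A \<eta> p \<epsilon> C \<longleftrightarrow> C > 0 \<and>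
     (let \<nu> = nu_const A \<eta> p in
      \<forall>t\<ge>0. (kummer_1F1 (real d / 2) (1 / 2) (\<nu> * t) +
             2 * (Gamma ((real d + 1) / 2) / Gamma (real d / 2)) * sqrt (\<nu> * t) *
               kummer_1F1 ((real d + 1) / 2) (3 / 2) (\<nu> * t)) powr (1 / p)
          \<le> C * exp ((1 + \<epsilon>) * (\<nu> / p) * t))"

definition omega_const :: "complex ^ 'n ^ 'n \<Rightarrow> complex ^ 'n ^ 'n \<Rightarrow> real \<Rightarrow> real \<Rightarrow> real \<Rightarrow> real" where
  "omega_const A B \<eta> p \<epsilon> =
     - min_Re_spectrum B + (1 + \<epsilon>) * ((a_max A)\<^sup>2 * \<eta>\<^sup>2 * p / min_Re_spectrum A)"

definition M_const :: "nat \<Rightarrow> complex ^ 'n ^ 'n \<Rightarrow> complex ^ 'n ^ 'n \<Rightarrow> real \<Rightarrow> real \<Rightarrow> real" where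
  "M_const d A Y C\<theta> C_star = C\<theta> * kappa Y * a_one A powr (real d / 2) * C_star"

end

theory Submission
  imports Defs
begin

text \<open>Diagonalizing \<open>A\<close> and \<open>B\<close> simultaneously splits the semigroup into scalar convolutions with
  complex Gaussians, composed with the isometries \<open>e\<^sup>t\<^sup>S\<close>. All of them are dominated by one real Gaussian, and
  a weighted form of Young's inequality bounds the operator norm through the integral of that Gaussian
  against \<open>exp (\<eta> p |y|)\<close>; expanding the exponential, the radial Gaussian moments sum up to the Kummer functions in
  the growth condition. Hence \<open>F t = exp (- z t) T t\<close> decays with rate \<open>Re z - \<omega>\<close>, and the Laplace transform
  \<open>R g\<close>, the integral of \<open>F t g\<close> over \<open>t > 0\<close>, converges in the weighted space by Minkowski's inequality.
  Since \<open>F h (R g) - R g\<close> is minus the integral of \<open>F t g\<close> over \<open>0 < t \<le> h\<close>, dividing by \<open>h\<close> gives the resolvent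
  equation for \<open>R g\<close>. The same identity for \<open>R (F h w - w)\<close> shows that every solution \<open>w\<close> equals \<open>R g\<close>.\<close>

section \<open>Weighted Lebesgue spaces\<close>

text \<open>The difficulty lies between functions and classes. Elements of the weighted space are
  merely Lebesgue measurable, product measurability needs Borel representatives, and a divergent
  Bochner integral takes a default value. What helps is that for \<open>t > 0\<close> the kernel
  integral converges at every point \<open>x\<close>: linearity, the semigroup law and commutation
  with time integrals then hold pointwise. Time integrals are therefore taken pointwise in
  \<open>x\<close>, and the norm convergent Riemann integral is identified with them afterwards.
  Strong continuity at 0 comes from continuous functions of compact support: substituting
  \<open>\<xi> = rot S t x - sqrt t y\<close> removes \<open>t\<close> from the kernel, and one
  Gaussian in \<open>x\<close> dominates all small times. Density and the uniform operator bound do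
  the rest. The constants have separate sources: \<open>kappa Y\<close> is the price of the change
  of basis, \<open>a_one A\<close> to the power \<open>d / 2\<close> is the mass of the dominating
  Gaussian, \<open>C\<close> comes from moving the weight through the kernel, and
  \<open>C_star\<close> with its exponential bounds the \<open>p\<close>-th root of the exponential
  moment.\<close>

text \<open>By convexity the graph of \<open>x powr p\<close> lies above its tangent at
  \<open>m\<close>; after scaling to \<open>m = 1\<close> this is Young's inequality with exponents
  \<open>1 / p\<close> and \<open>1 - 1 / p\<close>. The Hoelder and Minkowski estimates below rest
  on it instead of on duality, so \<open>p = 1\<close> is no special case.\<close>

lemma powr_ge_tangent:
  fixes x m p :: real
  assumes "1 \<le> p" "0 \<le> x" "0 < m"
  shows "p * m powr (p - 1) * x \<le> x powr p + (p - 1) * m powr p"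
proof (cases "x = 0")
  case False
  define y where "y = x / m"
  have y: "y > 0" using False assms by (simp add: y_def)
  have "(y powr p) powr (1 / p) * 1 powr (1 - 1 / p) \<le> 1 / p * y powr p + (1 - 1 / p) * 1"
    using assms y by (intro Youngs_inequality_0) (auto simp: field_simps)
  then have "y \<le> 1 / p * y powr p + (1 - 1 / p)"
    using assms y by (simp add: powr_powr)
  then have "p * y \<le> p * (1 / p * y powr p + (1 - 1 / p))"
    using assms by (intro mult_left_mono) auto
  also have "\<dots> = y powr p + (p - 1)"
    using assms by (simp add: distrib_left right_diff_distrib)
  finally have "p * y \<le> y powr p + (p - 1)" .
  then have "m powr p * (p * y) \<le> m powr p * (y powr p + (p - 1))"
    by (intro mult_left_mono) auto
  moreover have "m powr p * y powr p = x powr p"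
    using assms False by (simp add: y_def powr_divide)
  moreover have "m powr p * y = m powr (p - 1) * x"
    using assms by (simp add: y_def powr_diff)
  ultimately show ?thesis
    by (simp add: algebra_simps)
qed (use assms in auto)

text \<open>Convexity of the power with weights \<open>a / (a + b)\<close> and
  \<open>b / (a + b)\<close>. When \<open>a\<close> and \<open>b\<close> are the norms of two
  functions, integrating the right side gives \<open>(a + b) powr p\<close>, which is the triangle
  inequality.\<close>

lemma powr_add_convex:
  fixes a b x y p :: real
  assumes "1 \<le> p" "0 \<le> x" "0 \<le> y" "0 < a" "0 < b"
  shows "(x + y) powr p \<le> (a + b) powr (p - 1) * (a powr (1 - p) * x powr p + b powr (1 - p) * y powr p)"
proof (cases "x + y = 0")
  case False
  define s where "s = x + y"
  \<comment> \<open>The mean of \<open>x / a\<close> and \<open>y / b\<close> with weights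
    \<open>a\<close> and \<open>b\<close>. The tangent at this point is used for both quotients, and
    the two linear terms then add up to a multiple of \<open>s\<close>.\<close>
  define m where "m = s / (a + b)"
  have s: "s > 0" and m: "m > 0" using False assms by (auto simp: s_def m_def)
  have *: "p * m powr (p - 1) * u \<le> c powr (1 - p) * u powr p + (p - 1) * m powr p * c"
    if "0 \<le> u" "0 < c" for u c
  proof -
    have "p * m powr (p - 1) * (u / c) \<le> (u / c) powr p + (p - 1) * m powr p"
      by (rule powr_ge_tangent) (use that m assms in auto)
    then have "c * (p * m powr (p - 1) * (u / c)) \<le> c * ((u / c) powr p + (p - 1) * m powr p)"
      using that by (intro mult_left_mono) auto
    moreover have "c * (u / c) powr p = c powr (1 - p) * u powr p"
      using that by (simp add: powr_divide powr_diff)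
    ultimately show ?thesis using that by (simp add: algebra_simps)
  qed
  have "p * m powr (p - 1) * s \<le> (a powr (1 - p) * x powr p + b powr (1 - p) * y powr p)
      + (p - 1) * m powr p * (a + b)"
    using *[of x a] *[of y b] assms by (simp add: s_def algebra_simps)
  moreover have "m powr p * (a + b) = m powr (p - 1) * s"
  proof -
    have "s = m * (a + b)" using assms by (simp add: m_def)
    then show ?thesis using m by (simp add: powr_diff)
  qed
  then have "(p - 1) * m powr p * (a + b) = (p - 1) * (m powr (p - 1) * s)" by (metis mult.assoc)
  ultimately have "m powr (p - 1) * s \<le> a powr (1 - p) * x powr p + b powr (1 - p) * y powr p"
    by (simp add: algebra_simps)
  then have "(a + b) powr (p - 1) * (m powr (p - 1) * s)
      \<le> (a + b) powr (p - 1) * (a powr (1 - p) * x powr p + b powr (1 - p) * y powr p)"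
    by (intro mult_left_mono) auto
  moreover have "(a + b) powr (p - 1) * (m powr (p - 1) * s) = s powr p"
    using s assms by (simp add: m_def powr_divide powr_diff)
  ultimately show ?thesis by (simp add: s_def)
qed (use assms in auto)

text \<open>The tangent at 1, scaled by \<open>c t\<close>, dominates \<open>f\<close> by a sum of
  two integrable functions. Since \<open>0 powr _ = 0\<close>, the factor
  \<open>c t powr (1 - p)\<close> is zero and not infinite where \<open>c\<close> vanishes;
  demanding \<open>f t = 0\<close> there restores the usual convention.\<close>

lemma weighted_Hoelder_integrable:
  fixes f c :: "'t \<Rightarrow> real"
  assumes [measurable]: "f \<in> borel_measurable M" "c \<in> borel_measurable M"
    and nn: "\<And>t. 0 \<le> f t" "\<And>t. 0 \<le> c t" "\<And>t. c t = 0 \<Longrightarrow> f t = 0" and p: "1 \<le> p"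
    and c: "(\<integral>\<^sup>+t. ennreal (c t) \<partial>M) \<le> ennreal C"
    and f: "(\<integral>\<^sup>+t. ennreal (c t powr (1 - p) * f t powr p) \<partial>M) < \<infinity>"
  shows "integrable M f"
proof (rule integrableI_nonneg)
  have le: "f t \<le> c t powr (1 - p) * f t powr p + c t" for t
  proof (cases "c t = 0")
    case False
    then have ct: "c t > 0" using nn(2)[of t] by simp
    have "p * 1 powr (p - 1) * (f t / c t) \<le> (f t / c t) powr p + (p - 1) * 1 powr p"
      by (rule powr_ge_tangent) (use nn ct p in auto)
    then have "f t / c t * p \<le> ((f t / c t) powr p + 1) * p"
      using p mult_left_mono[of 1 p "(f t / c t) powr p"] by (auto simp: algebra_simps)
    then have "f t / c t \<le> (f t / c t) powr p + 1"
      by (rule mult_right_le_imp_le) (use p in auto)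
    then have "c t * (f t / c t) \<le> c t * ((f t / c t) powr p + 1)" using ct by (intro mult_left_mono) auto
    then show ?thesis using ct nn by (simp add: powr_divide powr_diff algebra_simps)
  qed (use nn in auto)
  have "(\<integral>\<^sup>+t. ennreal (f t) \<partial>M) \<le> (\<integral>\<^sup>+t. ennreal (c t powr (1 - p) * f t powr p) + ennreal (c t) \<partial>M)"
    using le nn by (intro nn_integral_mono) (simp flip: ennreal_plus add: ennreal_leI)
  also have "\<dots> = (\<integral>\<^sup>+t. ennreal (c t powr (1 - p) * f t powr p) \<partial>M) + (\<integral>\<^sup>+t. ennreal (c t) \<partial>M)"
    by (intro nn_integral_add) auto
  also have "\<dots> < \<infinity>" using c f by (simp add: less_top ennreal_add_eq_top) (metis ennreal_less_top order.strict_trans1)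
  finally show "(\<integral>\<^sup>+t. ennreal (f t) \<partial>M) < \<infinity>" .
qed (use nn in auto)

text \<open>Jensen's inequality for \<open>f / c\<close> under the measure with density
  \<open>c\<close>, stated without a conjugate exponent. It serves twice: with \<open>c\<close> a
  kernel it gives Young's inequality, with \<open>c\<close> a bound of norms it gives Minkowski's
  integral inequality.\<close>

lemma weighted_Hoelder:
  fixes f c :: "'t \<Rightarrow> real"
  assumes [measurable]: "f \<in> borel_measurable M" "c \<in> borel_measurable M"
    and nn: "\<And>t. 0 \<le> f t" "\<And>t. 0 \<le> c t" "\<And>t. c t = 0 \<Longrightarrow> f t = 0" and p: "1 \<le> p"
    and C: "(\<integral>\<^sup>+t. ennreal (c t) \<partial>M) \<le> ennreal C" "C > 0"
  shows "ennreal ((LINT t|M. f t) powr p)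
    \<le> ennreal (C powr (p - 1)) * (\<integral>\<^sup>+t. ennreal (c t powr (1 - p) * f t powr p) \<partial>M)"
proof (cases "integrable M f \<and> (LINT t|M. f t) \<noteq> 0 \<and> (\<integral>\<^sup>+t. ennreal (c t powr (1 - p) * f t powr p) \<partial>M) < \<infinity>")
  case True
  define F where "F = (LINT t|M. f t)"
  \<comment> \<open>The mean of \<open>f / c\<close> when \<open>c\<close> has mass
    \<open>C\<close>; placing the tangent here makes the integrated bound sharp.\<close>
  define m where "m = F / C"
  have F: "F > 0" using True nn by (simp add: F_def order_less_le)
  then have m: "m > 0" using C by (simp add: m_def)
  have intc: "integrable M c"
    by (rule integrableI_nonneg) (use nn C in \<open>auto intro: order.strict_trans1\<close>)
  have cC: "(LINT t|M. c t) \<le> C"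
    using C intc nn by (subst (asm) nn_integral_eq_integral) auto
  have intf: "integrable M (\<lambda>t. c t powr (1 - p) * f t powr p)"
    by (rule integrableI_nonneg) (use nn True in auto)
  define G where "G = (LINT t|M. c t powr (1 - p) * f t powr p)"
  have Geq: "(\<integral>\<^sup>+t. ennreal (c t powr (1 - p) * f t powr p) \<partial>M) = ennreal G"
    unfolding G_def by (rule nn_integral_eq_integral[OF intf]) (use nn in auto)
  have le: "p * m powr (p - 1) * f t \<le> c t powr (1 - p) * f t powr p + (p - 1) * m powr p * c t" for t
  proof (cases "c t = 0")
    case False
    then have ct: "c t > 0" using nn(2)[of t] by simp
    have "p * m powr (p - 1) * (f t / c t) \<le> (f t / c t) powr p + (p - 1) * m powr p"
      by (rule powr_ge_tangent) (use nn ct p m in auto)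
    then have "c t * (p * m powr (p - 1) * (f t / c t)) \<le> c t * ((f t / c t) powr p + (p - 1) * m powr p)"
      using ct by (intro mult_left_mono) auto
    then show ?thesis using ct nn by (simp add: powr_divide powr_diff algebra_simps)
  qed (use nn in auto)
  have "(LINT t|M. p * m powr (p - 1) * f t)
      \<le> (LINT t|M. c t powr (1 - p) * f t powr p + (p - 1) * m powr p * c t)"
    using le True intc intf by (intro integral_mono) auto
  then have "p * m powr (p - 1) * F \<le> G + (p - 1) * m powr p * (LINT t|M. c t)"
    using True intc intf by (simp add: F_def G_def)
  also have "\<dots> \<le> G + (p - 1) * m powr p * C"
    using cC p by (intro add_left_mono mult_left_mono) auto
  finally have "p * m powr (p - 1) * F \<le> G + (p - 1) * m powr p * C" .
  moreover have "m powr p * C = m powr (p - 1) * F"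
    using m C F by (simp add: m_def powr_diff)
  then have "(p - 1) * m powr p * C = (p - 1) * (m powr (p - 1) * F)" by (metis mult.assoc)
  ultimately have "m powr (p - 1) * F \<le> G" by (simp add: algebra_simps)
  then have "C powr (p - 1) * (m powr (p - 1) * F) \<le> C powr (p - 1) * G"
    by (intro mult_left_mono) auto
  moreover have "C powr (p - 1) * (m powr (p - 1) * F) = F powr p"
    using F C by (simp add: m_def powr_divide powr_diff)
  ultimately have "F powr p \<le> C powr (p - 1) * G" by simp
  then show ?thesis unfolding Geq F_def[symmetric]
    by (subst ennreal_mult'[symmetric]) (auto intro: ennreal_leI)
next
  case False
  \<comment> \<open>A finite right side forces \<open>f\<close> to be integrable, so only the case
    of a vanishing integral is left; an infinite right side needs no proof. The default value of the
    integral never matters.\<close>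
  show ?thesis
  proof (cases "(\<integral>\<^sup>+t. ennreal (c t powr (1 - p) * f t powr p) \<partial>M) < \<infinity>")
    case True
    have "integrable M f"
      by (rule weighted_Hoelder_integrable[OF assms(1,2) nn p C(1) True])
    with True False have "(LINT t|M. f t) = 0" by blast
    then show ?thesis by simp
  next
    case False
    then have "(\<integral>\<^sup>+t. ennreal (c t powr (1 - p) * f t powr p) \<partial>M) = top"
      by (metis infinity_ennreal_def less_top)
    then show ?thesis using C by (simp add: ennreal_mult_top)
  qed
qed

section \<open>Borel representatives of Lebesgue measurable functions\<close>

lemma borel_imp_lebesgue_measurable:
  "f \<in> borel_measurable borel \<Longrightarrow> f \<in> borel_measurable lebesgue"
  by (rule measurable_completion) simp

text \<open>Completeness of \<open>lebesgue\<close>: preimages under the two functions differ by a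
  null set.\<close>

lemma lebesgue_measurable_cong_AE:
  fixes v w :: "'a::euclidean_space \<Rightarrow> 'b::euclidean_space"
  assumes v: "v \<in> borel_measurable lebesgue" and ae: "AE x in lebesgue. w x = v x"
  shows "w \<in> borel_measurable lebesgue"
proof (rule measurableI)
  fix S :: "'b set" assume "S \<in> sets borel"
  then have "v -` S \<inter> space lebesgue \<in> sets lebesgue" by (rule measurable_sets[OF v])
  moreover have "AE x in lebesgue. x \<in> v -` S \<inter> space lebesgue \<longleftrightarrow> x \<in> w -` S \<inter> space lebesgue"
    using ae by eventually_elim auto
  ultimately show "w -` S \<inter> space lebesgue \<in> sets lebesgue"
    using completion.complete_measure_axioms complete_measure.in_sets_AE[of lebesgue] by blast
qed auto

text \<open>The real-valued case is applied to each coordinate. Borel representatives are what makes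
  kernels times functions measurable on product spaces, where Fubini's theorem is used.\<close>

lemma lebesgue_measurable_ex_borel:
  fixes v :: "'a::euclidean_space \<Rightarrow> 'b::euclidean_space"
  assumes "v \<in> borel_measurable lebesgue"
  obtains w where "w \<in> borel_measurable borel" "AE x in lebesgue. v x = w x"
proof -
  have "\<exists>g. g \<in> borel_measurable lborel \<and> (AE x in lborel. v x \<bullet> b = g x)" for b
    using completion_ex_borel_measurable_real[of "\<lambda>x. v x \<bullet> b" lborel] assms by auto
  then obtain g where g: "\<And>b. g b \<in> borel_measurable lborel" "\<And>b. AE x in lborel. v x \<bullet> b = g b x"
    by metis
  have g': "g b \<in> borel_measurable borel" for b using g(1)[of b] by simp
  have "AE x in lborel. \<forall>b\<in>Basis. v x \<bullet> b = g b x"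
    using g(2) by (intro AE_finite_allI) auto
  then have "AE x in lborel. v x = (\<Sum>b\<in>Basis. g b x *\<^sub>R b)"
    by eventually_elim (metis (mono_tags, lifting) euclidean_representation sum.cong)
  then show ?thesis using g'
    by (intro that[of "\<lambda>x. \<Sum>b\<in>Basis. g b x *\<^sub>R b"]) (auto simp: AE_completion_iff)
qed

section \<open>The weighted space and its norm\<close>

locale weighted_Lp =
  fixes p :: real and \<theta> :: "'a::euclidean_space \<Rightarrow> real"
  assumes p_ge_1: "1 \<le> p" and cont_weight: "continuous_on UNIV \<theta>" and weight_pos: "\<And>x. \<theta> x > 0"
begin

text \<open>This integral becomes infinite where the Bochner integral in \<open>Lp_norm\<close>
  would fall back to its default, so membership and norm bounds are both read off from it.\<close>

abbreviation Lp_nn :: "('a \<Rightarrow> 'b::euclidean_space) \<Rightarrow> ennreal" where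
  "Lp_nn v \<equiv> (\<integral>\<^sup>+x. ennreal ((\<theta> x * norm (v x)) powr p) \<partial>lebesgue)"

lemma weight_measurable [measurable]: "\<theta> \<in> borel_measurable borel"
  using cont_weight by (rule borel_measurable_continuous_onI)

lemma weight_measurable_lebesgue [measurable]: "\<theta> \<in> borel_measurable lebesgue"
  using weight_measurable by (rule borel_imp_lebesgue_measurable)

text \<open>Local integrability is automatic: on a compact set the weight has a positive minimum,
  and \<open>u \<le> 1 + u powr p\<close> bounds the function by an integrable one.\<close>

lemma Lp_space_iff:
  "v \<in> Lp_space p \<theta> \<longleftrightarrow> v \<in> borel_measurable lebesgue \<and> Lp_nn v < \<infinity>"
proof
  assume "v \<in> Lp_space p \<theta>"
  then have "v \<in> borel_measurable lebesgue" "integrable lebesgue (\<lambda>x. (\<theta> x * norm (v x)) powr p)"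
    by (auto simp: Lp_space_def locally_L1_def)
  then show "v \<in> borel_measurable lebesgue \<and> Lp_nn v < \<infinity>"
    by (auto simp: integrable_iff_bounded)
next
  assume v: "v \<in> borel_measurable lebesgue \<and> Lp_nn v < \<infinity>"
  then have [measurable]: "v \<in> borel_measurable lebesgue" by simp
  have int: "integrable lebesgue (\<lambda>x. (\<theta> x * norm (v x)) powr p)"
    by (rule integrableI_nonneg) (use v in auto)
  have "set_integrable lebesgue K v" if K: "compact K" for K
  proof (cases "K = {}")
    case False
    have "continuous_on K \<theta>" using cont_weight continuous_on_subset by blast
    then obtain x0 where x0: "x0 \<in> K" "\<And>x. x \<in> K \<Longrightarrow> \<theta> x0 \<le> \<theta> x"
      using continuous_attains_inf[OF K False] by blast
    have [measurable]: "K \<in> sets lebesgue" using K by (simp add: compact_imp_closed)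
    have fin: "emeasure lebesgue K < \<infinity>"
      using K emeasure_compact_finite[OF K] by (simp add: compact_imp_closed)
    have ind: "integrable lebesgue (indicator K :: 'a \<Rightarrow> real)"
      using fin by (simp add: integrable_indicator_iff)
    show ?thesis unfolding set_integrable_def
    proof (rule Bochner_Integration.integrable_bound)
      show "integrable lebesgue (\<lambda>x. (indicator K x + (\<theta> x * norm (v x)) powr p) / \<theta> x0)"
        using ind int by auto
      have "norm (indicator K x *\<^sub>R v x) \<le> (indicator K x + (\<theta> x * norm (v x)) powr p) / \<theta> x0" for x
      proof (cases "x \<in> K")
        case True
        have le: "u \<le> 1 + u powr p" if "0 \<le> u" for u
        proof (cases "u \<le> 1")
          case False
          then show ?thesis using powr_mono[of 1 p u] p_ge_1 by simp
        qed (use powr_ge_zero[of u p] in linarith)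
        have "\<theta> x0 * norm (v x) \<le> \<theta> x * norm (v x)"
          using x0 True by (intro mult_right_mono) auto
        also have "\<dots> \<le> 1 + (\<theta> x * norm (v x)) powr p"
          using weight_pos[of x] by (intro le) auto
        finally show ?thesis using weight_pos[of x0] True by (simp add: field_simps)
      qed (use weight_pos[of x0] in auto)
      note bound = this
      show "AE x in lebesgue. norm (indicator K x *\<^sub>R v x)
          \<le> norm ((indicator K x + (\<theta> x * norm (v x)) powr p) / \<theta> x0)"
        using order_trans[OF bound abs_ge_self] by (simp only: real_norm_def eventually_True)
    qed auto
  qed auto
  then show "v \<in> Lp_space p \<theta>" using int by (auto simp: Lp_space_def locally_L1_def)
qed

lemma Lp_measurable: "v \<in> Lp_space p \<theta> \<Longrightarrow> v \<in> borel_measurable lebesgue"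
  by (simp add: Lp_space_iff)

lemma Lp_norm_nonneg [simp]: "0 \<le> Lp_norm p \<theta> v"
  by (simp add: Lp_norm_def)

lemma Lp_nn_eq:
  assumes "v \<in> Lp_space p \<theta>"
  shows "Lp_nn v = ennreal (Lp_norm p \<theta> v powr p)"
proof -
  have int: "integrable lebesgue (\<lambda>x. (\<theta> x * norm (v x)) powr p)"
    using assms by (simp add: Lp_space_def)
  have "Lp_nn v = ennreal (LINT x|lebesgue. (\<theta> x * norm (v x)) powr p)"
    by (rule nn_integral_eq_integral[OF int]) auto
  also have "(LINT x|lebesgue. (\<theta> x * norm (v x)) powr p) = Lp_norm p \<theta> v powr p"
    using p_ge_1 by (simp add: Lp_norm_def powr_powr)
  finally show ?thesis .
qed

lemma Lp_normI:
  assumes "v \<in> borel_measurable lebesgue" "Lp_nn v \<le> ennreal (c powr p)" "0 \<le> c"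
  shows "v \<in> Lp_space p \<theta>" "Lp_norm p \<theta> v \<le> c"
proof -
  show v: "v \<in> Lp_space p \<theta>"
    using assms by (auto simp: Lp_space_iff intro: order.strict_trans1)
  have "Lp_norm p \<theta> v powr p \<le> c powr p"
    using assms(2) by (simp add: Lp_nn_eq[OF v])
  then show "Lp_norm p \<theta> v \<le> c"
    using p_ge_1 assms(3) powr_less_mono2[of p c "Lp_norm p \<theta> v"] by linarith
qed

lemma Lp_cong_AE:
  assumes "v \<in> Lp_space p \<theta>" "AE x in lebesgue. w x = v x"
  shows "w \<in> Lp_space p \<theta>" "Lp_norm p \<theta> w = Lp_norm p \<theta> v"
proof -
  have w: "w \<in> borel_measurable lebesgue"
    using lebesgue_measurable_cong_AE assms Lp_measurable by blast
  have nn: "Lp_nn w = Lp_nn v" using assms(2) by (intro nn_integral_cong_AE) auto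
  show w': "w \<in> Lp_space p \<theta>" using w nn assms(1) by (simp add: Lp_space_iff)
  have "(LINT x|lebesgue. (\<theta> x * norm (w x)) powr p) = (LINT x|lebesgue. (\<theta> x * norm (v x)) powr p)"
  proof (rule integral_cong_AE)
    have [measurable]: "w \<in> borel_measurable lebesgue" "v \<in> borel_measurable lebesgue"
      using w assms(1) Lp_measurable by auto
    show "(\<lambda>x. (\<theta> x * norm (w x)) powr p) \<in> borel_measurable lebesgue"
      "(\<lambda>x. (\<theta> x * norm (v x)) powr p) \<in> borel_measurable lebesgue" by measurable
  qed (use assms(2) in auto)
  then show "Lp_norm p \<theta> w = Lp_norm p \<theta> v" by (simp add: Lp_norm_def)
qed

lemma Lp_ex_borel:
  fixes v :: "'a \<Rightarrow> 'b::euclidean_space"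
  assumes "v \<in> Lp_space p \<theta>"
  obtains w where "w \<in> borel_measurable borel" "AE x in lebesgue. v x = w x" "w \<in> Lp_space p \<theta>"
    "Lp_norm p \<theta> w = Lp_norm p \<theta> v"
proof -
  obtain w where w: "w \<in> borel_measurable borel" "AE x in lebesgue. v x = w x"
    using lebesgue_measurable_ex_borel[OF Lp_measurable[OF assms]] by blast
  have "AE x in lebesgue. w x = v x" using w(2) by eventually_elim auto
  from Lp_cong_AE[OF assms this] w show ?thesis by (intro that[of w]) auto
qed

lemma Lp_bound:
  fixes v :: "'a \<Rightarrow> 'b::euclidean_space" and w :: "'a \<Rightarrow> 'c::euclidean_space"
  assumes v: "v \<in> Lp_space p \<theta>" and w: "w \<in> borel_measurable lebesgue"
    and le: "AE x in lebesgue. norm (w x) \<le> c * norm (v x)" and c: "0 \<le> c"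
  shows "w \<in> Lp_space p \<theta>" "Lp_norm p \<theta> w \<le> c * Lp_norm p \<theta> v"
proof -
  have [measurable]: "v \<in> borel_measurable lebesgue" using v by (rule Lp_measurable)
  have "Lp_nn w \<le> (\<integral>\<^sup>+x. ennreal (c powr p) * ennreal ((\<theta> x * norm (v x)) powr p) \<partial>lebesgue)"
  proof (intro nn_integral_mono_AE)
    show "AE x in lebesgue. ennreal ((\<theta> x * norm (w x)) powr p)
        \<le> ennreal (c powr p) * ennreal ((\<theta> x * norm (v x)) powr p)"
      using le
    proof eventually_elim
      case (elim x)
      have "\<theta> x * norm (w x) \<le> c * (\<theta> x * norm (v x))"
        using mult_left_mono[OF elim, of "\<theta> x"] weight_pos[of x] by (simp add: algebra_simps)
      then have "(\<theta> x * norm (w x)) powr p \<le> (c * (\<theta> x * norm (v x))) powr p"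
        using weight_pos[of x] p_ge_1 by (intro powr_mono2) auto
      then show ?case using c weight_pos[of x]
        by (simp add: powr_mult ennreal_leI flip: ennreal_mult')
    qed
  qed
  also have "\<dots> = ennreal (c powr p) * Lp_nn v" by (rule nn_integral_cmult) measurable
  also have "\<dots> = ennreal ((c * Lp_norm p \<theta> v) powr p)"
    unfolding Lp_nn_eq[OF v] using c by (simp add: powr_mult ennreal_mult')
  finally have "Lp_nn w \<le> ennreal ((c * Lp_norm p \<theta> v) powr p)" .
  from Lp_normI[OF w this] c
  show "w \<in> Lp_space p \<theta>" "Lp_norm p \<theta> w \<le> c * Lp_norm p \<theta> v" by auto
qed

lemma Lp_add:
  fixes v w :: "'a \<Rightarrow> 'b::euclidean_space"
  assumes v: "v \<in> Lp_space p \<theta>" and w: "w \<in> Lp_space p \<theta>"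
  shows "(\<lambda>x. v x + w x) \<in> Lp_space p \<theta>"
    "Lp_norm p \<theta> (\<lambda>x. v x + w x) \<le> Lp_norm p \<theta> v + Lp_norm p \<theta> w"
proof -
  have [measurable]: "v \<in> borel_measurable lebesgue" "w \<in> borel_measurable lebesgue"
    using v w by (auto dest: Lp_measurable)
  have m: "(\<lambda>x. v x + w x) \<in> borel_measurable lebesgue" by measurable
  \<comment> \<open>\<open>powr_add_convex\<close> needs positive \<open>a\<close> and
    \<open>b\<close> while the norms may vanish; hence arbitrary positive upper bounds here, which
    shrink to the norms at the end.\<close>
  have *: "Lp_nn (\<lambda>x. v x + w x) \<le> ennreal ((a + b) powr p)"
    if ab: "Lp_norm p \<theta> v \<le> a" "Lp_norm p \<theta> w \<le> b" "0 < a" "0 < b" for a b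
  proof -
    have "Lp_nn (\<lambda>x. v x + w x) \<le> (\<integral>\<^sup>+x. ennreal ((a + b) powr (p - 1)) *
        (ennreal (a powr (1 - p)) * ennreal ((\<theta> x * norm (v x)) powr p)
        + ennreal (b powr (1 - p)) * ennreal ((\<theta> x * norm (w x)) powr p)) \<partial>lebesgue)"
    proof (intro nn_integral_mono)
      fix x
      have "\<theta> x * norm (v x + w x) \<le> \<theta> x * norm (v x) + \<theta> x * norm (w x)"
        using mult_left_mono[OF norm_triangle_ineq[of "v x" "w x"], of "\<theta> x"] weight_pos[of x]
        by (simp add: algebra_simps)
      then have "(\<theta> x * norm (v x + w x)) powr p \<le> (\<theta> x * norm (v x) + \<theta> x * norm (w x)) powr p"
        using weight_pos[of x] p_ge_1 by (intro powr_mono2) auto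
      also have "\<dots> \<le> (a + b) powr (p - 1) * (a powr (1 - p) * (\<theta> x * norm (v x)) powr p
           + b powr (1 - p) * (\<theta> x * norm (w x)) powr p)"
        using weight_pos[of x] p_ge_1 ab by (intro powr_add_convex) auto
      finally show "ennreal ((\<theta> x * norm (v x + w x)) powr p) \<le> ennreal ((a + b) powr (p - 1)) *
        (ennreal (a powr (1 - p)) * ennreal ((\<theta> x * norm (v x)) powr p)
        + ennreal (b powr (1 - p)) * ennreal ((\<theta> x * norm (w x)) powr p))"
        by (simp add: ennreal_leI flip: ennreal_mult' ennreal_plus)
    qed
    also have "\<dots> = ennreal ((a + b) powr (p - 1)) * (ennreal (a powr (1 - p)) * Lp_nn v
        + ennreal (b powr (1 - p)) * Lp_nn w)"
      by (simp add: nn_integral_cmult nn_integral_add)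
    also have "\<dots> = ennreal ((a + b) powr (p - 1) * (a powr (1 - p) * Lp_norm p \<theta> v powr p
        + b powr (1 - p) * Lp_norm p \<theta> w powr p))"
      by (simp add: Lp_nn_eq[OF v] Lp_nn_eq[OF w] flip: ennreal_mult' ennreal_plus)
    also have "\<dots> \<le> ennreal ((a + b) powr (p - 1) * (a powr (1 - p) * a powr p + b powr (1 - p) * b powr p))"
      using p_ge_1 ab
      by (intro ennreal_leI mult_left_mono add_mono powr_mono2) auto
    also have "a powr (1 - p) * a powr p + b powr (1 - p) * b powr p = a + b"
      using ab by (simp flip: powr_add)
    also have "(a + b) powr (p - 1) * (a + b) = (a + b) powr p"
      using ab by (simp add: powr_diff)
    finally show ?thesis .
  qed
  show "(\<lambda>x. v x + w x) \<in> Lp_space p \<theta>"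
    by (rule Lp_normI(1)[OF m *[of "Lp_norm p \<theta> v + 1" "Lp_norm p \<theta> w + 1"]])
      (auto intro!: add_nonneg_nonneg add_nonneg_pos)
  show "Lp_norm p \<theta> (\<lambda>x. v x + w x) \<le> Lp_norm p \<theta> v + Lp_norm p \<theta> w"
  proof (rule field_le_epsilon)
    fix e :: real assume e: "e > 0"
    have "Lp_norm p \<theta> (\<lambda>x. v x + w x) \<le> (Lp_norm p \<theta> v + e / 2) + (Lp_norm p \<theta> w + e / 2)"
      by (rule Lp_normI(2)[OF m *]) (use e in \<open>auto intro!: add_nonneg_nonneg add_nonneg_pos\<close>)
    then show "Lp_norm p \<theta> (\<lambda>x. v x + w x) \<le> Lp_norm p \<theta> v + Lp_norm p \<theta> w + e" by simp
  qed
qed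

lemma Lp_scaleR:
  fixes v :: "'a \<Rightarrow> 'b::euclidean_space"
  assumes v: "v \<in> Lp_space p \<theta>"
  shows "(\<lambda>x. c *\<^sub>R v x) \<in> Lp_space p \<theta>" "Lp_norm p \<theta> (\<lambda>x. c *\<^sub>R v x) \<le> \<bar>c\<bar> * Lp_norm p \<theta> v"
  using Lp_bound[OF v, of "\<lambda>x. c *\<^sub>R v x" "\<bar>c\<bar>"] Lp_measurable[OF v] by auto

lemma Lp_diff:
  fixes v w :: "'a \<Rightarrow> 'b::euclidean_space"
  assumes v: "v \<in> Lp_space p \<theta>" and w: "w \<in> Lp_space p \<theta>"
  shows "(\<lambda>x. v x - w x) \<in> Lp_space p \<theta>"
    "Lp_norm p \<theta> (\<lambda>x. v x - w x) \<le> Lp_norm p \<theta> v + Lp_norm p \<theta> w"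
    "Lp_norm p \<theta> (\<lambda>x. v x - w x) = Lp_norm p \<theta> (\<lambda>x. w x - v x)"
  using Lp_add[OF v Lp_scaleR(1)[OF w, of "-1"]] Lp_scaleR(2)[OF w, of "-1"]
  by (auto simp: Lp_norm_def norm_minus_commute)

lemma Lp_zero: "(\<lambda>x. 0) \<in> Lp_space p \<theta>" "Lp_norm p \<theta> (\<lambda>x. 0) = 0"
  using p_ge_1 by (auto simp: Lp_space_iff Lp_norm_def)

lemma Lp_sum:
  fixes v :: "'i \<Rightarrow> 'a \<Rightarrow> 'b::euclidean_space"
  assumes "\<And>i. i \<in> I \<Longrightarrow> v i \<in> Lp_space p \<theta>" "finite I"
  shows "(\<lambda>x. \<Sum>i\<in>I. v i x) \<in> Lp_space p \<theta>"
    "Lp_norm p \<theta> (\<lambda>x. \<Sum>i\<in>I. v i x) \<le> (\<Sum>i\<in>I. Lp_norm p \<theta> (v i))"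
  using assms(2,1)
proof (induction I rule: finite_induct)
  case empty
  { case 1 then show ?case by (simp add: Lp_zero) }
  { case 2 then show ?case by (simp add: Lp_zero) }
next
  case (insert i I)
  { case 1 then show ?case using insert Lp_add(1)[of "v i" "\<lambda>x. \<Sum>i\<in>I. v i x"] by simp }
  { case 2 then show ?case using insert Lp_add(2)[of "v i" "\<lambda>x. \<Sum>i\<in>I. v i x"] by force }
qed

lemma Lp_norm_eq_0_imp_AE:
  fixes v :: "'a \<Rightarrow> 'b::euclidean_space"
  assumes v: "v \<in> Lp_space p \<theta>" and 0: "Lp_norm p \<theta> v = 0"
  shows "AE x in lebesgue. v x = 0"
proof -
  have [measurable]: "v \<in> borel_measurable lebesgue" using v by (rule Lp_measurable)
  have "Lp_nn v = 0" using Lp_nn_eq[OF v] 0 p_ge_1 by simp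
  then have "AE x in lebesgue. ennreal ((\<theta> x * norm (v x)) powr p) = 0"
    by (subst (asm) nn_integral_0_iff_AE) auto
  then show ?thesis
  proof eventually_elim
    case (elim x)
    then show ?case using weight_pos[of x] by (auto simp: ennreal_eq_0_iff)
  qed
qed

text \<open>The limit inherits the bound \<open>b\<close>, so the \<open>p\<close>-th powers of the
  differences are dominated by \<open>2 powr p\<close> times that of \<open>b\<close>, and the
  scalar theorem applies.\<close>

lemma Lp_dominated_convergence:
  fixes u :: "nat \<Rightarrow> 'a \<Rightarrow> 'b::euclidean_space" and b :: "'a \<Rightarrow> real"
  assumes u: "\<And>n. u n \<in> borel_measurable lebesgue" and v: "v \<in> borel_measurable lebesgue"
    and b: "b \<in> Lp_space p \<theta>" and le: "\<And>n. AE x in lebesgue. norm (u n x) \<le> b x"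
    and lim: "AE x in lebesgue. (\<lambda>n. u n x) \<longlonglongrightarrow> v x"
  shows "v \<in> Lp_space p \<theta>" "\<And>n. u n \<in> Lp_space p \<theta>" "(\<lambda>n. Lp_norm p \<theta> (\<lambda>x. u n x - v x)) \<longlonglongrightarrow> 0"
proof -
  have [measurable]: "u n \<in> borel_measurable lebesgue" "v \<in> borel_measurable lebesgue"
    "b \<in> borel_measurable lebesgue" for n
    using u v b by (auto dest: Lp_measurable)
  have le': "AE x in lebesgue. \<forall>n. norm (u n x) \<le> b x"
    using le by (simp add: AE_all_countable)
  have lev: "AE x in lebesgue. norm (v x) \<le> b x"
    using le' lim
  proof eventually_elim
    case (elim x)
    have "(\<lambda>n. norm (u n x)) \<longlonglongrightarrow> norm (v x)" using elim by (intro tendsto_norm) auto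
    then show ?case by (rule LIMSEQ_le_const2) (use elim in auto)
  qed
  have bn: "\<And>x. b x \<le> norm (b x)" by simp
  show "v \<in> Lp_space p \<theta>"
    by (rule Lp_bound(1)[OF b v, of 1]) (use lev in \<open>auto elim: eventually_mono intro: order_trans[OF _ bn]\<close>)
  show "u n \<in> Lp_space p \<theta>" for n
    by (rule Lp_bound(1)[OF b u, of n 1]) (use le[of n] in \<open>auto elim: eventually_mono intro: order_trans[OF _ bn]\<close>)
  have intb: "integrable lebesgue (\<lambda>x. (\<theta> x * norm (b x)) powr p)" using b by (simp add: Lp_space_def)
  have "(\<lambda>n. LINT x|lebesgue. (\<theta> x * norm (u n x - v x)) powr p) \<longlonglongrightarrow> (LINT x|(lebesgue::'a measure). 0)"
  proof (rule integral_dominated_convergence[where w="\<lambda>x. 2 powr p * (\<theta> x * norm (b x)) powr p"])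
    show "integrable lebesgue (\<lambda>x. 2 powr p * (\<theta> x * norm (b x)) powr p)" using intb by simp
    show "AE x in lebesgue. (\<lambda>n. (\<theta> x * norm (u n x - v x)) powr p) \<longlonglongrightarrow> 0"
      using lim
    proof eventually_elim
      case (elim x)
      have "(\<lambda>n. \<theta> x * norm (u n x - v x)) \<longlonglongrightarrow> \<theta> x * norm (v x - v x)"
        using elim by (intro tendsto_intros)
      then have "(\<lambda>n. (\<theta> x * norm (u n x - v x)) powr p) \<longlonglongrightarrow> 0 powr p"
        using p_ge_1 weight_pos[of x] by (intro tendsto_powr') (auto simp: less_imp_le)
      then show ?case by simp
    qed
    show "AE x in lebesgue. norm ((\<theta> x * norm (u n x - v x)) powr p) \<le> 2 powr p * (\<theta> x * norm (b x)) powr p" for n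
      using le[of n] lev
    proof eventually_elim
      case (elim x)
      have "norm (u n x - v x) \<le> 2 * norm (b x)"
        using elim norm_triangle_ineq4[of "u n x" "v x"] by auto
      then have "\<theta> x * norm (u n x - v x) \<le> 2 * (\<theta> x * norm (b x))"
        using mult_left_mono[of _ "2 * norm (b x)" "\<theta> x"] weight_pos[of x] by (simp add: algebra_simps)
      then have "(\<theta> x * norm (u n x - v x)) powr p \<le> (2 * (\<theta> x * norm (b x))) powr p"
        using weight_pos[of x] p_ge_1 by (intro powr_mono2) auto
      then show ?case using weight_pos[of x] by (simp add: powr_mult)
    qed
  qed measurable
  then have "(\<lambda>n. LINT x|lebesgue. (\<theta> x * norm (u n x - v x)) powr p) \<longlonglongrightarrow> 0" by simp
  then have "(\<lambda>n. (LINT x|lebesgue. (\<theta> x * norm (u n x - v x)) powr p) powr (1 / p)) \<longlonglongrightarrow> 0 powr (1 / p)"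
    using p_ge_1 by (intro tendsto_powr') (auto intro: always_eventually)
  then show "(\<lambda>n. Lp_norm p \<theta> (\<lambda>x. u n x - v x)) \<longlonglongrightarrow> 0"
    by (simp add: Lp_norm_def)
qed


end

section \<open>Minkowski's integral inequality and dense classes\<close>

context weighted_Lp
begin

text \<open>Minkowski's integral inequality. At fixed \<open>x\<close> the weighted Hoelder
  inequality with weight \<open>c t\<close>, a bound for the norm of \<open>w t\<close>, puts the
  \<open>p\<close>-th power under the integral; by Tonelli's theorem the result is at most
  \<open>C powr (p - 1)\<close> times the integral of \<open>c\<close>. The same quantity, being
  finite almost everywhere, gives integrability in \<open>t\<close>.\<close>

lemma Lp_integral:
  fixes w :: "'t \<Rightarrow> 'a \<Rightarrow> 'b::euclidean_space"
  assumes sf: "sigma_finite_measure M"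
    and wm: "(\<lambda>(t, x). w t x) \<in> borel_measurable (M \<Otimes>\<^sub>M borel)"
    and cm [measurable]: "c \<in> borel_measurable M" and c: "\<And>t. 0 \<le> c t" "\<And>t x. c t = 0 \<Longrightarrow> w t x = 0"
    and w: "\<And>t. t \<in> space M \<Longrightarrow> w t \<in> Lp_space p \<theta>" "\<And>t. t \<in> space M \<Longrightarrow> Lp_norm p \<theta> (w t) \<le> c t"
    and C: "(\<integral>\<^sup>+t. ennreal (c t) \<partial>M) \<le> ennreal C" "C > 0"
  shows "AE x in lebesgue. integrable M (\<lambda>t. w t x)"
    "(\<lambda>x. LINT t|M. w t x) \<in> borel_measurable borel"
    "(\<lambda>x. LINT t|M. w t x) \<in> Lp_space p \<theta>" "Lp_norm p \<theta> (\<lambda>x. LINT t|M. w t x) \<le> C"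
proof -
  interpret sigma_finite_measure M by fact
  interpret pair_sigma_finite M lborel by standard
  have wm'[measurable]: "(\<lambda>z. w (snd z) (fst z)) \<in> borel_measurable (borel \<Otimes>\<^sub>M M)"
    using wm by (subst measurable_pair_swap_iff) (simp add: case_prod_beta')
  have [measurable]: "(\<lambda>t. w t x) \<in> borel_measurable M" for x
    using measurable_compose[OF measurable_Pair2'[of x borel M] wm] by simp
  show m: "(\<lambda>x. LINT t|M. w t x) \<in> borel_measurable borel"
    using sigma_finite_measure.borel_measurable_lebesgue_integral[OF sf, of "\<lambda>x t. w t x" borel] wm' by (simp add: case_prod_beta')
  then have m': "(\<lambda>x. LINT t|M. w t x) \<in> borel_measurable lebesgue"
    by (rule borel_imp_lebesgue_measurable)
  \<comment> \<open>The right side of the Hoelder inequality at the point \<open>x\<close>.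
    Integrating it over \<open>x\<close> first leaves \<open>c t powr (1 - p)\<close> times the
    \<open>p\<close>-th power of the norm of \<open>w t\<close>, which is at most
    \<open>c t\<close>.\<close>
  define G where "G x = (\<integral>\<^sup>+t. ennreal (c t powr (1 - p) * (\<theta> x * norm (w t x)) powr p) \<partial>M)" for x
  have Gm [measurable]: "G \<in> borel_measurable borel"
  proof -
    have "(\<lambda>z. ennreal (c (snd z) powr (1 - p) * (\<theta> (fst z) * norm (w (snd z) (fst z))) powr p))
        \<in> borel_measurable (borel \<Otimes>\<^sub>M M)" by measurable
    then show ?thesis
      unfolding G_def by (intro sigma_finite_measure.borel_measurable_nn_integral[OF sf]) (simp add: case_prod_beta')
  qed
  have [measurable]: "(\<lambda>z. w (fst z) (snd z)) \<in> borel_measurable (M \<Otimes>\<^sub>M borel)"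
    using wm by (simp add: case_prod_beta')
  have "(\<lambda>z. ennreal (c (fst z) powr (1 - p) * (\<theta> (snd z) * norm (w (fst z) (snd z))) powr p))
        \<in> borel_measurable (M \<Otimes>\<^sub>M borel)" by measurable
  then have "(\<integral>\<^sup>+x. G x \<partial>lborel) = (\<integral>\<^sup>+t. \<integral>\<^sup>+x. ennreal (c t powr (1 - p) * (\<theta> x * norm (w t x)) powr p) \<partial>lborel \<partial>M)"
    unfolding G_def by (intro Fubini') (simp add: case_prod_beta')
  also have "\<dots> = (\<integral>\<^sup>+t. ennreal (c t powr (1 - p)) * Lp_nn (w t) \<partial>M)"
  proof (intro nn_integral_cong)
    fix t assume t: "t \<in> space M"
    then have [measurable]: "w t \<in> borel_measurable borel"
      using measurable_compose[OF measurable_Pair1'[OF t, of borel] wm] by (simp only: prod.case)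
    show "(\<integral>\<^sup>+x. ennreal (c t powr (1 - p) * (\<theta> x * norm (w t x)) powr p) \<partial>lborel)
        = ennreal (c t powr (1 - p)) * Lp_nn (w t)"
      unfolding nn_integral_completion ennreal_mult'[OF powr_ge_zero]
      by (rule nn_integral_cmult) measurable
  qed
  also have "\<dots> \<le> (\<integral>\<^sup>+t. ennreal (c t) \<partial>M)"
  proof (intro nn_integral_mono)
    fix t assume t: "t \<in> space M"
    show "ennreal (c t powr (1 - p)) * Lp_nn (w t) \<le> ennreal (c t)"
    proof (cases "c t = 0")
      case False
      then have ct: "c t > 0" using c(1)[of t] by simp
      have "c t powr (1 - p) * Lp_norm p \<theta> (w t) powr p \<le> c t powr (1 - p) * c t powr p"
        using w(2)[OF t] p_ge_1 by (intro mult_left_mono powr_mono2) auto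
      also have "\<dots> = c t" using ct by (simp flip: powr_add)
      finally show ?thesis
        unfolding Lp_nn_eq[OF w(1)[OF t]] by (simp add: ennreal_leI flip: ennreal_mult')
    qed auto
  qed
  finally have G: "(\<integral>\<^sup>+x. G x \<partial>lborel) \<le> ennreal C" using C by (blast intro: order_trans)
  have "AE x in lborel. G x \<noteq> \<infinity>"
    by (rule nn_integral_noteq_infinite) (use G in \<open>auto simp: top_unique\<close>)
  then have "AE x in lborel. integrable M (\<lambda>t. w t x)"
  proof eventually_elim
    case (elim x)
    have "integrable M (\<lambda>t. \<theta> x * norm (w t x))"
      by (rule weighted_Hoelder_integrable[OF _ cm _ c(1) _ p_ge_1 C(1)])
        (use elim weight_pos[of x] c(2) in \<open>auto simp: G_def less_top\<close>)
    then have "integrable M (\<lambda>t. norm (w t x))" using weight_pos[of x] by simp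
    then show ?case by (subst (asm) integrable_norm_iff) auto
  qed
  then show "AE x in lebesgue. integrable M (\<lambda>t. w t x)" by (simp add: AE_completion_iff)
  have "Lp_nn (\<lambda>x. LINT t|M. w t x) = (\<integral>\<^sup>+x. ennreal ((\<theta> x * norm (LINT t|M. w t x)) powr p) \<partial>lborel)"
    by (rule nn_integral_completion)
  also have "\<dots> \<le> (\<integral>\<^sup>+x. ennreal (C powr (p - 1)) * G x \<partial>lborel)"
  proof (intro nn_integral_mono)
    fix x
    have "\<theta> x * norm (LINT t|M. w t x) \<le> (LINT t|M. \<theta> x * norm (w t x))"
      using integral_norm_bound[of M "\<lambda>t. w t x"] weight_pos[of x] by simp
    then have "(\<theta> x * norm (LINT t|M. w t x)) powr p \<le> (LINT t|M. \<theta> x * norm (w t x)) powr p"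
      using weight_pos[of x] p_ge_1 by (intro powr_mono2) auto
    then have "ennreal ((\<theta> x * norm (LINT t|M. w t x)) powr p) \<le> ennreal ((LINT t|M. \<theta> x * norm (w t x)) powr p)"
      by (rule ennreal_leI)
    also have "\<dots> \<le> ennreal (C powr (p - 1)) * G x"
      unfolding G_def
      by (rule weighted_Hoelder[OF _ cm _ c(1) _ p_ge_1 C]) (use weight_pos[of x] c(2) in auto)
    finally show "ennreal ((\<theta> x * norm (LINT t|M. w t x)) powr p) \<le> ennreal (C powr (p - 1)) * G x" .
  qed
  also have "\<dots> = ennreal (C powr (p - 1)) * (\<integral>\<^sup>+x. G x \<partial>lborel)" by (rule nn_integral_cmult) simp
  also have "\<dots> \<le> ennreal (C powr (p - 1)) * ennreal C" using G by (rule mult_left_mono) simp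
  also have "\<dots> = ennreal (C powr p)" using C by (simp add: powr_diff flip: ennreal_mult')
  finally have "Lp_nn (\<lambda>x. LINT t|M. w t x) \<le> ennreal (C powr p)" .
  from Lp_normI[OF m' this] C show "(\<lambda>x. LINT t|M. w t x) \<in> Lp_space p \<theta>"
    "Lp_norm p \<theta> (\<lambda>x. LINT t|M. w t x) \<le> C" by auto
qed

lemma bounded_support_in_Lp:
  fixes u :: "'a \<Rightarrow> 'b::euclidean_space"
  assumes u: "u \<in> borel_measurable lebesgue" and le: "\<And>x. norm (u x) \<le> K * indicator (cball 0 R) x"
  shows "u \<in> Lp_space p \<theta>"
proof -
  have "compact (\<theta> ` cball 0 R)"
    using cont_weight by (intro compact_continuous_image) (auto intro: continuous_on_subset)
  then obtain B where B: "\<And>x. x \<in> cball 0 R \<Longrightarrow> \<theta> x \<le> B"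
    using bounded_imp_bdd_above[OF compact_imp_bounded] unfolding bdd_above_def by (metis imageI)
  have "Lp_nn u \<le> (\<integral>\<^sup>+x. ennreal ((B * K) powr p) * indicator (cball (0::'a) R) x \<partial>lebesgue)"
  proof (intro nn_integral_mono)
    fix x
    show "ennreal ((\<theta> x * norm (u x)) powr p) \<le> ennreal ((B * K) powr p) * indicator (cball 0 R) x"
    proof (cases "x \<in> cball 0 R")
      case True
      have "norm (u x) \<le> K" using le[of x] True by simp
      then have "\<theta> x * norm (u x) \<le> B * K"
        using B[OF True] weight_pos[of x] by (intro mult_mono) auto
      then show ?thesis using True weight_pos[of x] p_ge_1
        by (auto intro!: ennreal_leI powr_mono2)
    qed (use le[of x] in auto)
  qed
  also have "\<dots> < \<infinity>"
    using emeasure_compact_finite[of "cball 0 R :: 'a set"]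
    by (simp add: nn_integral_cmult_indicator ennreal_mult_less_top)
  finally show ?thesis using u by (simp add: Lp_space_iff)
qed

text \<open>Truncation in the argument and in the value at once; the truncated functions are
  dominated by \<open>v\<close> itself.\<close>

lemma Lp_dense_bounded_support:
  fixes v :: "'a \<Rightarrow> 'b::euclidean_space"
  assumes v: "v \<in> Lp_space p \<theta>" and e: "0 < e"
  obtains n where "Lp_norm p \<theta> (\<lambda>x. (if norm x \<le> real n \<and> norm (v x) \<le> real n then v x else 0) - v x) < e"
proof -
  let ?u = "\<lambda>n x. if norm x \<le> real n \<and> norm (v x) \<le> real n then v x else 0"
  have [measurable]: "v \<in> borel_measurable lebesgue" using v by (rule Lp_measurable)
  have [measurable]: "(\<lambda>x::'a. norm x) \<in> borel_measurable lebesgue"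
    by (intro borel_imp_lebesgue_measurable) measurable
  have "(\<lambda>n. Lp_norm p \<theta> (\<lambda>x. ?u n x - v x)) \<longlonglongrightarrow> 0"
  proof (rule Lp_dominated_convergence(3)[where b="\<lambda>x. norm (v x)"])
    show "(\<lambda>x. norm (v x)) \<in> Lp_space p \<theta>"
      by (rule Lp_bound(1)[OF v, of _ 1]) auto
    have "(\<lambda>n. ?u n x) \<longlonglongrightarrow> v x" for x
    proof (rule tendsto_eventually)
      show "eventually (\<lambda>n. ?u n x = v x) sequentially"
        using eventually_ge_at_top[of "nat \<lceil>max (norm x) (norm (v x))\<rceil>"]
        by eventually_elim (auto simp: nat_le_iff ceiling_le_iff)
    qed
    then show "AE x in lebesgue. (\<lambda>n. ?u n x) \<longlonglongrightarrow> v x" by simp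
  qed auto
  then have "eventually (\<lambda>n. Lp_norm p \<theta> (\<lambda>x. ?u n x - v x) < e) sequentially"
    using e by (rule order_tendstoD)
  then show ?thesis using that by (auto simp: eventually_sequentially)
qed

text \<open>A measurable function is an almost everywhere limit of continuous functions. Composing
  these with a retraction and a cutoff supplies the common bound that dominated convergence
  needs.\<close>

lemma Lp_dense_continuous:
  fixes v :: "'a \<Rightarrow> 'b::euclidean_space"
  assumes v: "v \<in> Lp_space p \<theta>" and e: "0 < e"
  obtains u R K where "continuous_on UNIV u" "\<And>x. norm (u x) \<le> K * indicator (cball 0 R) x" "0 \<le> K" "0 \<le> R"
    "Lp_norm p \<theta> (\<lambda>x. u x - v x) < e"
proof -
  obtain n where n: "Lp_norm p \<theta> (\<lambda>x. (if norm x \<le> real n \<and> norm (v x) \<le> real n then v x else 0) - v x) < e / 2"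
    using Lp_dense_bounded_support[OF v, of "e / 2"] e by auto
  define w where "w x = (if norm x \<le> real n \<and> norm (v x) \<le> real n then v x else 0)" for x
  have [measurable]: "v \<in> borel_measurable lebesgue" using v by (rule Lp_measurable)
  have [measurable]: "(\<lambda>x::'a. norm x) \<in> borel_measurable lebesgue"
    by (intro borel_imp_lebesgue_measurable) measurable
  have wm: "w \<in> borel_measurable lebesgue" unfolding w_def by measurable
  have "w measurable_on UNIV" using wm by (simp add: measurable_on_iff_borel_measurable)
  then obtain N g where N: "negligible N" and g: "\<And>k. continuous_on UNIV (g k)"
    "\<And>x. x \<notin> N \<Longrightarrow> (\<lambda>k. g k x) \<longlonglongrightarrow> w x"
    unfolding measurable_on_def by auto
  \<comment> \<open>The radial retraction onto the closed ball of radius \<open>n\<close>; for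
    \<open>n = 0\<close> it is constantly zero, also by the convention for division by zero.\<close>
  define m where "m y = (real n / max (real n) (norm y)) *\<^sub>R y" for y :: 'b
  \<comment> \<open>Equal to 1 on the ball of radius \<open>n\<close>, where \<open>w\<close> lives,
    and to 0 outside the ball of radius \<open>n + 1\<close>.\<close>
  define \<phi> where "\<phi> x = max 0 (min 1 (real n + 1 - norm x))" for x :: 'a
  define u where "u k x = \<phi> x *\<^sub>R m (g k x)" for k x
  have m0: "m y = y" if "norm y \<le> real n" for y
    using that by (cases "real n = 0") (auto simp: m_def max_def)
  have mle: "norm (m y) \<le> real n" for y
  proof (cases "norm y \<le> real n")
    case False
    then show ?thesis using less_imp_le[of "real n" "norm y"] by (auto simp: m_def max_def divide_simps)
  qed (simp add: m0)
  have mcont: "continuous_on UNIV m"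
  proof (cases "n = 0")
    case False
    then show ?thesis unfolding m_def by (intro continuous_intros) (auto simp: max_def)
  qed (simp add: m_def)
  have \<phi>cont: "continuous_on UNIV \<phi>" unfolding \<phi>_def by (intro continuous_intros)
  have ucont: "continuous_on UNIV (u k)" for k
    unfolding u_def
    by (intro continuous_on_scaleR \<phi>cont continuous_on_compose2[OF mcont g(1)]) auto
  have ule: "norm (u k x) \<le> real n * indicator (cball 0 (real n + 1)) x" for k x
  proof (cases "x \<in> cball 0 (real n + 1)")
    case True
    have "norm (u k x) \<le> 1 * real n"
      unfolding u_def norm_scaleR using mle[of "g k x"] by (intro mult_mono) (auto simp: \<phi>_def)
    then show ?thesis using True by simp
  next
    case False
    then have "\<phi> x = 0" by (auto simp: \<phi>_def)
    then show ?thesis by (simp add: u_def)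
  qed
  have wle: "norm (w x) \<le> real n" for x by (simp add: w_def)
  have ulim: "(\<lambda>k. u k x) \<longlonglongrightarrow> w x" if "x \<notin> N" for x
  proof -
    have "(\<lambda>k. m (g k x)) \<longlonglongrightarrow> m (w x)"
      by (rule continuous_on_tendsto_compose[OF mcont g(2)[OF that]]) auto
    then have "(\<lambda>k. u k x) \<longlonglongrightarrow> \<phi> x *\<^sub>R m (w x)" unfolding u_def by (intro tendsto_intros)
    moreover have "\<phi> x *\<^sub>R m (w x) = w x"
      using m0[OF wle[of x]] by (auto simp: w_def \<phi>_def)
    ultimately show ?thesis by simp
  qed
  have b: "(\<lambda>x. real n * indicator (cball 0 (real n + 1)) x :: real) \<in> Lp_space p \<theta>"
  proof (rule bounded_support_in_Lp[where K="real n" and R="real n + 1"])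
    show "(\<lambda>x::'a. real n * indicator (cball 0 (real n + 1)) x :: real) \<in> borel_measurable lebesgue"
      by (intro borel_imp_lebesgue_measurable borel_measurable_times borel_measurable_indicator) auto
  qed auto
  have um: "u k \<in> borel_measurable lebesgue" for k
    by (intro borel_imp_lebesgue_measurable borel_measurable_continuous_onI ucont)
  have ae: "AE x in lebesgue. (\<lambda>k. u k x) \<longlonglongrightarrow> w x"
    using N ulim by (intro AE_I'[of N]) (auto simp: negligible_iff_null_sets)
  have "(\<lambda>k. Lp_norm p \<theta> (\<lambda>x. u k x - w x)) \<longlonglongrightarrow> 0"
    by (rule Lp_dominated_convergence(3)[OF um wm b _ ae]) (use ule in simp)
  then have "eventually (\<lambda>k. Lp_norm p \<theta> (\<lambda>x. u k x - w x) < e / 2) sequentially"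
    using e by (intro order_tendstoD) auto
  then obtain k where k: "Lp_norm p \<theta> (\<lambda>x. u k x - w x) < e / 2"
    by (auto simp: eventually_sequentially)
  have uL: "u k \<in> Lp_space p \<theta>" by (rule Lp_dominated_convergence(2)[OF um wm b _ ae]) (use ule in simp)
  have wL: "w \<in> Lp_space p \<theta>" by (rule Lp_dominated_convergence(1)[OF um wm b _ ae]) (use ule in simp)
  have "Lp_norm p \<theta> (\<lambda>x. (u k x - w x) + (w x - v x)) \<le> Lp_norm p \<theta> (\<lambda>x. u k x - w x) + Lp_norm p \<theta> (\<lambda>x. w x - v x)"
    by (intro Lp_add Lp_diff uL wL v)
  also have "\<dots> < e" using k n by (simp add: w_def)
  finally show ?thesis using ule by (intro that[OF ucont[of k], of "real n" "real n + 1"]) auto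
qed

end

section \<open>Gaussian integrals\<close>

text \<open>Does the work of polar coordinates. Sublevel sets of \<open>c |y|^2\<close> are balls,
  so the volume of a ball is the distribution function of the left side; its derivative in the
  radius parameter is the density on the right. Half-lines form a generator stable under
  intersection, so agreement on them suffices.\<close>

lemma distr_scaled_norm_sq:
  fixes c :: real
  assumes c: "c > 0"
  defines "d \<equiv> real DIM('a::euclidean_space)"
  shows "distr lborel borel (\<lambda>y::'a. c * (norm y)\<^sup>2) =
    density lborel (\<lambda>s. ennreal (indicator {0..} s * ((pi / c) powr (d / 2) / Gamma (d / 2)) * s powr (d / 2 - 1)))"
    (is "?M = density lborel ?f")
proof (rule measure_eqI_generator_eq)
  let ?E = "range (\<lambda>a::real. {..a})"
  have d: "d > 0" by (simp add: d_def)
  have [measurable]: "?f \<in> borel_measurable borel" by measurable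
  have M: "emeasure ?M {..r} = (if r < 0 then 0 else ennreal ((pi / c) powr (d / 2) / Gamma (d / 2 + 1) * r powr (d / 2)))" for r
  proof -
    have "emeasure ?M {..r} = emeasure lborel {y::'a. c * (norm y)\<^sup>2 \<le> r}"
      by (subst emeasure_distr) (auto simp: vimage_def)
    also have "\<dots> = (if r < 0 then 0 else ennreal ((pi / c) powr (d / 2) / Gamma (d / 2 + 1) * r powr (d / 2)))"
    proof (cases "r < 0")
      case True
      have "\<not> c * (norm y)\<^sup>2 \<le> r" for y :: 'a
        using True c mult_nonneg_nonneg[of c "(norm y)\<^sup>2"] by (simp del: zero_le_mult_iff mult_nonneg_nonneg)
      then show ?thesis using True by simp
    next
      case False
      have "c * (norm y)\<^sup>2 \<le> r \<longleftrightarrow> norm y \<le> sqrt (r / c)" for y :: 'a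
      proof -
        have "c * (norm y)\<^sup>2 \<le> r \<longleftrightarrow> (norm y)\<^sup>2 \<le> r / c" using c by (simp add: field_simps)
        also have "\<dots> \<longleftrightarrow> sqrt ((norm y)\<^sup>2) \<le> sqrt (r / c)" by (simp only: real_sqrt_le_iff)
        finally show ?thesis by simp
      qed
      then have "{y::'a. c * (norm y)\<^sup>2 \<le> r} = {y. norm y \<le> sqrt (r / c)}" by (simp only:)
      also have "\<dots> = cball 0 (sqrt (r / c))" by (simp add: cball_def)
      finally have "{y::'a. c * (norm y)\<^sup>2 \<le> r} = cball 0 (sqrt (r / c))" .
      moreover have "emeasure lborel (cball (0::'a) (sqrt (r / c))) = ennreal (unit_ball_vol d * sqrt (r / c) ^ DIM('a))"
        using False c unfolding d_def by (intro emeasure_cball) auto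
      moreover have "unit_ball_vol d * sqrt (r / c) ^ DIM('a) = (pi / c) powr (d / 2) / Gamma (d / 2 + 1) * r powr (d / 2)"
      proof (cases "r = 0")
        case True then show ?thesis by simp
      next
        case False2: False
        have "sqrt (r / c) ^ DIM('a) = (r / c) powr (d / 2)"
          using False False2 c by (simp add: d_def powr_realpow[symmetric] powr_half_sqrt[symmetric] powr_powr)
        then show ?thesis using False False2 c by (simp add: unit_ball_vol_def powr_divide)
      qed
      ultimately show ?thesis using False by simp
    qed
    finally show ?thesis .
  qed
  have N: "emeasure (density lborel ?f) {..r} = (if r < 0 then 0 else ennreal ((pi / c) powr (d / 2) / Gamma (d / 2 + 1) * r powr (d / 2)))" for r
  proof -
    have "emeasure (density lborel ?f) {..r} = (\<integral>\<^sup>+s. ?f s * indicator {..r} s \<partial>lborel)"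
      by (rule emeasure_density) auto
    also have "\<dots> = (if r < 0 then 0 else ennreal ((pi / c) powr (d / 2) / Gamma (d / 2 + 1) * r powr (d / 2)))"
    proof (cases "r < 0")
      case True
      then have "(\<lambda>s. ?f s * indicator {..r} s) = (\<lambda>_. 0)" by (auto simp: fun_eq_iff indicator_def)
      then show ?thesis using True by simp
    next
      case False
      let ?K = "(pi / c) powr (d / 2) / Gamma (d / 2)"
      have "((\<lambda>s. s powr (d / 2 - 1)) has_integral (r powr (d / 2 - 1 + 1) / (d / 2 - 1 + 1))) {0..r}"
        using d False by (intro has_integral_powr_from_0) auto
      then have "((\<lambda>s. ?K * s powr (d / 2 - 1)) has_integral (?K * (r powr (d / 2) / (d / 2)))) {0..r}"
        by (intro has_integral_mult_right) simp
      then have "(\<integral>\<^sup>+s. ennreal (indicator {0..r} s * (?K * s powr (d / 2 - 1))) \<partial>lborel) = ennreal (?K * (r powr (d / 2) / (d / 2)))"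
        using d by (intro nn_integral_has_integral_lebesgue) (auto intro!: divide_nonneg_pos mult_nonneg_nonneg Gamma_real_pos)
      moreover have "(\<lambda>s. ?f s * indicator {..r} s) = (\<lambda>s. ennreal (indicator {0..r} s * (?K * s powr (d / 2 - 1))))"
        by (auto simp: fun_eq_iff indicator_def)
      moreover have "?K * (r powr (d / 2) / (d / 2)) = (pi / c) powr (d / 2) / Gamma (d / 2 + 1) * r powr (d / 2)"
      proof -
        have g: "Gamma (d / 2 + 1) = d / 2 * Gamma (d / 2)"
          using d by (intro Gamma_plus1) (auto simp: nonpos_Ints_def)
        show ?thesis unfolding g using d by (simp add: mult_ac)
      qed
      ultimately show ?thesis using False by simp
    qed
    finally show ?thesis .
  qed
  show "Int_stable ?E" by (auto simp: Int_stable_def)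
  show "?E \<subseteq> Pow UNIV" by auto
  show "emeasure ?M X = emeasure (density lborel ?f) X" if "X \<in> ?E" for X
    using that M N by auto
  show "sets ?M = sigma_sets UNIV ?E" "sets (density lborel ?f) = sigma_sets UNIV ?E"
    by (auto simp: borel_eq_atMost)
  show "range (\<lambda>i::nat. {..real i}) \<subseteq> ?E" by auto
  show "(\<Union>i::nat. {..real i}) = UNIV" using real_arch_simple by (auto simp: set_eq_iff)
  show "emeasure ?M {..real i} \<noteq> \<infinity>" for i by (simp add: M)
qed

text \<open>Under the substitution \<open>s = c |y|^2\<close> the moment becomes Euler's integral
  for the Gamma function at \<open>(d + n) / 2\<close>.\<close>

lemma nn_integral_gauss_moment:
  fixes c :: real
  assumes c: "c > 0"
  defines "d \<equiv> real DIM('a::euclidean_space)"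
  shows "(\<integral>\<^sup>+y. ennreal (norm (y::'a) ^ n * exp (- (c * (norm y)\<^sup>2))) \<partial>lborel)
    = ennreal (pi powr (d / 2) / Gamma (d / 2) * Gamma ((d + real n) / 2) * c powr (- ((d + real n) / 2)))"
proof -
  let ?K = "(pi / c) powr (d / 2) / Gamma (d / 2)"
  let ?L = "?K * c powr (- (real n / 2))"
  have d: "d > 0" by (simp add: d_def)
  have G: "Gamma (d / 2) > 0" using d by (intro Gamma_real_pos) auto
  have "(\<integral>\<^sup>+y. ennreal (norm (y::'a) ^ n * exp (- (c * (norm y)\<^sup>2))) \<partial>lborel)
    = (\<integral>\<^sup>+y. ennreal ((sqrt (c * (norm (y::'a))\<^sup>2 / c)) ^ n * exp (- (c * (norm y)\<^sup>2))) \<partial>lborel)"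
    using c by simp
  also have "\<dots> = (\<integral>\<^sup>+s. ennreal ((sqrt (s / c)) ^ n * exp (- s)) \<partial>distr lborel borel (\<lambda>y::'a. c * (norm y)\<^sup>2))"
    by (subst nn_integral_distr) auto
  also have "\<dots> = (\<integral>\<^sup>+s. ennreal (indicator {0..} s * ?K * s powr (d / 2 - 1)) * ennreal ((sqrt (s / c)) ^ n * exp (- s)) \<partial>lborel)"
    unfolding distr_scaled_norm_sq[OF c, where 'a='a, folded d_def]
    by (subst nn_integral_density) auto
  also have "\<dots> = (\<integral>\<^sup>+s. ennreal ?L * ennreal (indicator {0..} s * s powr ((d + real n) / 2 - 1) / exp s) \<partial>lborel)"
  proof (rule nn_integral_cong_AE)
    have "AE s in lborel. s \<noteq> (0::real)" by (rule AE_lborel_singleton)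
    then show "AE s in lborel. ennreal (indicator {0..} s * ?K * s powr (d / 2 - 1)) * ennreal ((sqrt (s / c)) ^ n * exp (- s))
      = ennreal ?L * ennreal (indicator {0..} s * s powr ((d + real n) / 2 - 1) / exp s)"
    proof eventually_elim
      case (elim s)
      show ?case
      proof (cases "s > 0")
        case True
        have "sqrt (s / c) ^ n = (s / c) powr (real n / 2)"
          using True c by (simp add: powr_realpow[symmetric] powr_half_sqrt[symmetric] powr_powr)
        also have "\<dots> = s powr (real n / 2) * c powr (- (real n / 2))"
          using True c by (simp add: powr_divide powr_minus_divide)
        finally have e: "sqrt (s / c) ^ n = s powr (real n / 2) * c powr (- (real n / 2))" .
        have "(d + real n) / 2 - 1 = (d / 2 - 1) + real n / 2" by (simp add: add_divide_distrib)
        then have s: "s powr ((d + real n) / 2 - 1) = s powr (d / 2 - 1) * s powr (real n / 2)"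
          by (simp only: powr_add)
        have eq: "indicator {0..} s * ?K * s powr (d / 2 - 1) * (s powr (real n / 2) * c powr (- (real n / 2)) * exp (- s))
            = ?L * (indicator {0..} s * (s powr (d / 2 - 1) * s powr (real n / 2)) / exp s)"
          unfolding exp_minus divide_inverse by (simp only: mult_ac)
        have L0: "0 \<le> ?L" "0 \<le> indicator {0..} s * ?K * s powr (d / 2 - 1)"
          using G by (auto intro!: mult_nonneg_nonneg divide_nonneg_pos)
        show ?thesis
          unfolding e s ennreal_mult'[OF L0(1), symmetric] ennreal_mult'[OF L0(2), symmetric] eq ..
      qed (use elim in auto)
    qed
  qed
  also have "\<dots> = ennreal ?L * ennreal (Gamma ((d + real n) / 2))"
    using d by (subst nn_integral_cmult) (auto simp: Gamma_conv_nn_integral_real)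
  also have "\<dots> = ennreal (?L * Gamma ((d + real n) / 2))"
    using d G by (intro ennreal_mult'[symmetric]) (auto intro!: mult_nonneg_nonneg divide_nonneg_pos)
  also have "?L * Gamma ((d + real n) / 2) = pi powr (d / 2) / Gamma (d / 2) * Gamma ((d + real n) / 2) * c powr (- ((d + real n) / 2))"
  proof -
    have "- ((d + real n) / 2) = - (d / 2) + - (real n / 2)" by (simp add: add_divide_distrib)
    then have "c powr (- ((d + real n) / 2)) = c powr (- (d / 2)) * c powr (- (real n / 2))"
      by (simp only: powr_add)
    moreover have "(pi / c) powr (d / 2) = pi powr (d / 2) * c powr (- (d / 2))"
      using c by (simp add: powr_divide powr_minus_divide)
    ultimately show ?thesis by (simp only: divide_inverse mult_ac)
  qed
  finally show ?thesis .
qed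

text \<open>Ratio test: consecutive terms have ratio \<open>(a + n) / (b + n) * z / (n + 1)\<close>,
  whose first factor never exceeds \<open>L\<close>, and \<open>N\<close> is chosen to bring the
  whole below one half.\<close>

lemma kummer_summable:
  fixes a b z :: real
  assumes "a > 0" "b > 0" "z \<ge> 0"
  shows "summable (\<lambda>n. pochhammer a n / pochhammer b n * z ^ n / fact n)"
proof -
  define L where "L = max 1 (a / b)"
  define N where "N = nat \<lceil>2 * L * z\<rceil>"
  show ?thesis
  proof (rule summable_ratio_test[of "1/2" N])
    fix n assume n: "N \<le> n"
    let ?f = "\<lambda>n. pochhammer a n / pochhammer b n * z ^ n / fact n"
    have p: "pochhammer a n > 0" "pochhammer b n > 0" using assms by (auto intro: pochhammer_pos)
    have "?f (Suc n) = ?f n * ((a + real n) / (b + real n) * (z / (real n + 1)))"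
      using assms p by (simp add: pochhammer_Suc field_simps)
    moreover have "(a + real n) / (b + real n) \<le> L"
    proof -
      have "a \<le> L * b" using assms by (cases "a / b \<le> 1") (auto simp: L_def field_simps max_def)
      moreover have "real n \<le> L * real n" using mult_right_mono[of 1 L "real n"] by (simp add: L_def)
      ultimately show ?thesis using assms by (simp add: field_simps)
    qed
    then have "(a + real n) / (b + real n) * (z / (real n + 1)) \<le> L * (z / (real n + 1))"
      using assms by (intro mult_right_mono) auto
    moreover have "L * (z / (real n + 1)) \<le> 1 / 2"
    proof -
      have "2 * L * z \<le> real N" unfolding N_def by linarith
      also have "\<dots> \<le> real n" using n by simp
      finally show ?thesis by (simp add: field_simps)
    qed
    ultimately have q: "?f (Suc n) = ?f n * ((a + real n) / (b + real n) * (z / (real n + 1)))"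
      "(a + real n) / (b + real n) * (z / (real n + 1)) \<le> 1 / 2" by linarith+
    have f0: "0 \<le> ?f m" for m
      using assms pochhammer_pos[of a m] pochhammer_pos[of b m] by (simp add: less_imp_le)
    have "?f (Suc n) \<le> ?f n * (1 / 2)"
      unfolding q(1) using q(2) f0[of n] by (rule mult_left_mono)
    then show "norm (?f (Suc n)) \<le> 1 / 2 * norm (?f n)"
      using f0[of n] f0[of "Suc n"] by (simp only: real_norm_def abs_of_nonneg) (simp only: mult.commute)
  qed simp
qed

text \<open>Origin of the Kummer functions in the growth condition. Integrating the exponential
  series term by term leaves a power series in \<open>sqrt x\<close>, where
  \<open>x = m^2 / (4 c)\<close>; its even and odd parts are the two summands. All terms are
  nonnegative, so the interchange needs no estimate.\<close>

lemma nn_integral_gauss_exp_norm: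
  fixes c m :: real
  assumes c: "c > 0" and m: "m \<ge> 0"
  defines "d \<equiv> real DIM('a::euclidean_space)" and "x \<equiv> m\<^sup>2 / (4 * c)"
  shows "(\<integral>\<^sup>+y. ennreal (exp (m * norm (y::'a) - c * (norm y)\<^sup>2)) \<partial>lborel)
    = ennreal ((pi / c) powr (d / 2) * (kummer_1F1 (d / 2) (1 / 2) x
        + 2 * (Gamma ((d + 1) / 2) / Gamma (d / 2)) * sqrt x * kummer_1F1 ((d + 1) / 2) (3 / 2) x))"
proof -
  have d: "d > 0" by (simp add: d_def)
  have G: "Gamma (d / 2) > 0" using d by (intro Gamma_real_pos) auto
  have x: "x \<ge> 0" using c by (simp add: x_def)
  have mx: "m = 2 * (sqrt x * sqrt c)"
    using c m by (simp add: x_def real_sqrt_divide real_sqrt_mult)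
  define K where "K = (pi / c) powr (d / 2)"
  define a where "a n = m ^ n / fact n * (pi powr (d / 2) / Gamma (d / 2) * Gamma ((d + real n) / 2) * c powr (- ((d + real n) / 2)))" for n
  define f where "f k = K * (pochhammer (d / 2) k / pochhammer (1 / 2) k * x ^ k / fact k)" for k
  define g where "g k = K * (2 * (Gamma ((d + 1) / 2) / Gamma (d / 2)) * sqrt x) * (pochhammer ((d + 1) / 2) k / pochhammer (3 / 2) k * x ^ k / fact k)" for k
  have a0: "a n \<ge> 0" for n using m d G by (auto simp: a_def intro!: mult_nonneg_nonneg divide_nonneg_pos)
  have cpow: "c powr (- ((d + real n) / 2)) = c powr (- (d / 2)) * inverse (sqrt c ^ n)" for n
  proof -
    have "sqrt c ^ n = c powr (real n / 2)"
      using c by (simp add: powr_realpow[symmetric] powr_half_sqrt[symmetric] powr_powr)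
    moreover have "- ((d + real n) / 2) = - (d / 2) - real n / 2" by (simp add: add_divide_distrib)
    then have "c powr (- ((d + real n) / 2)) = c powr (- (d / 2)) / c powr (real n / 2)"
      by (simp only: powr_diff)
    ultimately show ?thesis by (simp only: divide_inverse)
  qed
  have Kc: "K = pi powr (d / 2) * c powr (- (d / 2))" using c by (simp add: K_def powr_divide powr_minus_divide)
  have an: "a n = K * ((2 * sqrt x) ^ n / fact n * (Gamma ((d + real n) / 2) / Gamma (d / 2)))" for n
    unfolding a_def cpow Kc using c by (subst mx) (simp add: power_mult_distrib field_simps)
  \<comment> \<open>The duplication formula \<open>(2 k)! = 4^k (1/2)_k k!\<close> produces the
    parameter \<open>1 / 2\<close>; the quotient of Gamma values is the Pochhammer symbol of
    \<open>d / 2\<close>.\<close>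
  have even: "a (2 * k) = f k" for k
  proof -
    have "pochhammer (d / 2) k = Gamma (d / 2 + real k) / Gamma (d / 2)"
      using d by (intro pochhammer_Gamma) (auto simp: nonpos_Ints_def)
    moreover have "(d + real (2 * k)) / 2 = d / 2 + real k" by (simp add: field_simps)
    moreover have "(2 * sqrt x) ^ (2 * k) = 4 ^ k * x ^ k"
      using x by (simp add: power_mult power_mult_distrib)
    moreover have "(fact (2 * k) :: real) = 4 ^ k * pochhammer (1 / 2) k * fact k"
      using fact_double[of k, where 'a=real] by (simp add: power_mult)
    moreover have "pochhammer (1 / 2 :: real) k > 0" by (intro pochhammer_pos) simp
    ultimately show ?thesis unfolding an f_def by (simp add: field_simps)
  qed
  \<comment> \<open>As for even indices, with \<open>(2 k + 1)! = 4^k (3/2)_k k!\<close>; one factor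
    \<open>2 sqrt x\<close> and the quotient of Gamma values at \<open>(d + 1) / 2\<close> and
    \<open>d / 2\<close> are left over.\<close>
  have odd: "a (2 * k + 1) = g k" for k
  proof -
    have "pochhammer ((d + 1) / 2) k = Gamma ((d + 1) / 2 + real k) / Gamma ((d + 1) / 2)"
      using d by (intro pochhammer_Gamma) (auto simp: nonpos_Ints_def)
    moreover have "(d + real (2 * k + 1)) / 2 = (d + 1) / 2 + real k" by (simp add: field_simps)
    moreover have "Gamma ((d + 1) / 2) > 0" using d by (intro Gamma_real_pos) auto
    then have "Gamma ((d + 1) / 2) \<noteq> 0" by (rule less_imp_neq[symmetric])
    ultimately have 1: "Gamma ((d + real (2 * k + 1)) / 2) = Gamma ((d + 1) / 2) * pochhammer ((d + 1) / 2) k"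
      by (simp only:) simp
    have 2: "(2 * sqrt x) ^ (2 * k + 1) = 4 ^ k * x ^ k * (2 * sqrt x)"
      using x by (simp add: power_mult power_mult_distrib)
    have "(fact (2 * k) :: real) = 4 ^ k * pochhammer (1 / 2) k * fact k"
      using fact_double[of k, where 'a=real] by (simp add: power_mult)
    moreover have "pochhammer (1 / 2 :: real) (Suc k) = (1 / 2) * pochhammer (3 / 2) k"
      by (simp add: pochhammer_rec)
    then have "pochhammer (1 / 2 :: real) k * (1 / 2 + real k) = (1 / 2) * pochhammer (3 / 2) k"
      by (simp only: pochhammer_Suc)
    then have "pochhammer (1 / 2 :: real) k * (2 * real k + 1) = pochhammer (3 / 2) k" by (simp add: algebra_simps)
    moreover have "(fact (2 * k + 1) :: real) = (2 * real k + 1) * fact (2 * k)" by (simp add: algebra_simps)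
    ultimately have 3: "(fact (2 * k + 1) :: real) = 4 ^ k * pochhammer (3 / 2) k * fact k"
      by (metis (no_types, opaque_lifting) mult.assoc mult.commute)
    have 4: "pochhammer (3 / 2 :: real) k > 0" by (intro pochhammer_pos) simp
    show ?thesis unfolding an g_def 1 2 3 using 4 G by (simp add: field_simps)
  qed
  have fs: "f sums (K * kummer_1F1 (d / 2) (1 / 2) x)"
    unfolding f_def kummer_1F1_def using d x by (intro sums_mult summable_sums kummer_summable) auto
  have gs: "g sums (K * (2 * (Gamma ((d + 1) / 2) / Gamma (d / 2)) * sqrt x) * kummer_1F1 ((d + 1) / 2) (3 / 2) x)"
    unfolding g_def kummer_1F1_def using d x by (intro sums_mult summable_sums kummer_summable) auto
  have "(\<lambda>n. if even n then f (n div 2) else g ((n - 1) div 2)) = a"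
  proof
    fix n show "(if even n then f (n div 2) else g ((n - 1) div 2)) = a n"
      using even odd by (cases "even n") (auto elim!: evenE oddE)
  qed
  with sums_if[OF gs fs] have as: "a sums (K * kummer_1F1 (d / 2) (1 / 2) x
     + K * (2 * (Gamma ((d + 1) / 2) / Gamma (d / 2)) * sqrt x) * kummer_1F1 ((d + 1) / 2) (3 / 2) x)"
    by (simp add: add.commute)
  have "(\<integral>\<^sup>+y. ennreal (exp (m * norm (y::'a) - c * (norm y)\<^sup>2)) \<partial>lborel)
     = (\<integral>\<^sup>+y. (\<Sum>n. ennreal (m ^ n / fact n * (norm (y::'a) ^ n * exp (- (c * (norm y)\<^sup>2))))) \<partial>lborel)"
  proof (intro nn_integral_cong)
    fix y :: 'a
    have "(\<lambda>n. (m * norm y) ^ n /\<^sub>R fact n * exp (- (c * (norm y)\<^sup>2))) sums (exp (m * norm y) * exp (- (c * (norm y)\<^sup>2)))"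
      by (intro sums_mult2 exp_converges)
    then have "(\<lambda>n. m ^ n / fact n * (norm y ^ n * exp (- (c * (norm y)\<^sup>2)))) sums exp (m * norm y - c * (norm y)\<^sup>2)"
      by (simp add: power_mult_distrib divide_inverse mult_ac exp_add[symmetric])
    then have "(\<Sum>n. ennreal (m ^ n / fact n * (norm y ^ n * exp (- (c * (norm y)\<^sup>2))))) = ennreal (exp (m * norm y - c * (norm y)\<^sup>2))"
      using m by (intro sums_unique[symmetric] sums_ennreal[THEN iffD2]) auto
    then show "ennreal (exp (m * norm y - c * (norm y)\<^sup>2)) = (\<Sum>n. ennreal (m ^ n / fact n * (norm y ^ n * exp (- (c * (norm y)\<^sup>2)))))"
      by simp
  qed
  also have "\<dots> = (\<Sum>n. \<integral>\<^sup>+y. ennreal (m ^ n / fact n * (norm (y::'a) ^ n * exp (- (c * (norm y)\<^sup>2)))) \<partial>lborel)"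
    by (rule nn_integral_suminf) measurable
  also have "\<dots> = (\<Sum>n. ennreal (a n))"
  proof (intro arg_cong[where f=suminf] ext)
    fix n
    have "(\<integral>\<^sup>+y. ennreal (m ^ n / fact n * (norm (y::'a) ^ n * exp (- (c * (norm y)\<^sup>2)))) \<partial>lborel)
       = (\<integral>\<^sup>+y. ennreal (m ^ n / fact n) * ennreal (norm (y::'a) ^ n * exp (- (c * (norm y)\<^sup>2))) \<partial>lborel)"
      using m by (intro nn_integral_cong ennreal_mult') auto
    also have "\<dots> = ennreal (m ^ n / fact n) * (\<integral>\<^sup>+y. ennreal (norm (y::'a) ^ n * exp (- (c * (norm y)\<^sup>2))) \<partial>lborel)"
      by (rule nn_integral_cmult) measurable
    also have "\<dots> = ennreal (a n)"
      unfolding nn_integral_gauss_moment[OF c] a_def d_def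
      using m by (intro ennreal_mult'[symmetric]) auto
    finally show "(\<integral>\<^sup>+y. ennreal (m ^ n / fact n * (norm (y::'a) ^ n * exp (- (c * (norm y)\<^sup>2)))) \<partial>lborel) = ennreal (a n)" .
  qed
  also have "\<dots> = ennreal (K * kummer_1F1 (d / 2) (1 / 2) x
     + K * (2 * (Gamma ((d + 1) / 2) / Gamma (d / 2)) * sqrt x) * kummer_1F1 ((d + 1) / 2) (3 / 2) x)"
  proof -
    have "0 \<le> suminf a" using as a0 by (intro suminf_nonneg sums_summable)
    then show ?thesis
      using as a0 sums_unique[OF as] by (intro sums_unique[symmetric] sums_ennreal[THEN iffD2]) simp_all
  qed
  finally show ?thesis by (simp add: K_def algebra_simps)
qed

text \<open>A positive real factor leaves the argument of \<open>z\<close> unchanged, so the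
  principal logarithm is additive here and no branch is crossed.\<close>

lemma powr_of_real_mult:
  fixes z a :: complex
  assumes "r > 0" "z \<noteq> 0"
  shows "(of_real r * z) powr a = of_real r powr a * z powr a"
proof -
  have "Ln (of_real r * z) = Ln (of_real r) + Ln z"
    using Ln_times_of_real[OF assms] Ln_of_real[of r] assms by simp
  then show ?thesis using assms by (simp only: powr_def) (simp add: exp_add[symmetric] distrib_left)
qed

text \<open>Writing \<open>1 / (4 b) = r - w\<close> with \<open>r\<close> real and \<open>|w| < r\<close>, the expansion of \<open>exp (w |y|\<^sup>2)\<close> reduces the
  integral to real moments, which sum up to a binomial series; this avoids analytic continuation.\<close>

lemma gauss_integral_complex:
  fixes b :: complex
  assumes b: "Re b > 0"
  shows "has_bochner_integral lborel (\<lambda>y::'a::euclidean_space. exp (- of_real ((norm y)\<^sup>2) / (4 * b)))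
    ((of_real (4 * pi) * b) powr of_real (real DIM('a) / 2))"
proof -
  define d where "d = real DIM('a)"
  have d: "d > 0" by (simp add: d_def)
  have G: "Gamma (d / 2) > 0" using d by (intro Gamma_real_pos) auto
  have b0: "b \<noteq> 0" using b by auto
  define s where "s = 1 / (4 * b)"
  have s: "Re s > 0" "s \<noteq> 0" using b b0 by (auto simp: s_def Re_divide intro!: divide_pos_pos add_pos_nonneg)
  \<comment> \<open>Chosen such that \<open>r * Re s = |s|^2\<close>; then
    \<open>|r - s|^2 = r^2 - |s|^2\<close>, which is smaller than \<open>r^2\<close>.\<close>
  define r where "r = (cmod s)\<^sup>2 / Re s"
  have r: "r > 0" using s by (simp add: r_def)
  define w where "w = of_real r - s"
  have "(cmod w)\<^sup>2 = r\<^sup>2 - 2 * r * Re s + (cmod s)\<^sup>2"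
    unfolding cmod_power2 by (simp add: w_def power2_eq_square algebra_simps)
  also have "2 * r * Re s = 2 * (r * Re s)" by simp
  also have "r * Re s = (cmod s)\<^sup>2" using s by (simp add: r_def)
  finally have "(cmod w)\<^sup>2 < r\<^sup>2" using s by (simp add: mult.assoc)
  then have w: "cmod w < r" using r power2_less_imp_less less_imp_le by blast
  define F where "F n y = w ^ n / fact n * of_real (norm (y::'a) ^ (2 * n) * exp (- (r * (norm y)\<^sup>2)))" for n y
  define M where "M n = pi powr (d / 2) * r powr (- (d / 2)) * (pochhammer (d / 2) n / r ^ n)" for n
  have mom: "has_bochner_integral lborel (\<lambda>y::'a. norm y ^ (2 * n) * exp (- (r * (norm y)\<^sup>2))) (M n)" for n
  proof (rule has_bochner_integral_nn_integral)
    have "pochhammer (d / 2) n = Gamma (d / 2 + real n) / Gamma (d / 2)"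
      using d by (intro pochhammer_Gamma) (auto simp: nonpos_Ints_def)
    moreover have "(d + real (2 * n)) / 2 = d / 2 + real n" by (simp add: field_simps)
    moreover have "r powr (- (d / 2 + real n)) = r powr (- (d / 2)) / r ^ n"
    proof -
      have "r powr (- (d / 2 + real n)) = r powr (- (d / 2) - real n)" by simp
      also have "\<dots> = r powr (- (d / 2)) / r ^ n" unfolding powr_diff using r by (simp add: powr_realpow)
      finally show ?thesis .
    qed
    ultimately have "pi powr (d / 2) / Gamma (d / 2) * Gamma ((d + real (2 * n)) / 2) * r powr (- ((d + real (2 * n)) / 2)) = M n"
      unfolding M_def by (simp only:) simp
    then show "(\<integral>\<^sup>+y. ennreal (norm (y::'a) ^ (2 * n) * exp (- (r * (norm y)\<^sup>2))) \<partial>lborel) = ennreal (M n)"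
      unfolding nn_integral_gauss_moment[OF r, where 'a='a, folded d_def] by simp
    show "0 \<le> M n" using d r by (auto simp: M_def intro!: mult_nonneg_nonneg divide_nonneg_pos pochhammer_nonneg)
  qed auto
  have Fint: "has_bochner_integral lborel (F n) (w ^ n / fact n * of_real (M n))" for n
    unfolding F_def using mom by (intro has_bochner_integral_mult_right has_bochner_integral_of_real)
  have Fnorm: "(LINT y|lborel. norm (F n y)) = cmod w ^ n / fact n * M n" for n
  proof -
    have "norm (F n y) = cmod w ^ n / fact n * (norm y ^ (2 * n) * exp (- (r * (norm y)\<^sup>2)))" for y
      by (simp add: F_def norm_mult norm_divide norm_power abs_mult)
    moreover have "has_bochner_integral lborel (\<lambda>y::'a. cmod w ^ n / fact n * (norm y ^ (2 * n) * exp (- (r * (norm y)\<^sup>2)))) (cmod w ^ n / fact n * M n)"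
      using mom by (intro has_bochner_integral_mult_right)
    ultimately show ?thesis by (simp add: has_bochner_integral_iff)
  qed
  have Fsum: "(\<lambda>n. F n y) sums exp (- of_real ((norm y)\<^sup>2) / (4 * b))" for y
  proof -
    have "(\<lambda>n. (w * of_real ((norm y)\<^sup>2)) ^ n /\<^sub>R fact n * of_real (exp (- (r * (norm y)\<^sup>2))))
       sums (exp (w * of_real ((norm y)\<^sup>2)) * of_real (exp (- (r * (norm y)\<^sup>2))))"
      by (intro sums_mult2 exp_converges)
    also have "exp (w * of_real ((norm y)\<^sup>2)) * of_real (exp (- (r * (norm y)\<^sup>2)))
       = exp (- of_real ((norm y)\<^sup>2) / (4 * b))"
      by (simp add: exp_of_real[symmetric] exp_add[symmetric] w_def s_def algebra_simps)
    also have "(\<lambda>n. (w * of_real ((norm y)\<^sup>2)) ^ n /\<^sub>R fact n * of_real (exp (- (r * (norm y)\<^sup>2)))) = (\<lambda>n. F n y)"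
      by (auto simp: F_def power_mult_distrib power_mult[symmetric] scaleR_conv_of_real divide_inverse mult_ac)
    finally show ?thesis .
  qed
  \<comment> \<open>The integrals of the norms form the same binomial series with \<open>w\<close>
    replaced by its modulus, since the binomial coefficients of \<open>- d / 2\<close> alternate in
    sign. Its convergence for \<open>|w| < r\<close> justifies integrating term by term.\<close>
  have "norm (- cmod w / r) < 1" using w r by simp
  then have "\<bar>cmod w / r\<bar> < 1" "\<bar>- cmod w / r\<bar> < 1" by auto
  from gen_binomial_real[OF this(2), of "- (d / 2)"]
  have "summable (\<lambda>n. (- (d / 2) gchoose n) * (- cmod w / r) ^ n)" by (rule sums_summable)
  then have "summable (\<lambda>n. pi powr (d / 2) * r powr (- (d / 2)) * ((- (d / 2) gchoose n) * (- cmod w / r) ^ n))"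
    by (rule summable_mult)
  moreover have "pi powr (d / 2) * r powr (- (d / 2)) * ((- (d / 2) gchoose n) * (- cmod w / r) ^ n) = cmod w ^ n / fact n * M n" for n
  proof -
    have "(- cmod w / r) ^ n = (-1) ^ n * (cmod w ^ n / r ^ n)"
      using power_minus[of "cmod w / r" n] by (simp add: power_divide)
    moreover have "(-1) ^ n * ((-1) ^ n * (u::real)) = u" for u
      by (simp add: mult.assoc[symmetric] power_mult_distrib[symmetric])
    ultimately show ?thesis by (simp add: gbinomial_pochhammer M_def field_simps)
  qed
  ultimately have sum: "summable (\<lambda>n. LINT y|lborel. norm (F n y))" by (simp only: Fnorm)
  have int: "integrable lborel (F n)" for n using Fint by (simp add: has_bochner_integral_iff)
  have ae: "AE y in lborel. summable (\<lambda>n. norm (F n y))"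
  proof (intro AE_I2)
    fix y
    have "(\<lambda>n. norm (F n y)) = (\<lambda>n. (cmod w * (norm y)\<^sup>2) ^ n /\<^sub>R fact n * exp (- (r * (norm y)\<^sup>2)))"
      by (auto simp: F_def norm_mult norm_divide norm_inverse norm_power power_mult_distrib power_mult[symmetric] divide_inverse mult_ac)
    then show "summable (\<lambda>n. norm (F n y))"
      by (simp only:) (intro summable_mult2 sums_summable[OF exp_converges])
  qed
  have I: "integrable lborel (\<lambda>y. \<Sum>n. F n y)" "(\<lambda>n. LINT y|lborel. F n y) sums (LINT y|lborel. (\<Sum>n. F n y))"
    using integrable_suminf[OF int ae sum] sums_integral[OF int ae sum] by auto
  have "(\<lambda>y. \<Sum>n. F n y) = (\<lambda>y. exp (- of_real ((norm y)\<^sup>2) / (4 * b)))"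
    using Fsum by (auto simp: sums_iff)
  note I = I[unfolded this]
  have "norm (- w / of_real r) < 1" using w r by (simp add: norm_divide)
  from gen_binomial_complex[OF this, of "- of_real (d / 2)"]
  have "(\<lambda>n. of_real (pi powr (d / 2) * r powr (- (d / 2))) * ((- of_real (d / 2) gchoose n) * (- w / of_real r) ^ n))
     sums (of_real (pi powr (d / 2) * r powr (- (d / 2))) * (1 + - w / of_real r) powr (- of_real (d / 2)))"
    by (rule sums_mult)
  moreover have "of_real (pi powr (d / 2) * r powr (- (d / 2))) * ((- of_real (d / 2) gchoose n) * (- w / of_real r) ^ n)
      = (LINT y|lborel. F n y)" for n
  proof -
    have "(LINT y|lborel. F n y) = w ^ n / fact n * of_real (M n)"
      using Fint by (simp add: has_bochner_integral_iff)
    moreover have "(- w / of_real r) ^ n = (-1) ^ n * (w ^ n / of_real r ^ n)"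
      using power_minus[of "w / of_real r" n] by (simp add: power_divide)
    moreover have "(-1) ^ n * ((-1) ^ n * (u::complex)) = u" for u
      by (simp add: mult.assoc[symmetric] power_mult_distrib[symmetric])
    ultimately show ?thesis by (simp add: gbinomial_pochhammer M_def pochhammer_of_real[symmetric] field_simps)
  qed
  ultimately have "(LINT y|lborel. exp (- of_real ((norm (y::'a))\<^sup>2) / (4 * b)))
      = of_real (pi powr (d / 2) * r powr (- (d / 2))) * (1 + - w / of_real r) powr (- of_real (d / 2))"
    using I(2) sums_unique2 by fastforce
  also have "1 + - w / of_real r = s / of_real r" using r by (simp add: w_def field_simps)
  also have "of_real (pi powr (d / 2) * r powr (- (d / 2))) * (s / of_real r) powr (- of_real (d / 2))
     = of_real pi powr of_real (d / 2) * (of_real r * (s / of_real r)) powr (- of_real (d / 2))"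
    using r s by (subst powr_of_real_mult) (auto simp: powr_of_real[symmetric])
  also have "of_real r * (s / of_real r) = s" using r by simp
  \<comment> \<open>Inverting \<open>4 b\<close> negates its principal logarithm because
    \<open>b\<close> lies in the right half plane, away from the branch cut.\<close>
  also have "s powr (- of_real (d / 2)) = (4 * b) powr of_real (d / 2)"
  proof -
    have "4 * b \<notin> \<real>\<^sub>\<le>\<^sub>0" using b by (auto simp: complex_nonpos_Reals_iff)
    then have Ln: "Ln (inverse (4 * b)) = - Ln (4 * b)" by (rule Ln_inverse)
    have s_inv: "s = inverse (4 * b)" unfolding s_def by (rule inverse_eq_divide[symmetric])
    have nz: "inverse (4 * b) \<noteq> 0" "4 * b \<noteq> 0" using b0 by auto
    show ?thesis unfolding s_inv powr_def Ln if_not_P[OF nz(1)] if_not_P[OF nz(2)] by (simp only: minus_mult_minus)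
  qed
  also have "of_real pi powr of_real (d / 2) * (4 * b) powr of_real (d / 2) = (of_real pi * (4 * b)) powr of_real (d / 2)"
    using b0 by (subst powr_of_real_mult) auto
  finally show ?thesis using I(1) by (simp add: has_bochner_integral_iff d_def mult_ac)
qed

section \<open>Rotations generated by skew-symmetric matrices\<close>

lemma nn_integral_lborel_translate:
  fixes a :: "'a::euclidean_space"
  assumes [measurable]: "f \<in> borel_measurable borel"
  shows "(\<integral>\<^sup>+x. f (x + a) \<partial>lborel) = (\<integral>\<^sup>+x. f x \<partial>lborel)"
proof -
  have "lborel = distr lborel borel (\<lambda>x. a + 1 *\<^sub>R x)"
    using lborel_affine[of 1 a] by (simp add: density_1)
  then have "(\<integral>\<^sup>+x. f x \<partial>lborel) = (\<integral>\<^sup>+x. f x \<partial>distr lborel borel (\<lambda>x. a + 1 *\<^sub>R x))" by simp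
  also have "\<dots> = (\<integral>\<^sup>+x. f (a + 1 *\<^sub>R x) \<partial>lborel)" by (rule nn_integral_distr) auto
  finally show ?thesis by (simp add: add.commute)
qed

text \<open>The proof compares \<open>Q\<close> with Lebesgue measure by testing both against a
  radial Gaussian, as in the uniqueness proof for Haar measure.\<close>

lemma distr_linear_isometry:
  fixes Q R :: "'a::euclidean_space \<Rightarrow> 'a"
  assumes lin: "linear Q" and iso: "\<And>x. norm (Q x) = norm x" and inv: "\<And>x. Q (R x) = x"
  shows "distr lborel borel Q = lborel"
proof (rule measure_eqI)
  fix A assume "A \<in> sets (distr lborel borel Q)"
  then have A [measurable]: "A \<in> sets borel" by simp
  have [measurable]: "Q \<in> borel_measurable borel"
    using lin by (intro borel_measurable_continuous_onI linear_continuous_on) (simp add: linear_conv_bounded_linear)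
  define f :: "'a \<Rightarrow> ennreal" where "f = indicator A"
  have [measurable]: "f \<in> borel_measurable borel" unfolding f_def by measurable
  \<comment> \<open>Any radial function with finite nonzero integral \<open>G\<close> would do; the
    factor \<open>G\<close> is cancelled at the end.\<close>
  define g where "g y = ennreal (exp (- (norm (y::'a))\<^sup>2))" for y
  have [measurable]: "g \<in> borel_measurable borel" unfolding g_def by measurable
  define G where "G = (\<integral>\<^sup>+y. g y \<partial>lborel)"
  have "G = ennreal (pi powr (real DIM('a) / 2) / Gamma (real DIM('a) / 2) * Gamma (real DIM('a) / 2))"
    using nn_integral_gauss_moment[of 1 0, where 'a='a] by (simp add: G_def g_def)
  moreover have "Gamma (real DIM('a) / 2) > 0" by (intro Gamma_real_pos) auto
  ultimately have G: "G \<noteq> 0" "G \<noteq> top" by auto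
  have "(\<integral>\<^sup>+x. f (Q x) \<partial>lborel) * G = (\<integral>\<^sup>+x. f (Q x) * G \<partial>lborel)"
    by (rule nn_integral_multc[symmetric]) measurable
  also have "\<dots> = (\<integral>\<^sup>+x. \<integral>\<^sup>+y. f (Q x) * g (y + - Q x) \<partial>lborel \<partial>lborel)"
  proof (rule nn_integral_cong)
    fix x
    have "G = (\<integral>\<^sup>+y. g (y + - Q x) \<partial>lborel)"
      unfolding G_def by (rule nn_integral_lborel_translate[symmetric]) measurable
    then show "f (Q x) * G = (\<integral>\<^sup>+y. f (Q x) * g (y + - Q x) \<partial>lborel)"
      by (simp add: nn_integral_cmult)
  qed
  also have "\<dots> = (\<integral>\<^sup>+y. \<integral>\<^sup>+x. f (Q x) * g (y + - Q x) \<partial>lborel \<partial>lborel)"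
    by (rule lborel_pair.Fubini'[symmetric]) measurable
  also have "\<dots> = (\<integral>\<^sup>+y. \<integral>\<^sup>+x. f (Q x + y) * g x \<partial>lborel \<partial>lborel)"
  proof (rule nn_integral_cong)
    \<comment> \<open>Translating \<open>x\<close> by \<open>R y\<close> moves \<open>Q x\<close> by
      \<open>y\<close>, so that \<open>g\<close> is evaluated at \<open>- Q x\<close>, where it
      equals \<open>g x\<close> since \<open>g\<close> is radial and \<open>Q\<close> preserves
      norms.\<close>
    fix y
    have "(\<integral>\<^sup>+x. f (Q x) * g (y + - Q x) \<partial>lborel) = (\<integral>\<^sup>+x. f (Q (x + R y)) * g (y + - Q (x + R y)) \<partial>lborel)"
      by (rule nn_integral_lborel_translate[symmetric]) measurable
    also have "\<dots> = (\<integral>\<^sup>+x. f (Q x + y) * g x \<partial>lborel)"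
      using lin by (simp add: linear_add inv g_def iso)
    finally show "(\<integral>\<^sup>+x. f (Q x) * g (y + - Q x) \<partial>lborel) = (\<integral>\<^sup>+x. f (Q x + y) * g x \<partial>lborel)" .
  qed
  also have "\<dots> = (\<integral>\<^sup>+x. \<integral>\<^sup>+y. f (Q x + y) * g x \<partial>lborel \<partial>lborel)"
    by (rule lborel_pair.Fubini') measurable
  also have "\<dots> = (\<integral>\<^sup>+x. (\<integral>\<^sup>+y. f y \<partial>lborel) * g x \<partial>lborel)"
  proof (rule nn_integral_cong)
    fix x
    have "(\<integral>\<^sup>+y. f (y + Q x) \<partial>lborel) = (\<integral>\<^sup>+y. f y \<partial>lborel)"
      by (rule nn_integral_lborel_translate) measurable
    then show "(\<integral>\<^sup>+y. f (Q x + y) * g x \<partial>lborel) = (\<integral>\<^sup>+y. f y \<partial>lborel) * g x"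
      by (simp add: nn_integral_multc add.commute)
  qed
  also have "\<dots> = (\<integral>\<^sup>+y. f y \<partial>lborel) * G"
    unfolding G_def by (rule nn_integral_cmult) measurable
  finally have "(\<integral>\<^sup>+x. f (Q x) \<partial>lborel) * G = (\<integral>\<^sup>+y. f y \<partial>lborel) * G" .
  then have "(\<integral>\<^sup>+x. f (Q x) \<partial>lborel) = (\<integral>\<^sup>+y. f y \<partial>lborel)"
    using G by (metis ennreal_mult_divide_eq)
  moreover have "(\<integral>\<^sup>+x. f (Q x) \<partial>lborel) = emeasure (distr lborel borel Q) A"
  proof -
    have "(\<integral>\<^sup>+x. f (Q x) \<partial>lborel) = (\<integral>\<^sup>+x. f x \<partial>distr lborel borel Q)"
      by (rule nn_integral_distr[symmetric]) measurable
    then show ?thesis by (simp add: f_def)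
  qed
  ultimately show "emeasure (distr lborel borel Q) A = emeasure lborel A" by (simp add: f_def)
qed simp

section \<open>The matrix exponential as the flow of a linear equation\<close>

lemma sums_vecI:
  fixes f :: "nat \<Rightarrow> 'a::real_normed_vector ^ 'n"
  assumes "\<And>i. (\<lambda>k. f k $ i) sums (l $ i)"
  shows "f sums l"
  using assms unfolding sums_def by (intro vec_tendstoI) (simp add: sum_component)

context
  fixes S :: "real ^ 'd ^ 'd"
begin

definition mat_pow :: "nat \<Rightarrow> real ^ 'd ^ 'd" where
  "mat_pow k = ((\<lambda>X. S ** X) ^^ k) (mat 1)"

text \<open>With \<open>K\<close> the sum of all absolute entries, which exceeds each absolute row
  sum, the bound reproduces itself under multiplication by \<open>S\<close>. It makes every entry of
  the exponential series converge.\<close>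

lemma mat_pow_bound: obtains K where "\<And>k i j. \<bar>mat_pow k $ i $ j\<bar> \<le> K ^ k" "K \<ge> 0"
proof -
  define K where "K = (\<Sum>i\<in>UNIV. \<Sum>l\<in>UNIV. \<bar>S $ i $ l\<bar>)"
  have K: "K \<ge> 0" by (simp add: K_def sum_nonneg)
  have row: "(\<Sum>l\<in>UNIV. \<bar>S $ i $ l\<bar>) \<le> K" for i
    unfolding K_def by (rule member_le_sum[where f="\<lambda>i. \<Sum>l\<in>UNIV. \<bar>S $ i $ l\<bar>"]) (auto simp: sum_nonneg)
  have "\<bar>mat_pow k $ i $ j\<bar> \<le> K ^ k" for k i j
  proof (induction k arbitrary: i)
    case 0
    then show ?case by (simp add: mat_pow_def mat_def)
  next
    case (Suc k)
    have "\<bar>mat_pow (Suc k) $ i $ j\<bar> = \<bar>\<Sum>l\<in>UNIV. S $ i $ l * mat_pow k $ l $ j\<bar>"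
      by (simp add: mat_pow_def matrix_matrix_mult_def)
    also have "\<dots> \<le> (\<Sum>l\<in>UNIV. \<bar>S $ i $ l * mat_pow k $ l $ j\<bar>)" by (rule sum_abs)
    also have "\<dots> \<le> (\<Sum>l\<in>UNIV. \<bar>S $ i $ l\<bar> * K ^ k)"
      using Suc.IH by (intro sum_mono) (auto simp: abs_mult intro!: mult_left_mono)
    also have "\<dots> \<le> K * K ^ k"
      using row[of i] K by (simp add: sum_distrib_right[symmetric] mult_right_mono)
    finally show ?case by simp
  qed
  then show ?thesis using K that by blast
qed

lemma mat_pow_summable: "summable (\<lambda>k. mat_pow k $ i $ j / fact k * t ^ k)"
proof -
  obtain K where K: "\<And>k i j. \<bar>mat_pow k $ i $ j\<bar> \<le> K ^ k" "K \<ge> 0" using mat_pow_bound by blast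
  show ?thesis
  proof (rule summable_comparison_test')
    show "summable (\<lambda>k. (K * \<bar>t\<bar>) ^ k /\<^sub>R fact k)" using exp_converges by (rule sums_summable)
    show "norm (mat_pow k $ i $ j / fact k * t ^ k) \<le> (K * \<bar>t\<bar>) ^ k /\<^sub>R fact k" for k
      using mult_right_mono[OF K(1)[of k i j], of "\<bar>t\<bar> ^ k"]
      by (simp add: abs_mult power_abs power_mult_distrib divide_simps)
  qed
qed

text \<open>Each entry is an everywhere convergent power series in \<open>t\<close>, which opens the
  way to differentiating term by term.\<close>

lemma mat_exp_entry: "mat_exp (t *\<^sub>R S) $ i $ j = (\<Sum>k. mat_pow k $ i $ j / fact k * t ^ k)"
proof -
  have pwt: "((\<lambda>X. (t *\<^sub>R S) ** X) ^^ k) (mat 1) = t ^ k *\<^sub>R mat_pow k" for k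
    by (induction k) (auto simp: mat_pow_def vec_eq_iff matrix_matrix_mult_def sum_distrib_left mult_ac)
  have "(\<lambda>k. (1 / fact k) *\<^sub>R (((\<lambda>X. (t *\<^sub>R S) ** X) ^^ k) (mat 1)))
      sums (\<chi> i j. \<Sum>k. mat_pow k $ i $ j / fact k * t ^ k)"
  proof (intro sums_vecI)
    fix i j
    have "(\<lambda>k. mat_pow k $ i $ j / fact k * t ^ k) sums (\<Sum>k. mat_pow k $ i $ j / fact k * t ^ k)"
      using mat_pow_summable by (rule summable_sums)
    then show "(\<lambda>k. ((1 / fact k) *\<^sub>R (((\<lambda>X. (t *\<^sub>R S) ** X) ^^ k) (mat 1))) $ i $ j)
        sums ((\<chi> i j. \<Sum>k. mat_pow k $ i $ j / fact k * t ^ k) $ i $ j)"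
      unfolding pwt by (simp add: mult_ac)
  qed
  then have "mat_exp (t *\<^sub>R S) = (\<chi> i j. \<Sum>k. mat_pow k $ i $ j / fact k * t ^ k)"
    unfolding mat_exp_def by (rule sums_unique[symmetric])
  then show ?thesis by simp
qed

lemma mat_exp_zero: "mat_exp (0 *\<^sub>R S) = mat 1"
proof -
  have "(\<Sum>k. mat_pow k $ i $ j / fact k * 0 ^ k) = mat_pow 0 $ i $ j" for i j
    using powser_zero[of "\<lambda>k. mat_pow k $ i $ j / fact k"] by simp
  then show ?thesis by (simp only: vec_eq_iff mat_exp_entry) (simp add: mat_pow_def)
qed

lemma mat_exp_entry_DERIV:
  "((\<lambda>t. mat_exp (t *\<^sub>R S) $ i $ j) has_field_derivative (\<Sum>l\<in>UNIV. S $ i $ l * mat_exp (t *\<^sub>R S) $ l $ j)) (at t)"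
proof -
  have "((\<lambda>t. \<Sum>k. mat_pow k $ i $ j / fact k * t ^ k) has_field_derivative (\<Sum>k. diffs (\<lambda>k. mat_pow k $ i $ j / fact k) k * t ^ k)) (at t)"
    by (rule termdiffs_strong_converges_everywhere) (rule mat_pow_summable)
  moreover have "diffs (\<lambda>k. mat_pow k $ i $ j / fact k) k * t ^ k = (\<Sum>l\<in>UNIV. S $ i $ l * (mat_pow k $ l $ j / fact k * t ^ k))" for k
  proof -
    have "mat_pow (Suc k) $ i $ j = (\<Sum>l\<in>UNIV. S $ i $ l * mat_pow k $ l $ j)"
      by (simp add: mat_pow_def matrix_matrix_mult_def)
    then show ?thesis
      by (simp add: diffs_def sum_distrib_right sum_distrib_left sum_divide_distrib mult_ac del: of_nat_Suc)
  qed
  moreover have "(\<lambda>k. \<Sum>l\<in>UNIV. S $ i $ l * (mat_pow k $ l $ j / fact k * t ^ k)) sums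
      (\<Sum>l\<in>UNIV. S $ i $ l * (\<Sum>k. mat_pow k $ l $ j / fact k * t ^ k))"
    by (intro sums_sum sums_mult summable_sums mat_pow_summable)
  ultimately show ?thesis by (simp add: mat_exp_entry sums_iff)
qed

abbreviation rot :: "real \<Rightarrow> real ^ 'd \<Rightarrow> real ^ 'd" where
  "rot t x \<equiv> mat_exp (t *\<^sub>R S) *v x"

lemma rot_DERIV: "((\<lambda>t. rot t x $ i) has_field_derivative ((S *v rot t x) $ i)) (at t)"
proof -
  have "((\<lambda>t. \<Sum>j\<in>UNIV. mat_exp (t *\<^sub>R S) $ i $ j * x $ j) has_field_derivative
      (\<Sum>j\<in>UNIV. (\<Sum>l\<in>UNIV. S $ i $ l * mat_exp (t *\<^sub>R S) $ l $ j) * x $ j)) (at t)"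
    by (intro DERIV_sum DERIV_cmult_right mat_exp_entry_DERIV)
  moreover have "(\<Sum>j\<in>UNIV. (\<Sum>l\<in>UNIV. S $ i $ l * mat_exp (t *\<^sub>R S) $ l $ j) * x $ j) = (S *v rot t x) $ i"
    unfolding matrix_vector_mul_assoc by (simp add: matrix_vector_mult_def matrix_matrix_mult_def)
  ultimately show ?thesis by (simp add: matrix_vector_mult_def)
qed

lemma rot_continuous: "continuous_on UNIV (\<lambda>z. rot (fst z) (snd z))"
proof -
  have "continuous_on UNIV (\<lambda>t. mat_exp (t *\<^sub>R S) $ i $ j)" for i j
    using mat_exp_entry_DERIV by (meson DERIV_isCont continuous_at_imp_continuous_on)
  then have "continuous_on UNIV (\<lambda>z::real \<times> (real ^ 'd). mat_exp (fst z *\<^sub>R S) $ i $ j)" for i j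
    by (rule continuous_on_compose2) (auto intro: continuous_intros)
  moreover have "continuous_on UNIV (\<lambda>z::real \<times> (real ^ 'd). snd z $ j)" for j
    by (intro bounded_linear.continuous_on[OF bounded_linear_vec_nth] continuous_on_snd continuous_on_id)
  ultimately have "continuous_on UNIV (\<lambda>z::real \<times> (real ^ 'd). \<Sum>j\<in>UNIV. mat_exp (fst z *\<^sub>R S) $ i $ j * snd z $ j)" for i
    by (intro continuous_on_sum continuous_on_mult)
  then show ?thesis
    unfolding matrix_vector_mult_def by (intro continuous_on_vec_lambda)
qed

lemma rot_linear: "linear (rot t)"
  by (rule matrix_vector_mul_linear)

context
  assumes skew: "transpose S = - S"
begin

text \<open>The squared norm has derivative \<open>2 f \<bullet> S f\<close>, which vanishes by
  skew-symmetry. Stated for every solution of the equation, it yields the isometry property as well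
  as uniqueness of solutions.\<close>

lemma skew_ode_norm_const:
  fixes f :: "real \<Rightarrow> real ^ 'd"
  assumes f: "\<And>i t. ((\<lambda>t. f t $ i) has_field_derivative ((S *v f t) $ i)) (at t)"
  shows "norm (f t) = norm (f 0)"
proof -
  have S: "S $ l $ i = - S $ i $ l" for i l
  proof -
    have "transpose S $ i $ l = (- S) $ i $ l" by (simp only: skew)
    then show ?thesis by (simp add: transpose_def)
  qed
  have 0: "(\<Sum>i\<in>UNIV. v $ i * (S *v v) $ i) = 0" for v :: "real ^ 'd"
  proof -
    let ?s = "\<Sum>i\<in>UNIV. \<Sum>l\<in>UNIV. v $ i * (S $ i $ l * v $ l)"
    have "?s = (\<Sum>l\<in>UNIV. \<Sum>i\<in>UNIV. v $ i * (S $ i $ l * v $ l))" by (rule sum.swap)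
    also have "\<dots> = (\<Sum>l\<in>UNIV. \<Sum>i\<in>UNIV. - (v $ l * (S $ l $ i * v $ i)))"
    proof (intro sum.cong refl)
      fix i l
      show "v $ i * (S $ i $ l * v $ l) = - (v $ l * (S $ l $ i * v $ i))" using S[of l i] by simp
    qed
    also have "\<dots> = - ?s" by (simp add: sum_negf)
    finally show ?thesis by (simp add: matrix_vector_mult_def sum_distrib_left)
  qed
  have "((\<lambda>t. \<Sum>i\<in>UNIV. (f t $ i)\<^sup>2) has_field_derivative (\<Sum>i\<in>UNIV. 2 * (f t $ i * (S *v f t) $ i))) (at t)" for t
    by (intro DERIV_sum) (auto intro!: derivative_eq_intros f)
  then have "((\<lambda>t. \<Sum>i\<in>UNIV. (f t $ i)\<^sup>2) has_field_derivative 0) (at t)" for t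
    using 0 by (simp flip: sum_distrib_left)
  then have "(\<Sum>i\<in>UNIV. (f t $ i)\<^sup>2) = (\<Sum>i\<in>UNIV. (f 0 $ i)\<^sup>2)"
    by (intro DERIV_isconst_all) auto
  then show ?thesis by (simp add: norm_vec_def L2_set_def)
qed

lemma rot_norm: "norm (rot t x) = norm x"
  using skew_ode_norm_const[of "\<lambda>t. rot t x" t] rot_DERIV mat_exp_zero by simp

text \<open>Both sides solve the same equation in \<open>r\<close> and agree at
  \<open>r = 0\<close>; their difference is a solution too, so its norm stays zero. No product of
  exponential series is needed.\<close>

lemma rot_rot: "rot r (rot s x) = rot (r + s) x"
proof -
  have "norm (rot r (rot s x) - rot (r + s) x) = norm (rot 0 (rot s x) - rot (0 + s) x)"
  proof (rule skew_ode_norm_const)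
    fix i t
    have "((\<lambda>t. rot (t + s) x $ i) has_field_derivative ((S *v rot (t + s) x) $ i)) (at t)"
      using rot_DERIV[of x i "t + s"] by (subst (asm) DERIV_shift) 
    then show "((\<lambda>t. (rot t (rot s x) - rot (t + s) x) $ i) has_field_derivative
        ((S *v (rot t (rot s x) - rot (t + s) x)) $ i)) (at t)"
      by (simp add: matrix_vector_mult_diff_distrib DERIV_diff rot_DERIV)
  qed
  then show ?thesis using mat_exp_zero by simp
qed

lemma rot_inverse: "rot t (rot (- t) x) = x"
  using rot_rot[of t "- t" x] mat_exp_zero by simp

lemma rot_distr: "distr lborel borel (rot t) = lborel"
  by (rule distr_linear_isometry[OF rot_linear rot_norm rot_inverse])

end

end

section \<open>The scalar semigroup\<close>

text \<open>The factors \<open>4 \<pi> t\<close> and \<open>a\<close> of the power are separated, so that measurability in \<open>t\<close> only involves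
  the real power function.\<close>

definition gker :: "complex \<Rightarrow> real \<Rightarrow> 'a::euclidean_space \<Rightarrow> complex" where
  "gker a t y = of_real ((4 * pi * t) powr - (real DIM('a) / 2)) * a powr - of_real (real DIM('a) / 2) *
     exp (- of_real ((norm y)\<^sup>2) / (4 * (of_real t * a)))"

lemma gker_measurable [measurable]:
  "(\<lambda>z. gker a (fst z) (snd z :: 'a::euclidean_space)) \<in> borel_measurable (borel \<Otimes>\<^sub>M borel)"
  unfolding gker_def by measurable

lemma gker_borel [measurable]: "gker a t \<in> borel_measurable borel"
  unfolding gker_def by measurable

lemma gker_cong_norm: "norm x = norm (y::'a::euclidean_space) \<Longrightarrow> gker a t (x::'a) = gker a t y"
  by (simp add: gker_def)

text \<open>The prefactor of \<open>gker\<close> is the reciprocal of the complex Gaussian integral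
  for \<open>t a\<close>; splitting off the positive factor \<open>4 pi t\<close> is harmless for
  the principal branch.\<close>

lemma gker_integral:
  assumes "Re a > 0" "t > 0"
  shows "has_bochner_integral lborel (gker a t :: 'a::euclidean_space \<Rightarrow> complex) 1"
proof -
  have a: "a \<noteq> 0" using assms by auto
  let ?d = "of_real (real DIM('a) / 2) :: complex"
  have "has_bochner_integral lborel (\<lambda>y::'a. exp (- of_real ((norm y)\<^sup>2) / (4 * (of_real t * a))))
    ((of_real (4 * pi) * (of_real t * a)) powr ?d)"
    by (rule gauss_integral_complex) (use assms in simp)
  moreover have "of_real (4 * pi) * (of_real t * a) = of_real (4 * pi * t) * a" by simp
  moreover have "(of_real (4 * pi * t) * a) powr ?d = of_real (4 * pi * t) powr ?d * a powr ?d"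
    using assms a by (intro powr_of_real_mult) auto
  moreover have "(of_real (4 * pi * t) :: complex) powr ?d = of_real ((4 * pi * t) powr (real DIM('a) / 2))"
    using assms by (intro powr_of_real) auto
  ultimately have I: "has_bochner_integral lborel (\<lambda>y::'a. exp (- of_real ((norm y)\<^sup>2) / (4 * (of_real t * a))))
    (of_real ((4 * pi * t) powr (real DIM('a) / 2)) * a powr ?d)" by (simp only:)
  let ?c = "of_real ((4 * pi * t) powr - (real DIM('a) / 2)) * a powr - ?d"
  have "has_bochner_integral lborel (\<lambda>y::'a. ?c * exp (- of_real ((norm y)\<^sup>2) / (4 * (of_real t * a))))
    (?c * (of_real ((4 * pi * t) powr (real DIM('a) / 2)) * a powr ?d))"
    using I by (rule has_bochner_integral_mult_right)
  moreover have "?c * (of_real ((4 * pi * t) powr (real DIM('a) / 2)) * a powr ?d) = 1"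
  proof -
    have 1: "(4 * pi * t) powr - (real DIM('a) / 2) * (4 * pi * t) powr (real DIM('a) / 2) = 1"
      using assms by (simp flip: powr_add)
    have 2: "a powr - ?d * a powr ?d = 1" using a by (simp flip: powr_add)
    have "?c * (of_real ((4 * pi * t) powr (real DIM('a) / 2)) * a powr ?d)
        = of_real ((4 * pi * t) powr - (real DIM('a) / 2) * (4 * pi * t) powr (real DIM('a) / 2)) * (a powr - ?d * a powr ?d)"
      by (simp only: of_real_mult mult_ac)
    then show ?thesis unfolding 1 2 by simp
  qed
  ultimately show ?thesis by (simp add: gker_def[abs_def])
qed

text \<open>The exponent of the power is real, so its modulus only sees \<open>|a|\<close>, while
  the decay is governed by \<open>Re (1 / a) = Re a / |a|^2\<close>. This mismatch between the two
  factors is why \<open>a_one\<close> can exceed 1.\<close>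

lemma norm_gker:
  assumes "Re a > 0" "t > 0"
  shows "norm (gker a t (y::'a::euclidean_space)) =
    (4 * pi * t * cmod a) powr - (real DIM('a) / 2) * exp (- (Re a / (4 * t * (cmod a)\<^sup>2) * (norm y)\<^sup>2))"
proof -
  have a: "a \<noteq> 0" using assms by auto
  have "Re (- of_real ((norm y)\<^sup>2) / (4 * (of_real t * a))) = - (Re a / (4 * t * (cmod a)\<^sup>2) * (norm y)\<^sup>2)"
  proof -
    have "Re (1 / a) = Re a / (cmod a)\<^sup>2" by (simp add: Re_divide cmod_power2)
    moreover have "- of_real ((norm y)\<^sup>2) / (4 * (of_real t * a)) = of_real (- (norm y)\<^sup>2 / (4 * t)) * (1 / a)" by simp
    ultimately show ?thesis by (simp only: Re_complex_of_real times_complex.sel Im_complex_of_real) simp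
  qed
  moreover have "norm (a powr - of_real (real DIM('a) / 2)) = cmod a powr - (real DIM('a) / 2)"
    using a by (simp add: powr_def norm_exp_eq_Re Re_Ln)
  ultimately show ?thesis
    using assms by (simp add: gker_def norm_mult norm_exp_eq_Re powr_mult)
qed

text \<open>Completing the square takes place in real vectors and real times; the complex number
  \<open>a\<close> enters only through the common factor \<open>1 / (4 a)\<close>. Hence the product
  of kernels is the target kernel times a kernel translated by a real vector, and no contour has to
  be shifted.\<close>

lemma gker_convolution:
  fixes x z :: "'a::euclidean_space"
  assumes a: "Re a > 0" and t: "t > 0" and s: "s > 0"
  shows "has_bochner_integral lborel (\<lambda>y. gker a t (x - y) * gker a s (y - z)) (gker a (t + s) (x - z))"
proof -
  \<comment> \<open>The time left over for the remaining kernel: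
    \<open>1 / r = 1 / t + 1 / s\<close>.\<close>
  define r where "r = t * s / (t + s)"
  have r: "r > 0" using t s by (simp add: r_def)
  have a0: "a \<noteq> 0" using a by auto
  let ?c = "\<lambda>t. (4 * pi * t) powr - (real DIM('a) / 2)"
  let ?d = "a powr - of_real (real DIM('a) / 2)"
  \<comment> \<open>The point of the segment from \<open>z\<close> to \<open>x\<close> at which the
    sum of the two quadratic exponents is minimal in \<open>y\<close>.\<close>
  define m where "m = z + (s / (t + s)) *\<^sub>R (x - z)"
  have "(4 * pi * t) * (4 * pi * s) = (4 * pi * (t + s)) * (4 * pi * r)" using t s by (simp add: r_def)
  then have c: "?c t * ?c s = ?c (t + s) * ?c r" 
  proof -
    assume eq: "(4 * pi * t) * (4 * pi * s) = (4 * pi * (t + s)) * (4 * pi * r)"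
    have "?c t * ?c s = ((4 * pi * t) * (4 * pi * s)) powr - (real DIM('a) / 2)"
      by (rule powr_mult[symmetric])
    also have "\<dots> = ?c (t + s) * ?c r"
      unfolding eq by (rule powr_mult)
    finally show ?thesis .
  qed
  have sq: "(norm (x - y))\<^sup>2 / t + (norm (y - z))\<^sup>2 / s = (norm (x - z))\<^sup>2 / (t + s) + (norm (y - m))\<^sup>2 / r" for y
  proof -
    define X Y where "X = x - z" and "Y = y - z"
    have 1: "x - y = X - Y" "y - m = Y - (s / (t + s)) *\<^sub>R X" by (auto simp: X_def Y_def m_def)
    have 2: "(norm (X - Y))\<^sup>2 = X \<bullet> X - 2 * (X \<bullet> Y) + Y \<bullet> Y"
      "(norm (Y - (s / (t + s)) *\<^sub>R X))\<^sup>2 = Y \<bullet> Y - 2 * (s / (t + s)) * (X \<bullet> Y) + (s / (t + s))\<^sup>2 * (X \<bullet> X)"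
      unfolding power2_norm_eq_inner
      by (simp_all add: inner_diff_left inner_diff_right inner_commute power2_eq_square algebra_simps)
    have 3: "1 / t = 1 / (t + s) + (s / (t + s))\<^sup>2 / r" "1 / t = s / (t + s) / r" "1 / t + 1 / s = 1 / r"
    proof -
      define q where "q = t + s"
      have q: "q > 0" using t s by (simp add: q_def)
      have "1 / q + (s / q)\<^sup>2 / (t * s / q) = 1 / q + s / (q * t)" using t s q by (simp add: power2_eq_square)
      also have "\<dots> = (t + s) / (q * t)" using t q by (simp add: add_divide_distrib)
      also have "\<dots> = 1 / t" using q by (simp flip: q_def)
      finally show "1 / t = 1 / (t + s) + (s / (t + s))\<^sup>2 / r" by (simp add: r_def q_def)
      have "s / q / (t * s / q) = 1 / t" using t s q by simp
      then show "1 / t = s / (t + s) / r" by (simp add: r_def q_def)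
      show "1 / t + 1 / s = 1 / r" using t s by (simp add: r_def field_simps)
    qed
    have "(X \<bullet> X - 2 * (X \<bullet> Y) + Y \<bullet> Y) / t + Y \<bullet> Y / s
        = (X \<bullet> X) * (1 / t) - 2 * (X \<bullet> Y) * (1 / t) + (Y \<bullet> Y) * (1 / t + 1 / s)"
      by (simp add: add_divide_distrib diff_divide_distrib distrib_left)
    also have "\<dots> = (X \<bullet> X) * (1 / (t + s) + (s / (t + s))\<^sup>2 / r) - 2 * (X \<bullet> Y) * (s / (t + s) / r) + (Y \<bullet> Y) * (1 / r)"
      by (subst (1) 3(1), subst 3(2), subst 3(3)) (rule refl)
    also have "\<dots> = X \<bullet> X / (t + s) + (Y \<bullet> Y - 2 * (s / (t + s)) * (X \<bullet> Y) + (s / (t + s))\<^sup>2 * (X \<bullet> X)) / r"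
      by (simp add: add_divide_distrib diff_divide_distrib distrib_left mult_ac)
    finally show ?thesis unfolding 1 2 by (simp add: X_def[symmetric] Y_def[symmetric] power2_norm_eq_inner)
  qed
  have eq: "gker a t (x - y) * gker a s (y - z) = gker a (t + s) (x - z) * gker a r (y - m)" for y
  proof -
    have e: "- of_real u / (4 * (of_real v * a)) = of_real (u / v) * (- 1 / (4 * a))" for u v :: real
      by simp
    have "exp (- of_real ((norm (x - y))\<^sup>2) / (4 * (of_real t * a))) * exp (- of_real ((norm (y - z))\<^sup>2) / (4 * (of_real s * a)))
        = exp (of_real ((norm (x - y))\<^sup>2 / t + (norm (y - z))\<^sup>2 / s) * (- 1 / (4 * a)))"
      unfolding e exp_add[symmetric] by (simp only: of_real_add distrib_right)
    also have "\<dots> = exp (- of_real ((norm (x - z))\<^sup>2) / (4 * (of_real (t + s) * a))) * exp (- of_real ((norm (y - m))\<^sup>2) / (4 * (of_real r * a)))"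
      unfolding e exp_add[symmetric] sq by (simp only: of_real_add distrib_right)
    finally have E: "exp (- of_real ((norm (x - y))\<^sup>2) / (4 * (of_real t * a))) * exp (- of_real ((norm (y - z))\<^sup>2) / (4 * (of_real s * a)))
        = exp (- of_real ((norm (x - z))\<^sup>2) / (4 * (of_real (t + s) * a))) * exp (- of_real ((norm (y - m))\<^sup>2) / (4 * (of_real r * a)))" .
    have "gker a t (x - y) * gker a s (y - z) = of_real (?c t * ?c s) * (?d * ?d) *
        (exp (- of_real ((norm (x - y))\<^sup>2) / (4 * (of_real t * a))) * exp (- of_real ((norm (y - z))\<^sup>2) / (4 * (of_real s * a))))"
      unfolding gker_def by (simp only: of_real_mult mult_ac)
    also have "\<dots> = gker a (t + s) (x - z) * gker a r (y - m)"
      unfolding gker_def c E by (simp only: of_real_mult mult_ac)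
    finally show ?thesis .
  qed
  have I: "has_bochner_integral lborel (\<lambda>y::'a. gker a r (y - m)) 1"
  proof -
    have "lborel = distr lborel borel (\<lambda>x. - m + 1 *\<^sub>R x)"
      using lborel_affine[of 1 "- m"] by (simp add: density_1)
    then have "has_bochner_integral (distr lborel borel (\<lambda>x. - m + 1 *\<^sub>R x)) (gker a r) 1"
      using gker_integral[OF a r, where 'a='a] by simp
    then show ?thesis
      unfolding has_bochner_integral_iff by (simp add: integrable_distr_eq integral_distr)
  qed
  have "has_bochner_integral lborel (\<lambda>y. gker a (t + s) (x - z) * gker a r (y - m)) (gker a (t + s) (x - z) * 1)"
    using I by (rule has_bochner_integral_mult_right)
  then show ?thesis by (simp add: eq)
qed

lemma integral_scaling:
  fixes f :: "'a::euclidean_space \<Rightarrow> complex"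
  assumes [measurable]: "f \<in> borel_measurable borel" and s: "s > 0"
  shows "(LINT \<xi>|lborel. f \<xi>) = of_real (s ^ DIM('a)) * (LINT y|lborel. f (m - s *\<^sub>R y))"
proof -
  have "lborel = density (distr lborel borel (\<lambda>y. m + (- s) *\<^sub>R y)) (\<lambda>_. ennreal (\<bar>- s\<bar> ^ DIM('a)))"
    using lborel_affine[of "- s" m] s by (simp only: ennreal_power abs_ge_zero)
  then have "(LINT \<xi>|lborel. f \<xi>) = (LINT \<xi>|density (distr lborel borel (\<lambda>y. m + (- s) *\<^sub>R y)) (\<lambda>_. ennreal (\<bar>- s\<bar> ^ DIM('a))). f \<xi>)"
    by simp
  also have "\<dots> = (LINT \<xi>|distr lborel borel (\<lambda>y. m + (- s) *\<^sub>R y). (\<bar>- s\<bar> ^ DIM('a)) *\<^sub>R f \<xi>)"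
    by (rule integral_density) auto
  also have "\<dots> = (LINT y|lborel. (\<bar>- s\<bar> ^ DIM('a)) *\<^sub>R f (m + (- s) *\<^sub>R y))"
    by (rule integral_distr) auto
  finally show ?thesis using s by (simp add: scaleR_conv_of_real)
qed

text \<open>By \<open>nn_integral_gauss_exp_norm\<close>, the factor by which the weight
  \<open>exp (m |y|)\<close> multiplies the mass of a Gaussian of rate \<open>c\<close> in dimension
  \<open>d\<close>, with \<open>x = m^2 / (4 c)\<close>.\<close>

definition kummer_bracket :: "real \<Rightarrow> real \<Rightarrow> real" where
  "kummer_bracket d x = kummer_1F1 (d / 2) (1 / 2) x
        + 2 * (Gamma ((d + 1) / 2) / Gamma (d / 2)) * sqrt x * kummer_1F1 ((d + 1) / 2) (3 / 2) x"

locale OU_weight = weighted_Lp p \<theta> for p :: real and \<theta> :: "real ^ 'd \<Rightarrow> real" +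
  fixes \<eta> C :: real and S :: "real ^ 'd ^ 'd"
  assumes growth: "\<And>x y. \<theta> (x + y) \<le> C * \<theta> x * exp (\<eta> * norm y)"
    and eta_nonneg: "\<eta> \<ge> 0" and C_pos: "C > 0" and radial: "radial \<theta>" and skew: "transpose S = - S"
begin

lemma weight_rot: "\<theta> (rot S t x) = \<theta> x"
  using radial rot_norm[OF skew, of t x] by (auto simp: radial_def)

lemma rot_measurable [measurable]: "(\<lambda>z. rot S (fst z) (snd z)) \<in> borel_measurable (borel \<Otimes>\<^sub>M borel)"
  using rot_continuous[of S] unfolding borel_prod by (rule borel_measurable_continuous_onI)

lemma rot_borel [measurable]: "rot S t \<in> borel_measurable borel"
  using rot_linear by (intro borel_measurable_continuous_onI linear_continuous_on) (simp add: linear_conv_bounded_linear)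

lemma nn_integral_rot:
  assumes [measurable]: "f \<in> borel_measurable borel"
  shows "(\<integral>\<^sup>+x. f (rot S t x) \<partial>lborel) = (\<integral>\<^sup>+x. f x \<partial>lborel)"
  using nn_integral_distr[of "rot S t" lborel borel f] rot_distr[OF skew, of t] by simp

text \<open>Young's inequality with weights. The Hoelder inequality with weight \<open>K\<close>
  costs \<open>C1 powr (p - 1)\<close>; the growth condition then moves the weight from the point of
  evaluation to \<open>\<xi>\<close> at the cost of \<open>C\<close> and
  \<open>exp (\<eta> * norm (y - \<xi>))\<close>, whose \<open>p\<close>-th power is integrated
  against \<open>K\<close> and gives \<open>C1\<close> times the Kummer bracket. The
  \<open>p\<close>-th root of the product is the constant in the norm bound.\<close>

lemma gauss_convolution_bound:
  fixes h :: "real ^ 'd \<Rightarrow> real"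
  assumes k: "k > 0" and c: "c > 0" and hm [measurable]: "h \<in> borel_measurable borel"
    and h0: "\<And>x. 0 \<le> h x" and hL: "h \<in> Lp_space p \<theta>"
  defines "d \<equiv> real CARD('d)"
  defines "K \<equiv> \<lambda>y::real ^ 'd. c * exp (- (k * (norm y)\<^sup>2))" and "C1 \<equiv> c * (pi / k) powr (d / 2)"
  shows "integrable lborel (\<lambda>\<xi>. K (rot S t x - \<xi>) * h \<xi>)"
    "(\<lambda>x. LINT \<xi>|lborel. K (rot S t x - \<xi>) * h \<xi>) \<in> Lp_space p \<theta>"
    "Lp_norm p \<theta> (\<lambda>x. LINT \<xi>|lborel. K (rot S t x - \<xi>) * h \<xi>)
      \<le> C * C1 * kummer_bracket d ((\<eta> * p)\<^sup>2 / (4 * k)) powr (1 / p) * Lp_norm p \<theta> h"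
proof -
  have [measurable]: "K \<in> borel_measurable borel" unfolding K_def by measurable
  have K0: "K y > 0" for y using c by (simp add: K_def)
  have Km: "K (- y) = K y" for y by (simp add: K_def)
  have C1: "C1 > 0" using c k by (simp add: C1_def)
  have dim: "real DIM(real ^ 'd) = d" by (simp add: d_def)
  let ?kb = "kummer_bracket d ((\<eta> * p)\<^sup>2 / (4 * k))"
  have kint: "(\<integral>\<^sup>+y. ennreal (exp (m * norm y) * K y) \<partial>lborel) = ennreal (C1 * kummer_bracket d (m\<^sup>2 / (4 * k)))" if "m \<ge> 0" for m
  proof -
    have "(\<integral>\<^sup>+y. ennreal (exp (m * norm y) * K y) \<partial>lborel) = (\<integral>\<^sup>+y. ennreal c * ennreal (exp (m * norm (y::real ^ 'd) - k * (norm y)\<^sup>2)) \<partial>lborel)"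
      using c by (intro nn_integral_cong) (simp add: K_def exp_diff exp_minus field_simps flip: ennreal_mult')
    also have "\<dots> = ennreal c * (\<integral>\<^sup>+y. ennreal (exp (m * norm (y::real ^ 'd) - k * (norm y)\<^sup>2)) \<partial>lborel)"
      by (rule nn_integral_cmult) measurable
    also have "\<dots> = ennreal (C1 * kummer_bracket d (m\<^sup>2 / (4 * k)))"
      unfolding nn_integral_gauss_exp_norm[OF k that] dim kummer_bracket_def[symmetric] C1_def
      using c by (simp only: ennreal_mult'[OF less_imp_le[OF c], symmetric] mult.assoc)
    finally show ?thesis .
  qed
  have Kint: "(\<integral>\<^sup>+y. ennreal (K y) \<partial>lborel) \<le> ennreal C1"
  proof -
    have "kummer_1F1 a b 0 = 1" for a b
      using powser_zero[of "\<lambda>n. pochhammer a n / pochhammer b n / fact n"]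
      by (simp add: kummer_1F1_def mult.commute)
    then show ?thesis using kint[of 0] by (simp add: kummer_bracket_def)
  qed
  have Kshift: "(\<integral>\<^sup>+\<xi>. ennreal (K (y - \<xi>)) \<partial>lborel) \<le> ennreal C1" for y
  proof -
    have "(\<integral>\<^sup>+\<xi>. ennreal (K (y - \<xi>)) \<partial>lborel) = (\<integral>\<^sup>+\<xi>. ennreal (K (\<xi> + - y)) \<partial>lborel)"
      by (intro nn_integral_cong) (metis Km minus_diff_eq diff_conv_add_uminus)
    also have "\<dots> = (\<integral>\<^sup>+y. ennreal (K y) \<partial>lborel)" by (rule nn_integral_lborel_translate) measurable
    finally show ?thesis using Kint by simp
  qed
  have hold: "K y powr (1 - p) * (K y * u) powr p = K y * u powr p" if "0 \<le> u" for y u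
    using K0[of y] that by (simp add: powr_mult mult.assoc[symmetric] flip: powr_add)
  have wt: "(\<theta> y * u) powr p \<le> C powr p * (exp (\<eta> * p * norm (y - \<xi>)) * (\<theta> \<xi> * u) powr p)" if "0 \<le> u" for y \<xi> u
  proof -
    have "\<theta> y \<le> C * \<theta> \<xi> * exp (\<eta> * norm (y - \<xi>))" using growth[of \<xi> "y - \<xi>"] by simp
    then have "\<theta> y * u \<le> C * (exp (\<eta> * norm (y - \<xi>)) * (\<theta> \<xi> * u))"
      using mult_right_mono[of "\<theta> y" "C * \<theta> \<xi> * exp (\<eta> * norm (y - \<xi>))" u] that by (simp add: mult_ac)
    then have "(\<theta> y * u) powr p \<le> (C * (exp (\<eta> * norm (y - \<xi>)) * (\<theta> \<xi> * u))) powr p"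
      using weight_pos[of y] that p_ge_1 by (intro powr_mono2) auto
    also have "\<dots> = C powr p * (exp (\<eta> * p * norm (y - \<xi>)) * (\<theta> \<xi> * u) powr p)"
      using C_pos weight_pos[of \<xi>] that by (simp add: powr_mult exp_powr_real mult_ac)
    finally show ?thesis .
  qed
  have hnn: "(\<integral>\<^sup>+\<xi>. ennreal ((\<theta> \<xi> * h \<xi>) powr p) \<partial>lborel) = ennreal (Lp_norm p \<theta> h powr p)"
    using Lp_nn_eq[OF hL] h0 by (simp add: nn_integral_completion)
  \<comment> \<open>The part of the estimate which is integrated over \<open>y\<close> afterwards;
    Tonelli's theorem splits it into the exponential moment of \<open>K\<close> and the
    \<open>p\<close>-th power of the norm of \<open>h\<close>.\<close>
  define G where "G y = (\<integral>\<^sup>+\<xi>. ennreal (K (y - \<xi>)) * ennreal (exp (\<eta> * p * norm (y - \<xi>))) * ennreal ((\<theta> \<xi> * h \<xi>) powr p) \<partial>lborel)" for y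
  have [measurable]: "G \<in> borel_measurable borel" unfolding G_def by measurable
  have Gle: "ennreal (\<theta> y powr p) * (\<integral>\<^sup>+\<xi>. ennreal (K (y - \<xi>) powr (1 - p) * (K (y - \<xi>) * h \<xi>) powr p) \<partial>lborel)
      \<le> ennreal (C powr p) * G y" for y
  proof -
    have "ennreal (\<theta> y powr p) * (\<integral>\<^sup>+\<xi>. ennreal (K (y - \<xi>) powr (1 - p) * (K (y - \<xi>) * h \<xi>) powr p) \<partial>lborel)
      = (\<integral>\<^sup>+\<xi>. ennreal (\<theta> y powr p) * ennreal (K (y - \<xi>) powr (1 - p) * (K (y - \<xi>) * h \<xi>) powr p) \<partial>lborel)"
      by (rule nn_integral_cmult[symmetric]) measurable
    also have "\<dots> \<le> (\<integral>\<^sup>+\<xi>. ennreal (C powr p) * (ennreal (K (y - \<xi>)) * ennreal (exp (\<eta> * p * norm (y - \<xi>))) * ennreal ((\<theta> \<xi> * h \<xi>) powr p)) \<partial>lborel)"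
    proof (rule nn_integral_mono)
      fix \<xi>
      have "\<theta> y powr p * (K (y - \<xi>) * h \<xi> powr p) = K (y - \<xi>) * (\<theta> y * h \<xi>) powr p"
        using weight_pos[of y] h0[of \<xi>] by (simp add: powr_mult)
      also have "\<dots> \<le> K (y - \<xi>) * (C powr p * (exp (\<eta> * p * norm (y - \<xi>)) * (\<theta> \<xi> * h \<xi>) powr p))"
        using K0[of "y - \<xi>"] wt[OF h0] by (intro mult_left_mono) auto
      also have "\<dots> = C powr p * (K (y - \<xi>) * exp (\<eta> * p * norm (y - \<xi>)) * (\<theta> \<xi> * h \<xi>) powr p)" by simp
      finally have le: "\<theta> y powr p * (K (y - \<xi>) * h \<xi> powr p) \<le> C powr p * (K (y - \<xi>) * exp (\<eta> * p * norm (y - \<xi>)) * (\<theta> \<xi> * h \<xi>) powr p)" .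
      show "ennreal (\<theta> y powr p) * ennreal (K (y - \<xi>) powr (1 - p) * (K (y - \<xi>) * h \<xi>) powr p)
        \<le> ennreal (C powr p) * (ennreal (K (y - \<xi>)) * ennreal (exp (\<eta> * p * norm (y - \<xi>))) * ennreal ((\<theta> \<xi> * h \<xi>) powr p))"
        unfolding hold[OF h0] using ennreal_leI[OF le] K0[of "y - \<xi>"]
        by (simp only: ennreal_mult'[OF powr_ge_zero] ennreal_mult''[OF powr_ge_zero] ennreal_mult''[OF exp_ge_zero])
    qed
    also have "\<dots> = ennreal (C powr p) * G y" unfolding G_def by (rule nn_integral_cmult) measurable
    finally show ?thesis .
  qed
  \<comment> \<open>Holds at every \<open>x\<close>, not only almost everywhere: completing the
    square shows that the Gaussian beats the exponential weight with a bound
    \<open>c * exp (m^2 / (4 k))\<close> independent of \<open>\<xi>\<close>, so \<open>G\<close> is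
    finite everywhere.\<close>
  show int: "integrable lborel (\<lambda>\<xi>. K (rot S t x - \<xi>) * h \<xi>)" for x
  proof (rule weighted_Hoelder_integrable[where c="\<lambda>\<xi>. K (rot S t x - \<xi>)", OF _ _ _ _ _ p_ge_1 Kshift])
    let ?y = "rot S t x"
    define m where "m = \<eta> * p"
    have "exp (m * r) * (c * exp (- (k * r\<^sup>2))) \<le> c * exp (m\<^sup>2 / (4 * k))" for r
    proof -
      have "k * (r - m / (2 * k))\<^sup>2 \<ge> 0" using k by simp
      moreover have "k * (r - m / (2 * k))\<^sup>2 = k * r\<^sup>2 - m * r + m\<^sup>2 / (4 * k)"
        using k by (simp add: power2_eq_square field_simps)
      ultimately have "m * r - k * r\<^sup>2 \<le> m\<^sup>2 / (4 * k)" by linarith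
      then show ?thesis using c by (simp add: exp_add[symmetric] mult.left_commute)
    qed
    then have B: "K y * exp (\<eta> * p * norm y) \<le> c * exp (m\<^sup>2 / (4 * k))" for y
      unfolding K_def m_def by (metis mult.commute)
    have "G ?y \<le> (\<integral>\<^sup>+\<xi>. ennreal (c * exp (m\<^sup>2 / (4 * k))) * ennreal ((\<theta> \<xi> * h \<xi>) powr p) \<partial>lborel)"
      unfolding G_def
    proof (rule nn_integral_mono)
      fix \<xi>
      show "ennreal (K (?y - \<xi>)) * ennreal (exp (\<eta> * p * norm (?y - \<xi>))) * ennreal ((\<theta> \<xi> * h \<xi>) powr p)
          \<le> ennreal (c * exp (m\<^sup>2 / (4 * k))) * ennreal ((\<theta> \<xi> * h \<xi>) powr p)"
        using B[of "?y - \<xi>"] by (intro mult_right_mono) (auto simp: ennreal_mult''[symmetric] intro!: ennreal_leI)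
    qed
    also have "\<dots> = ennreal (c * exp (m\<^sup>2 / (4 * k))) * ennreal (Lp_norm p \<theta> h powr p)"
      unfolding hnn[symmetric] by (rule nn_integral_cmult) measurable
    finally have "ennreal (C powr p) * G ?y \<le> ennreal (C powr p) * (ennreal (c * exp (m\<^sup>2 / (4 * k))) * ennreal (Lp_norm p \<theta> h powr p))"
      by (intro mult_left_mono) auto
    also have "\<dots> < \<infinity>" by (simp add: ennreal_mult_less_top)
    finally have "ennreal (\<theta> ?y powr p) * (\<integral>\<^sup>+\<xi>. ennreal (K (?y - \<xi>) powr (1 - p) * (K (?y - \<xi>) * h \<xi>) powr p) \<partial>lborel) < \<infinity>"
      using Gle[of ?y] by (rule order.strict_trans1[rotated])
    then show "(\<integral>\<^sup>+\<xi>. ennreal (K (?y - \<xi>) powr (1 - p) * (K (?y - \<xi>) * h \<xi>) powr p) \<partial>lborel) < \<infinity>"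
      using weight_pos[of ?y] by (auto simp: ennreal_mult_less_top)
  qed (use K0 h0 in \<open>auto simp: less_imp_le less_imp_neq[symmetric]\<close>)
  let ?w = "\<lambda>x. LINT \<xi>|lborel. K (rot S t x - \<xi>) * h \<xi>"
  have wm: "?w \<in> borel_measurable lebesgue" by (rule borel_imp_lebesgue_measurable) measurable
  have w0: "?w x \<ge> 0" for x using K0 h0 by (intro integral_nonneg_AE) (auto simp: less_imp_le)
  have "Lp_nn ?w = (\<integral>\<^sup>+x. ennreal ((\<theta> x * norm (?w x)) powr p) \<partial>lborel)"
    by (rule nn_integral_completion)
  also have "\<dots> \<le> (\<integral>\<^sup>+x. ennreal (C1 powr (p - 1)) * (ennreal (C powr p) * G (rot S t x)) \<partial>lborel)"
  proof (rule nn_integral_mono)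
    fix x let ?y = "rot S t x"
    have "ennreal ((\<theta> x * norm (?w x)) powr p) = ennreal (\<theta> ?y powr p) * ennreal (?w x powr p)"
      using w0[of x] weight_pos[of x] by (simp add: weight_rot powr_mult ennreal_mult')
    also have "\<dots> \<le> ennreal (\<theta> ?y powr p) * (ennreal (C1 powr (p - 1)) *
        (\<integral>\<^sup>+\<xi>. ennreal (K (?y - \<xi>) powr (1 - p) * (K (?y - \<xi>) * h \<xi>) powr p) \<partial>lborel))"
      by (intro mult_left_mono weighted_Hoelder[where c="\<lambda>\<xi>. K (?y - \<xi>)", OF _ _ _ _ _ p_ge_1 Kshift C1])
        (use K0 h0 in \<open>auto simp: less_imp_le less_imp_neq[symmetric]\<close>)
    also have "\<dots> = ennreal (C1 powr (p - 1)) * (ennreal (\<theta> ?y powr p) *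
        (\<integral>\<^sup>+\<xi>. ennreal (K (?y - \<xi>) powr (1 - p) * (K (?y - \<xi>) * h \<xi>) powr p) \<partial>lborel))"
      by (simp only: mult_ac)
    also have "\<dots> \<le> ennreal (C1 powr (p - 1)) * (ennreal (C powr p) * G ?y)"
      by (intro mult_left_mono Gle) auto
    finally show "ennreal ((\<theta> x * norm (?w x)) powr p) \<le> ennreal (C1 powr (p - 1)) * (ennreal (C powr p) * G ?y)" .
  qed
  also have "\<dots> = ennreal (C1 powr (p - 1)) * (ennreal (C powr p) * (\<integral>\<^sup>+x. G (rot S t x) \<partial>lborel))"
    by (simp add: nn_integral_cmult)
  \<comment> \<open>The rotation disappears because it preserves both the weight, used above, and
    Lebesgue measure.\<close>
  also have "(\<integral>\<^sup>+x. G (rot S t x) \<partial>lborel) = (\<integral>\<^sup>+y. G y \<partial>lborel)" by (rule nn_integral_rot) measurable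
  also have "(\<integral>\<^sup>+y. G y \<partial>lborel) = (\<integral>\<^sup>+\<xi>. \<integral>\<^sup>+y. ennreal (K (y - \<xi>)) * ennreal (exp (\<eta> * p * norm (y - \<xi>))) * ennreal ((\<theta> \<xi> * h \<xi>) powr p) \<partial>lborel \<partial>lborel)"
    unfolding G_def by (rule lborel_pair.Fubini'[symmetric]) measurable
  also have "\<dots> = (\<integral>\<^sup>+\<xi>. ennreal (C1 * ?kb) * ennreal ((\<theta> \<xi> * h \<xi>) powr p) \<partial>lborel)"
  proof (rule nn_integral_cong)
    fix \<xi>
    have "(\<integral>\<^sup>+y. ennreal (K (y - \<xi>)) * ennreal (exp (\<eta> * p * norm (y - \<xi>))) * ennreal ((\<theta> \<xi> * h \<xi>) powr p) \<partial>lborel)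
       = (\<integral>\<^sup>+y. ennreal (K (y + - \<xi>)) * ennreal (exp (\<eta> * p * norm (y + - \<xi>))) \<partial>lborel) * ennreal ((\<theta> \<xi> * h \<xi>) powr p)"
      by (simp add: nn_integral_multc)
    also have "(\<integral>\<^sup>+y. ennreal (K (y + - \<xi>)) * ennreal (exp (\<eta> * p * norm (y + - \<xi>))) \<partial>lborel)
        = (\<integral>\<^sup>+y. ennreal (K y) * ennreal (exp (\<eta> * p * norm y)) \<partial>lborel)"
      by (rule nn_integral_lborel_translate) measurable
    also have "\<dots> = (\<integral>\<^sup>+y. ennreal (exp (\<eta> * p * norm y) * K y) \<partial>lborel)"
      using K0 by (intro nn_integral_cong) (simp add: ennreal_mult''[symmetric] mult.commute)
    also have "\<dots> = ennreal (C1 * ?kb)" using kint[of "\<eta> * p"] eta_nonneg p_ge_1 by simp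
    finally show "(\<integral>\<^sup>+y. ennreal (K (y - \<xi>)) * ennreal (exp (\<eta> * p * norm (y - \<xi>))) * ennreal ((\<theta> \<xi> * h \<xi>) powr p) \<partial>lborel)
       = ennreal (C1 * ?kb) * ennreal ((\<theta> \<xi> * h \<xi>) powr p)" .
  qed
  also have "\<dots> = ennreal (C1 * ?kb) * ennreal (Lp_norm p \<theta> h powr p)"
    unfolding hnn[symmetric] by (rule nn_integral_cmult) measurable
  also have "ennreal (C1 powr (p - 1)) * (ennreal (C powr p) * (ennreal (C1 * ?kb) * ennreal (Lp_norm p \<theta> h powr p)))
      = ennreal ((C * C1 * ?kb powr (1 / p) * Lp_norm p \<theta> h) powr p)"
  proof (cases "?kb \<ge> 0")
    case True
    have "(C * C1 * ?kb powr (1 / p) * Lp_norm p \<theta> h) powr p = C powr p * C1 powr p * ?kb * Lp_norm p \<theta> h powr p"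
      using True C_pos C1 p_ge_1 by (simp add: powr_mult powr_powr)
    also have "C1 powr p = C1 powr (p - 1) * C1" using C1 by (simp add: powr_diff)
    finally show ?thesis using True C1 by (simp add: mult_ac flip: ennreal_mult')
  next
    case False
    \<comment> \<open>A negative bracket would be truncated by \<open>ennreal\<close>; then a
      strictly positive function would have integral zero, which makes the whole space a null
      set.\<close>
    have "ennreal (C1 * ?kb) = (\<integral>\<^sup>+y. ennreal (exp (\<eta> * p * norm y) * K y) \<partial>lborel)"
      using kint[of "\<eta> * p"] eta_nonneg p_ge_1 by simp
    moreover have "ennreal (C1 * ?kb) = 0" using False C1 by (intro ennreal_neg) (simp add: mult_le_0_iff)
    ultimately have "AE y in lborel. ennreal (exp (\<eta> * p * norm y) * K y) = 0"
      by (subst (asm) eq_commute) (simp add: nn_integral_0_iff_AE)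
    then have "AE y in (lborel :: (real ^ 'd) measure). False"
    proof eventually_elim
      case (elim y)
      then have "exp (\<eta> * p * norm y) * K y \<le> 0" by (simp only: ennreal_eq_0_iff)
      with mult_pos_pos[OF exp_gt_zero[of "\<eta> * p * norm y"] K0[of y]] show ?case by linarith
    qed
    then show ?thesis by (simp add: AE_iff_null null_sets_def)
  qed
  finally have "Lp_nn ?w \<le> ennreal ((C * C1 * ?kb powr (1 / p) * Lp_norm p \<theta> h) powr p)" .
  from Lp_normI[OF wm this] C_pos C1
  show "?w \<in> Lp_space p \<theta>" "Lp_norm p \<theta> ?w \<le> C * C1 * ?kb powr (1 / p) * Lp_norm p \<theta> h"
    by auto
qed

end

section \<open>One eigenvalue pair: the scalar operators\<close>

context OU_weight
begin

text \<open>The semigroup in one coordinate of the eigenbasis, for the eigenvalues \<open>a\<close>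
  of the diffusion and \<open>b\<close> of the zeroth-order matrix. It is later used with
  \<open>b k + z\<close> in place of \<open>b\<close>, which takes up the factor
  \<open>exp (- z * t)\<close>.\<close>

definition V :: "complex \<Rightarrow> complex \<Rightarrow> real \<Rightarrow> (real ^ 'd \<Rightarrow> complex) \<Rightarrow> real ^ 'd \<Rightarrow> complex" where
  "V a b t u x = exp (- (b * of_real t)) * (LINT \<xi>|lborel. gker a t (rot S t x - \<xi>) * u \<xi>)"

lemma V_jointly_measurable:
  assumes [measurable]: "u \<in> borel_measurable borel"
  shows "(\<lambda>z. V a b (fst z) u (snd z)) \<in> borel_measurable (borel \<Otimes>\<^sub>M borel)"
proof -
  have "(\<lambda>w. (fst (fst w), rot S (fst (fst w)) (snd (fst w)) - snd w)) \<in>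
      (borel \<Otimes>\<^sub>M borel) \<Otimes>\<^sub>M borel \<rightarrow>\<^sub>M borel \<Otimes>\<^sub>M borel"
    by measurable
  from measurable_compose[OF this gker_measurable[of a]]
  have [measurable]: "(\<lambda>w. gker a (fst (fst w)) (rot S (fst (fst w)) (snd (fst w)) - snd w))
      \<in> borel_measurable ((borel \<Otimes>\<^sub>M borel) \<Otimes>\<^sub>M borel)"
    by (simp only: fst_conv snd_conv)
  have "(\<lambda>w. gker a (fst (fst w)) (rot S (fst (fst w)) (snd (fst w)) - snd w) * u (snd w))
      \<in> borel_measurable ((borel \<Otimes>\<^sub>M borel) \<Otimes>\<^sub>M lborel)"
    by measurable
  then have [measurable]: "(\<lambda>z. LINT \<xi>|lborel. gker a (fst z) (rot S (fst z) (snd z) - \<xi>) * u \<xi>)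
      \<in> borel_measurable (borel \<Otimes>\<^sub>M borel)"
    by (intro lborel.borel_measurable_lebesgue_integral) (simp add: case_prod_beta')
  show ?thesis unfolding V_def by measurable
qed

lemma V_measurable:
  assumes "u \<in> borel_measurable borel"
  shows "V a b t u \<in> borel_measurable borel"
proof -
  have "Pair t \<in> borel \<rightarrow>\<^sub>M borel \<Otimes>\<^sub>M (borel :: (real ^ 'd) measure)" by (rule measurable_Pair1') simp
  from measurable_compose[OF this V_jointly_measurable[OF assms]] show ?thesis
    by (simp only: fst_conv snd_conv)
qed

lemma Lp_norm_fun:
  "v \<in> Lp_space p \<theta> \<Longrightarrow> (\<lambda>x. norm (v x)) \<in> Lp_space p \<theta>"
  using Lp_bound(1)[of v "\<lambda>x. norm (v x)" 1] Lp_measurable[of v] by auto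

lemma gker_bound_integrable:
  fixes W :: "real ^ 'd \<Rightarrow> real"
  assumes a: "Re a > 0" and t: "t > 0" and W: "W \<in> borel_measurable borel" "W \<in> Lp_space p \<theta>" "\<And>x. 0 \<le> W x"
  shows "integrable lborel (\<lambda>\<xi>. norm (gker a t (rot S t x - \<xi>)) * W \<xi>)"
    "(\<lambda>x. LINT \<xi>|lborel. norm (gker a t (rot S t x - \<xi>)) * W \<xi>) \<in> Lp_space p \<theta>"
proof -
  have pos: "Re a / (4 * t * (cmod a)\<^sup>2) > 0" "(4 * pi * t * cmod a) powr - (real DIM(real ^ 'd) / 2) > 0"
    using a t by (auto intro!: divide_pos_pos mult_pos_pos)
  show "integrable lborel (\<lambda>\<xi>. norm (gker a t (rot S t x - \<xi>)) * W \<xi>)"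
    unfolding norm_gker[OF a t] by (rule gauss_convolution_bound(1)[OF pos W(1,3,2)])
  show "(\<lambda>x. LINT \<xi>|lborel. norm (gker a t (rot S t x - \<xi>)) * W \<xi>) \<in> Lp_space p \<theta>"
    unfolding norm_gker[OF a t] by (rule gauss_convolution_bound(2)[OF pos W(1,3,2)])
qed

lemma V_integrable:
  assumes a: "Re a > 0" and t: "t > 0" and um: "u \<in> borel_measurable borel" and u: "u \<in> Lp_space p \<theta>"
  shows "integrable lborel (\<lambda>\<xi>. gker a t (rot S t x - \<xi>) * u \<xi>)"
proof -
  have [measurable]: "u \<in> borel_measurable borel" by fact
  have "integrable lborel (\<lambda>\<xi>. norm (gker a t (rot S t x - \<xi>)) * norm (u \<xi>))"
    by (rule gker_bound_integrable(1)[OF a t _ Lp_norm_fun[OF u]]) auto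
  then show ?thesis
    by (rule Bochner_Integration.integrable_bound) (auto simp: norm_mult)
qed

text \<open>The Chapman-Kolmogorov equation: after Fubini's theorem it reduces to the convolution
  identity of the kernels, once the inner rotation has been removed by a change of
  variables.\<close>

lemma V_semigroup:
  assumes a: "Re a > 0" and t: "t > 0" and s: "s > 0" and um: "u \<in> borel_measurable borel" and u: "u \<in> Lp_space p \<theta>"
  shows "V a b t (V a b s u) x = V a b (t + s) u x"
proof -
  have [measurable]: "u \<in> borel_measurable borel" by fact
  define f where "f = (\<lambda>(\<xi>, \<zeta>). gker a t (rot S t x - \<xi>) * (gker a s (rot S s \<xi> - \<zeta>) * u \<zeta>))"
  have fm: "f \<in> borel_measurable (lborel \<Otimes>\<^sub>M lborel)"
    unfolding f_def by measurable
  \<comment> \<open>The inner integral of absolute values is again a nonnegative element of the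
    weighted space, so the kernel bound can be applied to it a second time.\<close>
  have int: "integrable (lborel \<Otimes>\<^sub>M lborel) f"
  proof (rule lborel_pair.Fubini_integrable[OF fm])
    have "(LINT \<zeta>|lborel. norm (f (\<xi>, \<zeta>))) = norm (gker a t (rot S t x - \<xi>)) *
        (LINT \<zeta>|lborel. norm (gker a s (rot S s \<xi> - \<zeta>)) * norm (u \<zeta>))" for \<xi>
      by (simp add: f_def norm_mult)
    moreover have "integrable lborel (\<lambda>\<xi>. norm (gker a t (rot S t x - \<xi>)) *
        (LINT \<zeta>|lborel. norm (gker a s (rot S s \<xi> - \<zeta>)) * norm (u \<zeta>)))"
    proof (rule gker_bound_integrable(1)[OF a t])
      show "(\<lambda>\<xi>. LINT \<zeta>|lborel. norm (gker a s (rot S s \<xi> - \<zeta>)) * norm (u \<zeta>)) \<in> borel_measurable borel"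
        by measurable
      show "(\<lambda>\<xi>. LINT \<zeta>|lborel. norm (gker a s (rot S s \<xi> - \<zeta>)) * norm (u \<zeta>)) \<in> Lp_space p \<theta>"
        by (rule gker_bound_integrable(2)[OF a s _ Lp_norm_fun[OF u]]) auto
    qed auto
    ultimately show "integrable lborel (\<lambda>\<xi>. LINT \<zeta>|lborel. norm (f (\<xi>, \<zeta>)))" by simp
    show "AE \<xi> in lborel. integrable lborel (\<lambda>\<zeta>. f (\<xi>, \<zeta>))"
      unfolding f_def using V_integrable[OF a s um u] by (auto intro!: integrable_mult_right)
  qed
  have inner: "(LINT \<xi>|lborel. gker a t (rot S t x - \<xi>) * gker a s (rot S s \<xi> - \<zeta>)) = gker a (t + s) (rot S (t + s) x - \<zeta>)" for \<zeta>
  proof -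
    \<comment> \<open>The kernel depends on the norm alone, so \<open>rot S s\<close> may be applied
      to its argument. Then \<open>\<xi>\<close> occurs only through \<open>rot S s \<xi>\<close>,
      and the measure preserving substitution turns the integral into a plain convolution.\<close>
    have "gker a t (rot S t x - \<xi>) = gker a t (rot S (t + s) x - rot S s \<xi>)" for \<xi>
    proof (rule gker_cong_norm)
      have "rot S (t + s) x - rot S s \<xi> = rot S s (rot S t x - \<xi>)"
        by (simp add: rot_rot[OF skew] add.commute matrix_vector_mult_diff_distrib)
      then show "norm (rot S t x - \<xi>) = norm (rot S (t + s) x - rot S s \<xi>)"
        by (simp only: rot_norm[OF skew])
    qed
    then have "(LINT \<xi>|lborel. gker a t (rot S t x - \<xi>) * gker a s (rot S s \<xi> - \<zeta>))
       = (LINT \<xi>|lborel. gker a t (rot S (t + s) x - rot S s \<xi>) * gker a s (rot S s \<xi> - \<zeta>))" by simp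
    also have "\<dots> = (LINT y|distr lborel borel (rot S s). gker a t (rot S (t + s) x - y) * gker a s (y - \<zeta>))"
      by (rule integral_distr[symmetric]) measurable
    also have "\<dots> = gker a (t + s) (rot S (t + s) x - \<zeta>)"
      unfolding rot_distr[OF skew] using gker_convolution[OF a t s, of "rot S (t + s) x" \<zeta>] by (simp add: has_bochner_integral_iff)
    finally show ?thesis .
  qed
  have "(LINT \<xi>|lborel. gker a t (rot S t x - \<xi>) * V a b s u \<xi>)
      = exp (- (b * of_real s)) * (LINT \<xi>|lborel. LINT \<zeta>|lborel. f (\<xi>, \<zeta>))"
  proof -
    have f': "(LINT \<zeta>|lborel. f (\<xi>, \<zeta>)) = gker a t (rot S t x - \<xi>) * (LINT \<zeta>|lborel. gker a s (rot S s \<xi> - \<zeta>) * u \<zeta>)" for \<xi>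
      by (simp add: f_def)
    show ?thesis
      unfolding V_def f' integral_mult_right_zero[symmetric]
      by (intro Bochner_Integration.integral_cong refl mult.left_commute)
  qed
  also have "(LINT \<xi>|lborel. LINT \<zeta>|lborel. f (\<xi>, \<zeta>)) = (LINT \<zeta>|lborel. LINT \<xi>|lborel. f (\<xi>, \<zeta>))"
    using lborel_pair.Fubini_integral[of "\<lambda>\<xi> \<zeta>. f (\<xi>, \<zeta>)"] int by simp
  also have "\<dots> = (LINT \<zeta>|lborel. gker a (t + s) (rot S (t + s) x - \<zeta>) * u \<zeta>)"
  proof (rule Bochner_Integration.integral_cong[OF refl])
    fix \<zeta>
    have "(LINT \<xi>|lborel. f (\<xi>, \<zeta>)) = (LINT \<xi>|lborel. gker a t (rot S t x - \<xi>) * gker a s (rot S s \<xi> - \<zeta>) * u \<zeta>)"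
      by (simp add: f_def mult.assoc)
    also have "\<dots> = (LINT \<xi>|lborel. gker a t (rot S t x - \<xi>) * gker a s (rot S s \<xi> - \<zeta>)) * u \<zeta>"
      by (rule integral_mult_left_zero)
    finally show "(LINT \<xi>|lborel. f (\<xi>, \<zeta>)) = gker a (t + s) (rot S (t + s) x - \<zeta>) * u \<zeta>"
      unfolding inner .
  qed
  finally have "V a b t (V a b s u) x = (exp (- (b * of_real t)) * exp (- (b * of_real s))) *
      (LINT \<zeta>|lborel. gker a (t + s) (rot S (t + s) x - \<zeta>) * u \<zeta>)"
    unfolding V_def[of a b t] by (simp only: mult.assoc)
  also have "exp (- (b * of_real t)) * exp (- (b * of_real s)) = exp (- (b * of_real (t + s)))"
    by (simp only: exp_add[symmetric] of_real_add distrib_left minus_add_distrib)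
  finally show ?thesis by (simp add: V_def)
qed

text \<open>Fubini's theorem once more. The condition on the integral of the norms is what lets the
  kernel bound provide absolute integrability on the product.\<close>

lemma V_commutes_with_integral:
  fixes w :: "'t \<Rightarrow> real ^ 'd \<Rightarrow> complex"
  assumes a: "Re a > 0" and t: "t > 0" and sf: "sigma_finite_measure M"
    and wm: "(\<lambda>z. w (snd z) (fst z)) \<in> borel_measurable (borel \<Otimes>\<^sub>M M)"
    and ae: "AE \<xi> in lborel. integrable M (\<lambda>s. w s \<xi>)"
    and W: "(\<lambda>\<xi>. LINT s|M. norm (w s \<xi>)) \<in> Lp_space p \<theta>"
  shows "V a b t (\<lambda>\<xi>. LINT s|M. w s \<xi>) x = (LINT s|M. V a b t (w s) x)"
    "integrable M (\<lambda>s. V a b t (w s) x)"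
proof -
  interpret sigma_finite_measure M by fact
  interpret pair_sigma_finite lborel M by standard
  have [measurable]: "(\<lambda>z. w (snd z) (fst z)) \<in> borel_measurable (borel \<Otimes>\<^sub>M M)" by fact
  have "(\<lambda>z. norm (w (snd z) (fst z))) \<in> borel_measurable (borel \<Otimes>\<^sub>M M)" by measurable
  then have Wm: "(\<lambda>\<xi>. LINT s|M. norm (w s \<xi>)) \<in> borel_measurable borel"
    using sigma_finite_measure.borel_measurable_lebesgue_integral[OF sf, of "\<lambda>\<xi> s. norm (w s \<xi>)" borel]
    by (simp add: case_prod_beta')
  define f where "f = (\<lambda>(\<xi>, s). gker a t (rot S t x - \<xi>) * w s \<xi>)"
  have "(\<lambda>z. gker a t (rot S t x - fst z) * w (snd z) (fst z)) \<in> borel_measurable (borel \<Otimes>\<^sub>M M)" by measurable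
  then have fm: "f \<in> borel_measurable (lborel \<Otimes>\<^sub>M M)"
    unfolding f_def by (simp add: case_prod_beta')
  have int: "integrable (lborel \<Otimes>\<^sub>M M) f"
  proof (rule Fubini_integrable[OF fm])
    have "integrable lborel (\<lambda>\<xi>. norm (gker a t (rot S t x - \<xi>)) * (LINT s|M. norm (w s \<xi>)))"
      by (rule gker_bound_integrable(1)[OF a t Wm W]) simp
    then show "integrable lborel (\<lambda>\<xi>. LINT s|M. norm (f (\<xi>, s)))" by (simp add: f_def norm_mult)
    show "AE \<xi> in lborel. integrable M (\<lambda>s. f (\<xi>, s))"
      using ae by eventually_elim (simp add: f_def)
  qed
  have "(LINT \<xi>|lborel. gker a t (rot S t x - \<xi>) * (LINT s|M. w s \<xi>)) = (LINT \<xi>|lborel. LINT s|M. f (\<xi>, s))"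
    by (simp add: f_def)
  also have "\<dots> = (LINT s|M. LINT \<xi>|lborel. f (\<xi>, s))"
    using Fubini_integral[of "\<lambda>\<xi> s. f (\<xi>, s)"] int by simp
  finally show "V a b t (\<lambda>\<xi>. LINT s|M. w s \<xi>) x = (LINT s|M. V a b t (w s) x)" by (simp add: V_def f_def)
  have "integrable M (\<lambda>s. LINT \<xi>|lborel. f (\<xi>, s))"
    using integrable_snd[of "\<lambda>\<xi> s. f (\<xi>, s)"] int by simp
  then show "integrable M (\<lambda>s. V a b t (w s) x)"
    unfolding V_def f_def by (intro integrable_mult_right) simp
qed

text \<open>Supplies the dominating function for strong continuity: the weight grows at most
  exponentially, which a Gaussian absorbs.\<close>

lemma gauss_in_Lp:
  assumes q: "q > 0" and B: "B \<ge> 0"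
  shows "(\<lambda>x::real ^ 'd. B * exp (- (q * (norm x)\<^sup>2))) \<in> Lp_space p \<theta>"
proof -
  have le: "(\<theta> x * norm (B * exp (- (q * (norm x)\<^sup>2)))) powr p
      \<le> (C * \<theta> 0 * B) powr p * exp (\<eta> * p * norm x - q * p * (norm x)\<^sup>2)" for x
  proof -
    have "\<theta> x * (B * exp (- (q * (norm x)\<^sup>2))) \<le> C * \<theta> 0 * exp (\<eta> * norm x) * (B * exp (- (q * (norm x)\<^sup>2)))"
      using growth[of 0 x] B by (intro mult_right_mono) auto
    also have "\<dots> = (C * \<theta> 0 * B) * exp (\<eta> * norm x - q * (norm x)\<^sup>2)"
      by (simp add: exp_diff exp_minus field_simps)
    finally have "(\<theta> x * (B * exp (- (q * (norm x)\<^sup>2)))) powr p \<le> ((C * \<theta> 0 * B) * exp (\<eta> * norm x - q * (norm x)\<^sup>2)) powr p"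
      using weight_pos[of x] B p_ge_1 by (intro powr_mono2) auto
    also have "\<dots> = (C * \<theta> 0 * B) powr p * exp (\<eta> * p * norm x - q * p * (norm x)\<^sup>2)"
      using C_pos weight_pos[of 0] B by (simp add: powr_mult exp_powr_real algebra_simps)
    finally show ?thesis using B by simp
  qed
  have "Lp_nn (\<lambda>x::real ^ 'd. B * exp (- (q * (norm x)\<^sup>2)))
      = (\<integral>\<^sup>+x. ennreal ((\<theta> x * norm (B * exp (- (q * (norm x)\<^sup>2)))) powr p) \<partial>lborel)"
    by (rule nn_integral_completion)
  also have "\<dots> \<le> (\<integral>\<^sup>+x. ennreal ((C * \<theta> 0 * B) powr p) * ennreal (exp (\<eta> * p * norm (x::real ^ 'd) - q * p * (norm x)\<^sup>2)) \<partial>lborel)"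
    using le by (intro nn_integral_mono) (simp add: ennreal_leI flip: ennreal_mult')
  also have "\<dots> = ennreal ((C * \<theta> 0 * B) powr p) * (\<integral>\<^sup>+x. ennreal (exp (\<eta> * p * norm (x::real ^ 'd) - q * p * (norm x)\<^sup>2)) \<partial>lborel)"
    by (rule nn_integral_cmult) measurable
  also have "\<dots> < \<infinity>"
  proof -
    have "(\<integral>\<^sup>+x. ennreal (exp (\<eta> * p * norm (x::real ^ 'd) - q * p * (norm x)\<^sup>2)) \<partial>lborel) < top"
      using q p_ge_1 eta_nonneg by (subst nn_integral_gauss_exp_norm) auto
    then show ?thesis by (simp add: ennreal_mult_less_top)
  qed
  finally show ?thesis
    unfolding Lp_space_iff by (intro conjI borel_imp_lebesgue_measurable) measurable
qed

text \<open>Substituting \<open>\<xi> = rot S t x - sqrt t y\<close> freezes the kernel at time 1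
  and moves \<open>t\<close> into the argument of \<open>u\<close>, where continuity of
  \<open>u\<close> can handle the limit.\<close>

lemma V_rescaled:
  assumes t: "t > 0" and [measurable]: "u \<in> borel_measurable borel"
  shows "V a b t u x = exp (- (b * of_real t)) * (LINT y|lborel. gker a 1 y * u (rot S t x - sqrt t *\<^sub>R y))"
proof -
  let ?f = "\<lambda>\<xi>. gker a t (rot S t x - \<xi>) * u \<xi>"
  have g: "of_real (sqrt t ^ CARD('d)) * gker a t (sqrt t *\<^sub>R y) = gker a 1 y" for y :: "real ^ 'd"
  proof -
    have 1: "- complex_of_real ((norm (sqrt t *\<^sub>R y))\<^sup>2) / (4 * (of_real t * a)) = - complex_of_real ((norm y)\<^sup>2) / (4 * (of_real 1 * a))"
      using t by (simp add: power_mult_distrib)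
    have "sqrt t ^ CARD('d) = t powr (real CARD('d) / 2)"
      using t by (simp add: powr_realpow[symmetric] powr_half_sqrt[symmetric] powr_powr)
    moreover have "(4 * pi * t) powr - (real CARD('d) / 2) = (4 * pi) powr - (real CARD('d) / 2) * t powr - (real CARD('d) / 2)"
      by (rule powr_mult)
    moreover have "t powr (real CARD('d) / 2) * t powr - (real CARD('d) / 2) = 1"
      using t by (simp flip: powr_add)
    ultimately have "sqrt t ^ CARD('d) * (4 * pi * t) powr - (real CARD('d) / 2) = (4 * pi * 1) powr - (real CARD('d) / 2)"
      by (simp add: mult.left_commute)
    then have 2: "of_real (sqrt t ^ CARD('d)) * complex_of_real ((4 * pi * t) powr - (real CARD('d) / 2)) = of_real ((4 * pi * 1) powr - (real CARD('d) / 2))"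
      by (simp only: of_real_mult[symmetric])
    have d: "DIM(real ^ 'd) = CARD('d)" by simp
    show ?thesis unfolding gker_def 1 d by (simp only: mult.assoc[symmetric] 2)
  qed
  have "(LINT \<xi>|lborel. ?f \<xi>) = of_real (sqrt t ^ DIM(real ^ 'd)) * (LINT y|lborel. ?f (rot S t x - sqrt t *\<^sub>R y))"
    by (rule integral_scaling) (use t in auto)
  also have "\<dots> = (LINT y|lborel. of_real (sqrt t ^ CARD('d)) * (gker a t (sqrt t *\<^sub>R y) * u (rot S t x - sqrt t *\<^sub>R y)))"
    by simp
  also have "\<dots> = (LINT y|lborel. gker a 1 y * u (rot S t x - sqrt t *\<^sub>R y))"
    by (simp only: mult.assoc[symmetric] g)
  finally show ?thesis by (simp only: V_def)
qed

text \<open>In the rescaled form the values converge pointwise because \<open>gker a 1\<close> has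
  integral 1. For \<open>t \<le> 1\<close> the integrand is nonzero only if
  \<open>|x| \<le> R + |y|\<close>, so part of the decay in \<open>y\<close> can be traded for decay
  in \<open>x\<close>; this yields one dominating Gaussian for all these times.\<close>

lemma V_strongly_continuous_compact_support:
  assumes a: "Re a > 0" and uc: "continuous_on UNIV u"
    and ule: "\<And>x. norm (u x) \<le> K * indicator (cball 0 R) x" and K: "0 \<le> K" and R: "0 \<le> R"
  shows "((\<lambda>t. Lp_norm p \<theta> (\<lambda>x. V a b t u x - u x)) \<longlongrightarrow> 0) (at_right 0)"
    "\<And>t. 0 < t \<Longrightarrow> t \<le> 1 \<Longrightarrow> V a b t u \<in> Lp_space p \<theta>" "u \<in> Lp_space p \<theta>"
proof -
  have um [measurable]: "u \<in> borel_measurable borel" using uc by (rule borel_measurable_continuous_onI)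
  have uK: "norm (u x) \<le> K" for x
  proof -
    have "K * indicator (cball 0 R) x \<le> K * 1" using K by (intro mult_left_mono) (auto simp: indicator_def)
    then show ?thesis using ule[of x] by linarith
  qed
  show u: "u \<in> Lp_space p \<theta>" by (rule bounded_support_in_Lp[OF borel_imp_lebesgue_measurable[OF um] ule])
  \<comment> \<open>One quarter of the decay rate of \<open>gker a 1\<close>. With rate
    \<open>4 q\<close> in \<open>|y|^2\<close> available, \<open>2 q\<close> stays for integrating
    over \<open>y\<close> and the other \<open>2 q\<close> pays for a factor of rate
    \<open>q\<close> in \<open>|x|^2\<close>.\<close>
  define q where "q = Re a / (16 * (cmod a)\<^sup>2)"
  have q: "q > 0" using a by (auto simp: q_def intro!: divide_pos_pos)
  define c where "c = (4 * pi * 1 * cmod a) powr - (real DIM(real ^ 'd) / 2)"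
  have c: "c \<ge> 0" by (simp add: c_def)
  have gk: "norm (gker a 1 (y::real ^ 'd)) = c * exp (- (4 * q * (norm y)\<^sup>2))" for y
    using norm_gker[OF a, of 1 y] by (simp add: c_def q_def)
  have gint: "integrable lborel (\<lambda>y::real ^ 'd. norm (gker a 1 y))"
    using gker_integral[OF a, of 1, where 'a="real ^ 'd"] by (intro integrable_norm) (simp add: has_bochner_integral_iff)
  have eint: "integrable lborel (\<lambda>y::real ^ 'd. exp (- (2 * q * (norm y)\<^sup>2)))"
  proof (rule integrableI_nonneg)
    show "(\<integral>\<^sup>+y. ennreal (exp (- (2 * q * (norm (y::real ^ 'd))\<^sup>2))) \<partial>lborel) < \<infinity>"
      using nn_integral_gauss_moment[of "2 * q" 0, where 'a="real ^ 'd"] q by simp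
  qed auto
  define I where "I = (LINT y|lborel. exp (- (2 * q * (norm (y::real ^ 'd))\<^sup>2)))"
  have I: "I \<ge> 0" unfolding I_def by (intro integral_nonneg_AE) auto
  \<comment> \<open>Collects the bound of \<open>exp (- b t)\<close> for \<open>t \<le> 1\<close>,
    the size of the kernel and of \<open>u\<close>, the loss caused by the radius of the support,
    and the remaining integral over \<open>y\<close>.\<close>
  define B where "B = exp (cmod b) * (c * K * exp (2 * q * R\<^sup>2) * I)"
  have B: "B \<ge> 0" using c K I by (simp add: B_def)
  have fint: "integrable lborel (\<lambda>y. gker a 1 y * u (rot S t x - sqrt t *\<^sub>R y))" for t x
  proof (rule Bochner_Integration.integrable_bound[where f="\<lambda>y. K * norm (gker a 1 y)"])
    show "integrable lborel (\<lambda>y::real ^ 'd. K * norm (gker a 1 y))" using gint by simp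
    have "norm (gker a 1 y * u (rot S t x - sqrt t *\<^sub>R y)) \<le> norm (K * norm (gker a 1 y))" for y
      using mult_left_mono[OF uK[of "rot S t x - sqrt t *\<^sub>R y"], of "norm (gker a 1 y)"] K by (simp add: norm_mult mult.commute)
    then show "AE y in lborel. norm (gker a 1 y * u (rot S t x - sqrt t *\<^sub>R y)) \<le> norm (K * norm (gker a 1 y))" by simp
  qed measurable
  have bound: "norm (V a b t u x) \<le> B * exp (- (q * (norm x)\<^sup>2))" if t: "0 < t" "t \<le> 1" for t x
  proof -
    have p: "norm (gker a 1 y * u (rot S t x - sqrt t *\<^sub>R y))
        \<le> (c * K * exp (2 * q * R\<^sup>2) * exp (- (q * (norm x)\<^sup>2))) * exp (- (2 * q * (norm y)\<^sup>2))" for y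
    proof (cases "rot S t x - sqrt t *\<^sub>R y \<in> cball 0 R")
      case True
      have "norm x = norm (rot S t x)" by (simp add: rot_norm[OF skew])
      also have "\<dots> \<le> norm (rot S t x - sqrt t *\<^sub>R y) + norm (sqrt t *\<^sub>R y)" 
        using norm_triangle_ineq[of "rot S t x - sqrt t *\<^sub>R y" "sqrt t *\<^sub>R y"] by simp
      also have "\<dots> \<le> R + norm y"
        using True t mult_right_mono[of "sqrt t" 1 "norm y"] by (intro add_mono) auto
      finally have "(norm x)\<^sup>2 \<le> (R + norm y)\<^sup>2" by (intro power_mono) auto
      also have "\<dots> \<le> 2 * R\<^sup>2 + 2 * (norm y)\<^sup>2"
        using sum_squares_bound[of R "norm y"] by (simp add: power2_sum)
      finally have "q * (norm x)\<^sup>2 \<le> q * (2 * R\<^sup>2 + 2 * (norm y)\<^sup>2)" using q by (intro mult_left_mono) auto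
      then have "- (4 * q * (norm y)\<^sup>2) \<le> 2 * q * R\<^sup>2 + - (q * (norm x)\<^sup>2) + - (2 * q * (norm y)\<^sup>2)"
        by (simp add: algebra_simps)
      then have "exp (- (4 * q * (norm y)\<^sup>2)) \<le> exp (2 * q * R\<^sup>2) * exp (- (q * (norm x)\<^sup>2)) * exp (- (2 * q * (norm y)\<^sup>2))"
        by (simp only: exp_add[symmetric] exp_le_cancel_iff)
      then have "(c * exp (- (4 * q * (norm y)\<^sup>2))) * K \<le> (c * (exp (2 * q * R\<^sup>2) * exp (- (q * (norm x)\<^sup>2)) * exp (- (2 * q * (norm y)\<^sup>2)))) * K"
        using c K by (intro mult_right_mono mult_left_mono)
      moreover have "norm (gker a 1 y * u (rot S t x - sqrt t *\<^sub>R y)) \<le> (c * exp (- (4 * q * (norm y)\<^sup>2))) * K"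
        unfolding norm_mult gk using c uK by (intro mult_left_mono) auto
      ultimately show ?thesis by (simp only: mult_ac)
    next
      case False
      then have ind: "indicator (cball 0 R) (rot S t x - sqrt t *\<^sub>R y) = (0::real)"
        by (rule indicator_simps(2))
      have "norm (u (rot S t x - sqrt t *\<^sub>R y)) \<le> 0"
        using ule[of "rot S t x - sqrt t *\<^sub>R y"] unfolding ind by (simp only: mult_zero_right)
      then have "u (rot S t x - sqrt t *\<^sub>R y) = 0" by simp
      then show ?thesis using c K by (simp only: mult_zero_right norm_zero) simp
    qed
    have "norm (LINT y|lborel. gker a 1 y * u (rot S t x - sqrt t *\<^sub>R y))
        \<le> (LINT y|lborel. (c * K * exp (2 * q * R\<^sup>2) * exp (- (q * (norm x)\<^sup>2))) * exp (- (2 * q * (norm (y::real ^ 'd))\<^sup>2)))"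
    proof (rule order_trans[OF integral_norm_bound])
      show "(LINT y|lborel. norm (gker a 1 y * u (rot S t x - sqrt t *\<^sub>R y)))
          \<le> (LINT y|lborel. (c * K * exp (2 * q * R\<^sup>2) * exp (- (q * (norm x)\<^sup>2))) * exp (- (2 * q * (norm (y::real ^ 'd))\<^sup>2)))"
        by (intro integral_mono integrable_norm fint integrable_mult_right eint p)
    qed
    also have "\<dots> = (c * K * exp (2 * q * R\<^sup>2) * exp (- (q * (norm x)\<^sup>2))) * I"
      by (simp add: I_def)
    finally have 1: "norm (LINT y|lborel. gker a 1 y * u (rot S t x - sqrt t *\<^sub>R y))
        \<le> (c * K * exp (2 * q * R\<^sup>2) * exp (- (q * (norm x)\<^sup>2))) * I" .
    have "\<bar>Re b * t\<bar> \<le> cmod b * 1" unfolding abs_mult using t abs_Re_le_cmod[of b] by (intro mult_mono) auto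
    then have "norm (exp (- (b * of_real t))) \<le> exp (cmod b)" by (simp add: norm_exp_eq_Re)
    then have "norm (V a b t u x) \<le> exp (cmod b) * ((c * K * exp (2 * q * R\<^sup>2) * exp (- (q * (norm x)\<^sup>2))) * I)"
      unfolding V_rescaled[OF t(1) um] norm_mult using 1 by (intro mult_mono) auto
    then show ?thesis by (simp add: B_def mult_ac)
  qed
  have bL: "(\<lambda>x. B * exp (- (q * (norm x)\<^sup>2))) \<in> Lp_space p \<theta>" by (rule gauss_in_Lp[OF q B])
  have Vm: "V a b t u \<in> borel_measurable lebesgue" for t
    by (intro borel_imp_lebesgue_measurable V_measurable um)
  show VL: "V a b t u \<in> Lp_space p \<theta>" if "0 < t" "t \<le> 1" for t
  proof (rule Lp_bound(1)[OF bL Vm, where c=1])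
    show "AE x in lebesgue. norm (V a b t u x) \<le> 1 * norm (B * exp (- (q * (norm x)\<^sup>2)))"
      using bound[OF that] B by simp
  qed simp
  show "((\<lambda>t. Lp_norm p \<theta> (\<lambda>x. V a b t u x - u x)) \<longlongrightarrow> 0) (at_right 0)"
  proof (rule tendsto_at_right_sequentially[of 0 1])
    fix T :: "nat \<Rightarrow> real" assume T: "\<And>n. 0 < T n" "\<And>n. T n < 1" "decseq T" "T \<longlonglongrightarrow> 0"
    show "(\<lambda>n. Lp_norm p \<theta> (\<lambda>x. V a b (T n) u x - u x)) \<longlonglongrightarrow> 0"
    proof (rule Lp_dominated_convergence(3)[OF Vm borel_imp_lebesgue_measurable[OF um] bL])
      show "AE x in lebesgue. norm (V a b (T n) u x) \<le> B * exp (- (q * (norm x)\<^sup>2))" for n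
        using bound[OF T(1)[of n] less_imp_le[OF T(2)[of n]]] by simp
      have "(\<lambda>n. V a b (T n) u x) \<longlonglongrightarrow> u x" for x
      proof -
        have "(\<lambda>n. LINT y|lborel. gker a 1 y * u (rot S (T n) x - sqrt (T n) *\<^sub>R y)) \<longlonglongrightarrow> (LINT y|lborel. gker a 1 (y::real ^ 'd) * u x)"
        proof (rule integral_dominated_convergence[where w="\<lambda>y. K * norm (gker a 1 y)"])
          show "integrable lborel (\<lambda>y::real ^ 'd. K * norm (gker a 1 y))" using gint by simp
          have "(\<lambda>n. (T n, x)) \<longlonglongrightarrow> (0, x)" by (intro tendsto_Pair T tendsto_const)
          from continuous_on_tendsto_compose[OF rot_continuous[of S] this]
          have "(\<lambda>n. rot S (T n) x) \<longlonglongrightarrow> rot S 0 x" by (simp only: fst_conv snd_conv UNIV_I eventually_True)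
          then have r: "(\<lambda>n. rot S (T n) x) \<longlonglongrightarrow> x" using mat_exp_zero[of S] by simp
          have "(\<lambda>n. gker a 1 y * u (rot S (T n) x - sqrt (T n) *\<^sub>R y)) \<longlonglongrightarrow> gker a 1 y * u x" for y
          proof -
            have "(\<lambda>n. rot S (T n) x - sqrt (T n) *\<^sub>R y) \<longlonglongrightarrow> x - sqrt 0 *\<^sub>R y"
              by (intro tendsto_intros r T)
            then have "(\<lambda>n. u (rot S (T n) x - sqrt (T n) *\<^sub>R y)) \<longlonglongrightarrow> u x"
              using continuous_on_tendsto_compose[OF uc, of "\<lambda>n. rot S (T n) x - sqrt (T n) *\<^sub>R y" x] by simp
            then show ?thesis by (intro tendsto_mult tendsto_const)
          qed
          then show "AE y in lborel. (\<lambda>n. gker a 1 y * u (rot S (T n) x - sqrt (T n) *\<^sub>R y)) \<longlonglongrightarrow> gker a 1 y * u x" by simp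
          show "AE y in lborel. norm (gker a 1 y * u (rot S (T n) x - sqrt (T n) *\<^sub>R y)) \<le> K * norm (gker a 1 y)" for n
            unfolding norm_mult mult.commute[of K] by (intro AE_I2 mult_left_mono uK) simp
        qed measurable
        also have "(LINT y|lborel. gker a 1 (y::real ^ 'd) * u x) = u x"
          using gker_integral[OF a, of 1, where 'a="real ^ 'd"] by (simp add: has_bochner_integral_iff)
        finally have 1: "(\<lambda>n. LINT y|lborel. gker a 1 y * u (rot S (T n) x - sqrt (T n) *\<^sub>R y)) \<longlonglongrightarrow> u x" .
        have "(\<lambda>n. exp (- (b * of_real (T n)))) \<longlonglongrightarrow> exp (- (b * of_real 0))"
          by (intro tendsto_intros T)
        from tendsto_mult[OF this 1] show ?thesis by (simp add: V_rescaled[OF T(1) um])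
      qed
      then show "AE x in lebesgue. (\<lambda>n. V a b (T n) u x) \<longlonglongrightarrow> u x" by simp
    qed
  qed simp
qed

end

section \<open>The resolvent of an exponentially decaying semigroup\<close>

lemma nn_integral_exp_tail:
  fixes a B \<tau> :: real
  assumes a: "a > 0" and B: "B \<ge> 0"
  shows "(\<integral>\<^sup>+t. ennreal (indicator {\<tau><..} t * (B * exp (- a * t))) \<partial>lborel) \<le> ennreal (B * (exp (- a * \<tau>) / a))"
proof -
  have "((\<lambda>t. B * exp (- a * t)) has_integral (B * (exp (- a * \<tau>) / a))) {\<tau>..}"
    using a by (intro has_integral_mult_right has_integral_exp_minus_to_infinity)
  then have "(\<integral>\<^sup>+t. ennreal (indicator {\<tau>..} t * (B * exp (- a * t))) \<partial>lborel) = ennreal (B * (exp (- a * \<tau>) / a))"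
    using B by (intro nn_integral_has_integral_lebesgue) auto
  moreover have "(\<integral>\<^sup>+t. ennreal (indicator {\<tau><..} t * (B * exp (- a * t))) \<partial>lborel)
      \<le> (\<integral>\<^sup>+t. ennreal (indicator {\<tau>..} t * (B * exp (- a * t))) \<partial>lborel)"
    using B by (intro nn_integral_mono ennreal_leI) (auto simp: indicator_def)
  ultimately show ?thesis by simp
qed

section \<open>Minkowski's inequality for integrals over time\<close>

context weighted_Lp
begin

text \<open>The variant of \<open>Lp_integral\<close> for sets of positive times in which
  \<open>C = 0\<close> is allowed, as happens when \<open>g\<close> vanishes almost everywhere. The
  auxiliary bound has a mass at most \<open>e\<close> larger, and \<open>e\<close> tends to
  zero.\<close>

lemma Lp_set_integral:
  fixes w :: "real \<Rightarrow> 'a \<Rightarrow> 'b::euclidean_space"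
  assumes S [measurable]: "S \<in> sets borel" and S0: "S \<subseteq> {0<..}"
    and wm: "(\<lambda>(t, x). indicator S t *\<^sub>R w t x) \<in> borel_measurable (borel \<Otimes>\<^sub>M borel)"
    and cm [measurable]: "c \<in> borel_measurable borel" and c: "\<And>t. 0 \<le> c t"
    and w: "\<And>t. t \<in> S \<Longrightarrow> w t \<in> Lp_space p \<theta>" "\<And>t. t \<in> S \<Longrightarrow> Lp_norm p \<theta> (w t) \<le> c t"
    and C: "(\<integral>\<^sup>+t. ennreal (indicator S t * c t) \<partial>lborel) \<le> ennreal C" "C \<ge> 0"
  shows "AE x in lebesgue. integrable lborel (\<lambda>t. indicator S t *\<^sub>R w t x)"
    "(\<lambda>x. LINT t|lborel. indicator S t *\<^sub>R w t x) \<in> borel_measurable borel"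
    "(\<lambda>x. LINT t|lborel. indicator S t *\<^sub>R w t x) \<in> Lp_space p \<theta>"
    "Lp_norm p \<theta> (\<lambda>x. LINT t|lborel. indicator S t *\<^sub>R w t x) \<le> C"
proof -
  have *: "(AE x in lebesgue. integrable lborel (\<lambda>t. indicator S t *\<^sub>R w t x)) \<and>
    (\<lambda>x. LINT t|lborel. indicator S t *\<^sub>R w t x) \<in> borel_measurable borel \<and>
    (\<lambda>x. LINT t|lborel. indicator S t *\<^sub>R w t x) \<in> Lp_space p \<theta> \<and>
    Lp_norm p \<theta> (\<lambda>x. LINT t|lborel. indicator S t *\<^sub>R w t x) \<le> C + e" if e: "e > 0" for e
  proof -
    \<comment> \<open>\<open>Lp_integral\<close> needs \<open>w t = 0\<close> pointwise, not just almost everywhere, where the norm bound vanishes;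
      the added term makes the bound positive on \<open>S\<close>.\<close>
    define c' where "c' t = indicator S t * c t + indicator S t * (e * exp (- 1 * t))" for t
    have [measurable]: "c' \<in> borel_measurable borel" unfolding c'_def by measurable
    have c'm: "c' \<in> borel_measurable lborel" by simp
    have c'0: "0 \<le> c' t" for t using c[of t] e by (simp add: c'_def)
    have c'z: "indicator S t *\<^sub>R w t x = 0" if "c' t = 0" for t x
    proof (cases "t \<in> S")
      case True
      then have "c' t = c t + e * exp (- 1 * t)" by (simp add: c'_def)
      moreover have "e * exp (- 1 * t) > 0" using e by simp
      ultimately show ?thesis using that c[of t] by linarith
    qed simp
    have wL: "(\<lambda>x. indicator S t *\<^sub>R w t x) \<in> Lp_space p \<theta>" for t
      using w(1)[of t] Lp_zero(1) by (cases "t \<in> S") simp_all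
    have wN: "Lp_norm p \<theta> (\<lambda>x. indicator S t *\<^sub>R w t x) \<le> c' t" for t
    proof (cases "t \<in> S")
      case True
      then show ?thesis using w(2)[OF True] e by (simp add: c'_def add_increasing2)
    next
      case False
      then show ?thesis by (simp add: c'_def Lp_zero(2))
    qed
    have wm': "(\<lambda>(t, x). indicator S t *\<^sub>R w t x) \<in> borel_measurable (lborel \<Otimes>\<^sub>M borel)"
      using wm by (simp cong: measurable_cong_sets)
    have "(\<integral>\<^sup>+t. ennreal (c' t) \<partial>lborel) = (\<integral>\<^sup>+t. ennreal (indicator S t * c t) + ennreal (indicator S t * (e * exp (- 1 * t))) \<partial>lborel)"
      using c e by (intro nn_integral_cong) (simp add: c'_def)
    also have "\<dots> = (\<integral>\<^sup>+t. ennreal (indicator S t * c t) \<partial>lborel) + (\<integral>\<^sup>+t. ennreal (indicator S t * (e * exp (- 1 * t))) \<partial>lborel)"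
      by (rule nn_integral_add) auto
    also have "(\<integral>\<^sup>+t. ennreal (indicator S t * (e * exp (- 1 * t))) \<partial>lborel)
        \<le> (\<integral>\<^sup>+t. ennreal (indicator {0<..} t * (e * exp (- 1 * t))) \<partial>lborel)"
      using S0 e by (intro nn_integral_mono ennreal_leI) (auto simp: indicator_def)
    also have "\<dots> \<le> ennreal e" using nn_integral_exp_tail[of 1 e 0] e by simp
    finally have "(\<integral>\<^sup>+t. ennreal (c' t) \<partial>lborel) \<le> ennreal C + ennreal e"
      using C(1) by (meson add_mono order_trans order_refl)
    then have c'C: "(\<integral>\<^sup>+t. ennreal (c' t) \<partial>lborel) \<le> ennreal (C + e)" using C(2) e by simp
    show ?thesis
      using Lp_integral[OF lborel.sigma_finite_measure_axioms wm' c'm c'0 c'z wL wN c'C] C(2) e by simp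
  qed
  from *[of 1] show "AE x in lebesgue. integrable lborel (\<lambda>t. indicator S t *\<^sub>R w t x)"
    "(\<lambda>x. LINT t|lborel. indicator S t *\<^sub>R w t x) \<in> borel_measurable borel"
    "(\<lambda>x. LINT t|lborel. indicator S t *\<^sub>R w t x) \<in> Lp_space p \<theta>" by auto
  show "Lp_norm p \<theta> (\<lambda>x. LINT t|lborel. indicator S t *\<^sub>R w t x) \<le> C"
    by (rule field_le_epsilon) (use * in blast)
qed

end

section \<open>Laplace transform and resolvent of an abstract decaying semigroup\<close>

text \<open>The algebraic laws are required at every point \<open>x\<close> and only for positive
  times, where a kernel integral satisfies them. \<open>F_integral\<close> plays the role of a
  bounded operator commuting with a vector-valued integral, since the integrals here are taken
  separately at each \<open>x\<close>.\<close>

locale decaying_semigroup = weighted_Lp p \<theta> for p :: real and \<theta> :: "'a::euclidean_space \<Rightarrow> real" +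
  fixes F :: "real \<Rightarrow> ('a \<Rightarrow> 'b::euclidean_space) \<Rightarrow> 'a \<Rightarrow> 'b" and M \<delta> :: real
  assumes M_pos: "M > 0" and \<delta>_pos: "\<delta> > 0"
    and F_Lp: "\<And>t g. t > 0 \<Longrightarrow> g \<in> Lp_space p \<theta> \<Longrightarrow> F t g \<in> Lp_space p \<theta>"
    and F_bound: "\<And>t g. t > 0 \<Longrightarrow> g \<in> Lp_space p \<theta> \<Longrightarrow> Lp_norm p \<theta> (F t g) \<le> M * exp (- \<delta> * t) * Lp_norm p \<theta> g"
    and F_linear: "\<And>t g h c x. t > 0 \<Longrightarrow> g \<in> Lp_space p \<theta> \<Longrightarrow> h \<in> Lp_space p \<theta> \<Longrightarrow>
        F t (\<lambda>x. c *\<^sub>R g x + h x) x = c *\<^sub>R F t g x + F t h x"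
    and F_semigroup: "\<And>t s g x. t > 0 \<Longrightarrow> s > 0 \<Longrightarrow> g \<in> Lp_space p \<theta> \<Longrightarrow> F t (F s g) x = F (t + s) g x"
    and F_continuous: "\<And>g. g \<in> Lp_space p \<theta> \<Longrightarrow> ((\<lambda>t. Lp_norm p \<theta> (\<lambda>x. F t g x - g x)) \<longlongrightarrow> 0) (at_right 0)"
    and F_measurable: "\<And>g. g \<in> Lp_space p \<theta> \<Longrightarrow>
        (\<lambda>z. indicator {0<..} (fst z) *\<^sub>R F (fst z) g (snd z)) \<in> borel_measurable (borel \<Otimes>\<^sub>M borel)"
    and F_integral: "\<And>h g x. h > 0 \<Longrightarrow> g \<in> Lp_space p \<theta> \<Longrightarrow>
        F h (\<lambda>x. LINT t|lborel. indicator {0<..} t *\<^sub>R F t g x) x = (LINT t|lborel. indicator {0<..} t *\<^sub>R F h (F t g) x)"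
begin

definition I :: "real set \<Rightarrow> ('a \<Rightarrow> 'b) \<Rightarrow> 'a \<Rightarrow> 'b" where
  "I S g x = (LINT t|lborel. indicator S t *\<^sub>R F t g x)"

lemma F_measurable_on:
  assumes S [measurable]: "S \<in> sets borel" and S0: "S \<subseteq> {0<..}" and g: "g \<in> Lp_space p \<theta>"
  shows "(\<lambda>z. indicator S (fst z) *\<^sub>R F (fst z) g (snd z)) \<in> borel_measurable (borel \<Otimes>\<^sub>M borel)"
proof -
  note [measurable] = F_measurable[OF g]
  have "(\<lambda>z. indicator S (fst z) *\<^sub>R F (fst z) g (snd z))
      = (\<lambda>z. indicator S (fst z) *\<^sub>R (indicator {0<..} (fst z) *\<^sub>R F (fst z) g (snd z)))"
    using S0 by (auto simp: indicator_def fun_eq_iff)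
  also have "\<dots> \<in> borel_measurable (borel \<Otimes>\<^sub>M borel)" by measurable
  finally show ?thesis .
qed

lemma F_borel:
  assumes t: "t > 0" and g: "g \<in> Lp_space p \<theta>"
  shows "F t g \<in> borel_measurable borel"
proof -
  have "Pair t \<in> borel \<rightarrow>\<^sub>M borel \<Otimes>\<^sub>M (borel :: 'a measure)" by (rule measurable_Pair1') simp
  from measurable_compose[OF this F_measurable[OF g]] t show ?thesis by simp
qed

text \<open>The exponential bound is integrated over times beyond \<open>\<tau>\<close>:
  \<open>\<tau> = 0\<close> gives the resolvent estimate, large \<open>\<tau>\<close> the
  convergence of the improper integral.\<close>

lemma I_facts:
  assumes S: "S \<in> sets borel" "S \<subseteq> {\<tau><..}" and \<tau>: "\<tau> \<ge> 0" and g: "g \<in> Lp_space p \<theta>"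
  shows "AE x in lebesgue. integrable lborel (\<lambda>t. indicator S t *\<^sub>R F t g x)"
    "I S g \<in> borel_measurable borel" "I S g \<in> Lp_space p \<theta>"
    "Lp_norm p \<theta> (I S g) \<le> M * exp (- \<delta> * \<tau>) / \<delta> * Lp_norm p \<theta> g"
proof -
  have S0: "S \<subseteq> {0<..}" using S \<tau> by auto
  have wm: "(\<lambda>(t, x). indicator S t *\<^sub>R F t g x) \<in> borel_measurable (borel \<Otimes>\<^sub>M borel)"
    using F_measurable_on[OF S(1) S0 g] by (simp add: case_prod_beta')
  define c where "c t = M * Lp_norm p \<theta> g * exp (- \<delta> * t)" for t
  have cm: "c \<in> borel_measurable borel" unfolding c_def by measurable
  have c0: "0 \<le> c t" for t using M_pos by (simp add: c_def)
  have C0: "M * exp (- \<delta> * \<tau>) / \<delta> * Lp_norm p \<theta> g \<ge> 0" using M_pos \<delta>_pos by simp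
  have "(\<integral>\<^sup>+t. ennreal (indicator S t * c t) \<partial>lborel)
      \<le> (\<integral>\<^sup>+t. ennreal (indicator {\<tau><..} t * (M * Lp_norm p \<theta> g * exp (- \<delta> * t))) \<partial>lborel)"
    using S(2) M_pos by (intro nn_integral_mono ennreal_leI) (auto simp: indicator_def c_def)
  also have "\<dots> \<le> ennreal (M * Lp_norm p \<theta> g * (exp (- \<delta> * \<tau>) / \<delta>))"
    by (rule nn_integral_exp_tail) (use M_pos \<delta>_pos in auto)
  also have "M * Lp_norm p \<theta> g * (exp (- \<delta> * \<tau>) / \<delta>) = M * exp (- \<delta> * \<tau>) / \<delta> * Lp_norm p \<theta> g" by simp
  finally have C: "(\<integral>\<^sup>+t. ennreal (indicator S t * c t) \<partial>lborel) \<le> ennreal (M * exp (- \<delta> * \<tau>) / \<delta> * Lp_norm p \<theta> g)" .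
  have FL: "F t g \<in> Lp_space p \<theta>" "Lp_norm p \<theta> (F t g) \<le> c t" if "t \<in> S" for t
    using F_Lp[of t g] F_bound[of t g] that S0 g by (auto simp: c_def mult_ac)
  note R = Lp_set_integral[OF S(1) S0 wm cm c0 FL C C0]
  show "AE x in lebesgue. integrable lborel (\<lambda>t. indicator S t *\<^sub>R F t g x)" by (rule R(1))
  have Ieq: "I S g = (\<lambda>x. LINT t|lborel. indicator S t *\<^sub>R F t g x)" by (simp add: I_def fun_eq_iff)
  show "I S g \<in> borel_measurable borel" unfolding Ieq by (rule R(2))
  show "I S g \<in> Lp_space p \<theta>" unfolding Ieq by (rule R(3))
  show "Lp_norm p \<theta> (I S g) \<le> M * exp (- \<delta> * \<tau>) / \<delta> * Lp_norm p \<theta> g" unfolding Ieq by (rule R(4))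
qed

lemma I_initial:
  assumes g: "g \<in> Lp_space p \<theta>"
  shows "AE x in lebesgue. integrable lborel (\<lambda>t. indicator {0<..h} t *\<^sub>R F t g x)" "I {0<..h} g \<in> Lp_space p \<theta>"
proof -
  have "{0<..h} \<subseteq> {0<..}" by auto
  from I_facts(1,3)[OF _ this _ g] show "AE x in lebesgue. integrable lborel (\<lambda>t. indicator {0<..h} t *\<^sub>R F t g x)"
    "I {0<..h} g \<in> Lp_space p \<theta>" by simp_all
qed

abbreviation R :: "('a \<Rightarrow> 'b) \<Rightarrow> 'a \<Rightarrow> 'b" where "R \<equiv> I {0<..}"

lemma R_facts:
  assumes g: "g \<in> Lp_space p \<theta>"
  shows "AE x in lebesgue. integrable lborel (\<lambda>t. indicator {0<..} t *\<^sub>R F t g x)"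
    "R g \<in> borel_measurable borel" "R g \<in> Lp_space p \<theta>"
    "Lp_norm p \<theta> (R g) \<le> M / \<delta> * Lp_norm p \<theta> g"
  using I_facts[of "{0<..}" 0, OF _ _ _ g] by auto

lemma translate_integral:
  "(LINT t|lborel. indicator {0<..} t *\<^sub>R F (h + t) g x) = I {h<..} g x"
proof -
  have "I {h<..} g x = \<bar>1\<bar> *\<^sub>R (LINT t|lborel. indicator {h<..} (h + 1 * t) *\<^sub>R F (h + 1 * t) g x)"
    unfolding I_def by (rule lborel_integral_real_affine) simp
  moreover have "indicator {h<..} (h + t) = (indicator {0<..} t :: real)" for t by (auto simp: indicator_def)
  ultimately show ?thesis by simp
qed

text \<open>Moving \<open>F h\<close> under the integral shifts the time by \<open>h\<close>.
  Together with \<open>R_F\<close> this says that \<open>R\<close> commutes with the semigroup, the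
  common value being the integral over times beyond \<open>h\<close>.\<close>

lemma F_R: "h > 0 \<Longrightarrow> g \<in> Lp_space p \<theta> \<Longrightarrow> F h (R g) x = I {h<..} g x"
proof -
  assume h: "h > 0" and g: "g \<in> Lp_space p \<theta>"
  have "F h (R g) x = (LINT t|lborel. indicator {0<..} t *\<^sub>R F h (F t g) x)"
    using F_integral[OF h g] by (simp add: I_def[abs_def])
  also have "\<dots> = (LINT t|lborel. indicator {0<..} t *\<^sub>R F (h + t) g x)"
    using F_semigroup[OF h _ g] by (intro Bochner_Integration.integral_cong refl) (auto simp: indicator_def)
  finally show ?thesis by (simp add: translate_integral)
qed

lemma R_F: "h > 0 \<Longrightarrow> g \<in> Lp_space p \<theta> \<Longrightarrow> R (F h g) x = I {h<..} g x"
proof -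
  assume h: "h > 0" and g: "g \<in> Lp_space p \<theta>"
  have "R (F h g) x = (LINT t|lborel. indicator {0<..} t *\<^sub>R F (h + t) g x)"
    unfolding I_def using F_semigroup[OF _ h g]
    by (intro Bochner_Integration.integral_cong refl) (auto simp: indicator_def add.commute)
  then show ?thesis by (simp add: translate_integral)
qed

lemma I_split:
  assumes h: "h > 0" and g: "g \<in> Lp_space p \<theta>"
  shows "AE x in lebesgue. R g x = I {0<..h} g x + I {h<..} g x"
proof -
  have 1: "AE x in lebesgue. integrable lborel (\<lambda>t. indicator {0<..h} t *\<^sub>R F t g x)"
    by (rule I_initial(1)[OF g])
  have 2: "AE x in lebesgue. integrable lborel (\<lambda>t. indicator {h<..} t *\<^sub>R F t g x)"
    using I_facts(1)[of "{h<..}" 0, OF _ _ _ g] h by auto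
  from 1 2 show ?thesis
  proof eventually_elim
    case (elim x)
    have "(\<lambda>t. indicator {0<..} t *\<^sub>R F t g x) = (\<lambda>t. indicator {0<..h} t *\<^sub>R F t g x + indicator {h<..} t *\<^sub>R F t g x)"
      using h by (auto simp: indicator_def fun_eq_iff)
    then show ?case using elim by (simp add: I_def)
  qed
qed

lemma F_diff:
  assumes t: "t > 0" and g: "g \<in> Lp_space p \<theta>" and h: "h \<in> Lp_space p \<theta>"
  shows "F t (\<lambda>x. g x - h x) x = F t g x - F t h x"
proof -
  have "(\<lambda>x. g x - h x) = (\<lambda>x. (-1) *\<^sub>R h x + g x)" by auto
  then show ?thesis using F_linear[OF t h g, of "-1" x] by simp
qed

text \<open>The average minus \<open>g\<close> is the average of \<open>F t g - g\<close> over times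
  up to \<open>h\<close>, so Minkowski's inequality reduces the claim to strong continuity at
  0.\<close>

lemma I_average_tendsto:
  assumes g: "g \<in> Lp_space p \<theta>"
  shows "((\<lambda>h. Lp_norm p \<theta> (\<lambda>x. (1 / h) *\<^sub>R I {0<..h} g x - g x)) \<longlongrightarrow> 0) (at_right 0)"
proof -
  obtain g' where g': "g' \<in> borel_measurable borel" "AE x in lebesgue. g x = g' x" "g' \<in> Lp_space p \<theta>"
    using Lp_ex_borel[OF g] by blast
  show ?thesis
  proof (rule tendstoI)
    fix e :: real assume e: "e > 0"
    have "eventually (\<lambda>t. Lp_norm p \<theta> (\<lambda>x. F t g x - g x) < e / 2) (at_right 0)"
      using order_tendstoD(2)[OF F_continuous[OF g], of "e / 2"] e by simp
    then obtain d where d: "d > 0" "\<And>t. 0 < t \<Longrightarrow> t < d \<Longrightarrow> Lp_norm p \<theta> (\<lambda>x. F t g x - g x) < e / 2"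
      by (auto simp: eventually_at_right_field)
    have "Lp_norm p \<theta> (\<lambda>x. (1 / h) *\<^sub>R I {0<..h} g x - g x) < e" if h: "0 < h" "h < d" for h
    proof -
      let ?S = "{0<..h}"
      \<comment> \<open>Subtracting the Borel representative keeps the integrand measurable jointly
        in time and space; the norms are not affected.\<close>
      let ?w = "\<lambda>t x. F t g x - g' x"
      have w: "?w t \<in> Lp_space p \<theta>" "Lp_norm p \<theta> (?w t) \<le> e / 2" if "t \<in> ?S" for t
      proof -
        have 1: "(\<lambda>x. F t g x - g x) \<in> Lp_space p \<theta>" using that by (intro Lp_diff F_Lp g) auto
        have "AE x in lebesgue. ?w t x = F t g x - g x" using g'(2) by eventually_elim simp
        from Lp_cong_AE[OF 1 this] d(2)[of t] that h
        show "?w t \<in> Lp_space p \<theta>" "Lp_norm p \<theta> (?w t) \<le> e / 2" by auto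
      qed
      have wm: "(\<lambda>(t, x). indicator ?S t *\<^sub>R ?w t x) \<in> borel_measurable (borel \<Otimes>\<^sub>M borel)"
      proof -
        note [measurable] = g'(1)
        have "(\<lambda>z. indicator ?S (fst z) *\<^sub>R F (fst z) g (snd z) - indicator ?S (fst z) *\<^sub>R g' (snd z)) \<in> borel_measurable (borel \<Otimes>\<^sub>M borel)"
          by (intro borel_measurable_diff F_measurable_on g) (measurable, auto)
        then show ?thesis by (simp add: case_prod_beta' scaleR_diff_right)
      qed
      have C: "(\<integral>\<^sup>+t. ennreal (indicator ?S t * (e / 2)) \<partial>lborel) \<le> ennreal (e / 2 * h)"
      proof -
        have "(\<integral>\<^sup>+t. ennreal (indicator ?S t * (e / 2)) \<partial>lborel) = (\<integral>\<^sup>+t. ennreal (e / 2) * indicator ?S t \<partial>lborel)"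
          by (intro nn_integral_cong) (simp add: indicator_def)
        also have "\<dots> = ennreal (e / 2) * ennreal h" using h by (simp add: nn_integral_cmult_indicator)
        finally show ?thesis using e h by (simp flip: ennreal_mult')
      qed
      have "Lp_norm p \<theta> (\<lambda>x. LINT t|lborel. indicator ?S t *\<^sub>R ?w t x) \<le> e / 2 * h"
        "(\<lambda>x. LINT t|lborel. indicator ?S t *\<^sub>R ?w t x) \<in> Lp_space p \<theta>"
        by (rule Lp_set_integral[where c="\<lambda>_. e / 2", OF _ _ wm _ _ w C], use e h in auto)+
      note W = this
      have 1: "(\<lambda>x. (1 / h) *\<^sub>R (LINT t|lborel. indicator ?S t *\<^sub>R ?w t x)) \<in> Lp_space p \<theta>"
        by (rule Lp_scaleR(1)[OF W(2)])
      have "Lp_norm p \<theta> (\<lambda>x. (1 / h) *\<^sub>R (LINT t|lborel. indicator ?S t *\<^sub>R ?w t x))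
          \<le> \<bar>1 / h\<bar> * Lp_norm p \<theta> (\<lambda>x. LINT t|lborel. indicator ?S t *\<^sub>R ?w t x)"
        by (rule Lp_scaleR(2)[OF W(2)])
      also have "\<dots> \<le> \<bar>1 / h\<bar> * (e / 2 * h)" by (intro mult_left_mono W) simp
      also have "\<dots> = e / 2" using h by simp
      finally have 2: "Lp_norm p \<theta> (\<lambda>x. (1 / h) *\<^sub>R (LINT t|lborel. indicator ?S t *\<^sub>R ?w t x)) \<le> e / 2" .
      have "AE x in lebesgue. integrable lborel (\<lambda>t. indicator ?S t *\<^sub>R F t g x)"
        by (rule I_initial(1)[OF g])
      then have "AE x in lebesgue. (1 / h) *\<^sub>R I ?S g x - g x = (1 / h) *\<^sub>R (LINT t|lborel. indicator ?S t *\<^sub>R ?w t x)"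
        using g'(2)
      proof eventually_elim
        case (elim x)
        have c: "has_bochner_integral lborel (\<lambda>t. indicator ?S t *\<^sub>R g' x) (measure lborel ?S *\<^sub>R g' x)"
          using has_bochner_integral_scaleR_left[OF has_bochner_integral_real_indicator[of ?S lborel], of "g' x"] h by simp
        have "(LINT t|lborel. indicator ?S t *\<^sub>R ?w t x) = I ?S g x - h *\<^sub>R g' x"
          using elim(1) c h by (simp add: I_def scaleR_diff_right has_bochner_integral_iff)
        then show ?case using elim h by (simp add: scaleR_diff_right)
      qed
      from Lp_cong_AE(2)[OF 1 this] 2 e show ?thesis by linarith
    qed
    then show "eventually (\<lambda>h. dist (Lp_norm p \<theta> (\<lambda>x. (1 / h) *\<^sub>R I {0<..h} g x - g x)) 0 < e) (at_right 0)"
      using d(1) unfolding eventually_at_right_field by (auto simp: dist_real_def)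
  qed
qed

text \<open>By \<open>F_R\<close> and \<open>I_split\<close> the quotient is, almost everywhere,
  minus the average of \<open>F t g\<close> over times up to \<open>h\<close>. The summand
  \<open>g\<close> in place of a difference encodes the limit \<open>- g\<close>.\<close>

lemma resolvent_quotient_tendsto:
  assumes g: "g \<in> Lp_space p \<theta>"
  shows "((\<lambda>h. Lp_norm p \<theta> (\<lambda>x. (1 / h) *\<^sub>R (F h (R g) x - R g x) + g x)) \<longlongrightarrow> 0) (at_right 0)"
proof (rule Lim_transform_eventually[OF I_average_tendsto[OF g]])
  have "Lp_norm p \<theta> (\<lambda>x. (1 / h) *\<^sub>R (F h (R g) x - R g x) + g x)
      = Lp_norm p \<theta> (\<lambda>x. (1 / h) *\<^sub>R I {0<..h} g x - g x)" if h: "h > 0" for h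
  proof -
    have IL: "I {0<..h} g \<in> Lp_space p \<theta>" by (rule I_initial(2)[OF g])
    have L: "(\<lambda>x. g x - (1 / h) *\<^sub>R I {0<..h} g x) \<in> Lp_space p \<theta>" by (intro Lp_diff Lp_scaleR IL g)
    have "AE x in lebesgue. (1 / h) *\<^sub>R (F h (R g) x - R g x) + g x = g x - (1 / h) *\<^sub>R I {0<..h} g x"
      using I_split[OF h g] by eventually_elim (simp add: F_R[OF h g] scaleR_add_right scaleR_diff_right)
    from Lp_cong_AE(2)[OF L this] show ?thesis
      using Lp_diff(3)[OF g Lp_scaleR(1)[OF IL]] by simp
  qed
  then show "eventually (\<lambda>h. Lp_norm p \<theta> (\<lambda>x. (1 / h) *\<^sub>R I {0<..h} g x - g x)
      = Lp_norm p \<theta> (\<lambda>x. (1 / h) *\<^sub>R (F h (R g) x - R g x) + g x)) (at_right 0)"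
    by (simp add: eventually_at_right_less[THEN eventually_mono])
qed

lemma R_linear:
  assumes g: "g \<in> Lp_space p \<theta>" and h: "h \<in> Lp_space p \<theta>"
  shows "AE x in lebesgue. R (\<lambda>x. c *\<^sub>R g x + h x) x = c *\<^sub>R R g x + R h x"
  using R_facts(1)[OF g] R_facts(1)[OF h]
proof eventually_elim
  case (elim x)
  have *: "indicator {0<..} t *\<^sub>R F t (\<lambda>x. c *\<^sub>R g x + h x) x
      = c *\<^sub>R (indicator {0<..} t *\<^sub>R F t g x) + indicator {0<..} t *\<^sub>R F t h x" for t
    using F_linear[OF _ g h, of t c x] by (simp add: indicator_def)
  show ?case
    by (simp only: I_def * Bochner_Integration.integral_add[OF integrable_scaleR_right[OF elim(1)] elim(2)] integral_scaleR_right)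
qed

text \<open>Boundedness of \<open>R\<close> carries the hypothesis over: \<open>R\<close> of the
  quotient of \<open>w\<close> tends to \<open>- R g\<close>. Since \<open>R\<close> commutes with
  \<open>F h\<close>, the same expression is minus an average of \<open>F t w\<close>, which tends
  to \<open>- w\<close>.\<close>

lemma resolvent_unique:
  assumes w: "w \<in> Lp_space p \<theta>" and g: "g \<in> Lp_space p \<theta>"
    and lim: "((\<lambda>h. Lp_norm p \<theta> (\<lambda>x. (1 / h) *\<^sub>R (F h w x - w x) + g x)) \<longlongrightarrow> 0) (at_right 0)"
  shows "AE x in lebesgue. w x = R g x"
proof -
  have le: "Lp_norm p \<theta> (\<lambda>x. R g x - w x) \<le> M / \<delta> * Lp_norm p \<theta> (\<lambda>x. (1 / h) *\<^sub>R (F h w x - w x) + g x)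
      + Lp_norm p \<theta> (\<lambda>x. (1 / h) *\<^sub>R I {0<..h} w x - w x)" if h: "h > 0" for h
  proof -
    define q where "q x = (1 / h) *\<^sub>R (F h w x - w x) + g x" for x
    have Fw: "F h w \<in> Lp_space p \<theta>" by (rule F_Lp[OF h w])
    have d: "(\<lambda>x. F h w x - w x) \<in> Lp_space p \<theta>" by (intro Lp_diff Fw w)
    have q: "q \<in> Lp_space p \<theta>" unfolding q_def by (intro Lp_add Lp_scaleR d g)
    have IL: "I {0<..h} w \<in> Lp_space p \<theta>" by (rule I_initial(2)[OF w])
    have 1: "AE x in lebesgue. R q x = (1 / h) *\<^sub>R R (\<lambda>x. F h w x - w x) x + R g x"
      unfolding q_def by (rule R_linear[OF d g])
    have "AE x in lebesgue. R (\<lambda>x. (-1) *\<^sub>R w x + F h w x) x = (-1) *\<^sub>R R w x + R (F h w) x"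
      by (rule R_linear[OF w Fw])
    moreover have "(\<lambda>x. (-1) *\<^sub>R w x + F h w x) = (\<lambda>x. F h w x - w x)" by auto
    ultimately have 2: "AE x in lebesgue. R (\<lambda>x. F h w x - w x) x = R (F h w) x - R w x" by simp
    \<comment> \<open>Both summands on the right become small: \<open>q\<close> by hypothesis and
      the second one by strong continuity. The left side does not depend on
      \<open>h\<close>.\<close>
    have "AE x in lebesgue. R g x - w x = R q x + ((1 / h) *\<^sub>R I {0<..h} w x - w x)"
      using 1 2 I_split[OF h w]
      by eventually_elim (simp add: R_F[OF h w] scaleR_add_right scaleR_diff_right)
    moreover have L2: "(\<lambda>x. (1 / h) *\<^sub>R I {0<..h} w x - w x) \<in> Lp_space p \<theta>" by (intro Lp_diff Lp_scaleR IL w)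
    ultimately have "Lp_norm p \<theta> (\<lambda>x. R g x - w x) = Lp_norm p \<theta> (\<lambda>x. R q x + ((1 / h) *\<^sub>R I {0<..h} w x - w x))"
      by (intro Lp_cong_AE(2) Lp_add(1) R_facts(3) q)
    also have "\<dots> \<le> Lp_norm p \<theta> (R q) + Lp_norm p \<theta> (\<lambda>x. (1 / h) *\<^sub>R I {0<..h} w x - w x)"
      by (rule Lp_add(2)[OF R_facts(3)[OF q] L2])
    also have "Lp_norm p \<theta> (R q) \<le> M / \<delta> * Lp_norm p \<theta> q" by (rule R_facts(4)[OF q])
    finally show ?thesis by (simp add: q_def[abs_def])
  qed
  have "((\<lambda>h. M / \<delta> * Lp_norm p \<theta> (\<lambda>x. (1 / h) *\<^sub>R (F h w x - w x) + g x)
      + Lp_norm p \<theta> (\<lambda>x. (1 / h) *\<^sub>R I {0<..h} w x - w x)) \<longlongrightarrow> M / \<delta> * 0 + 0) (at_right 0)"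
    by (intro tendsto_intros lim I_average_tendsto w)
  from tendsto_lowerbound[OF this eventually_mono[OF eventually_at_right_less le]]
  have "Lp_norm p \<theta> (\<lambda>x. R g x - w x) \<le> M / \<delta> * 0 + 0" by simp
  then have "Lp_norm p \<theta> (\<lambda>x. R g x - w x) = 0" by (simp add: antisym)
  from Lp_norm_eq_0_imp_AE[OF Lp_diff(1)[OF R_facts(3)[OF g] w] this] show ?thesis
    by eventually_elim simp
qed

text \<open>For \<open>s < t\<close> the difference is \<open>F s\<close> applied to
  \<open>F (t - s) g - g\<close>, so continuity at 0 and the uniform operator bound suffice. The
  value at time 0 is put in by hand, because nothing is assumed about \<open>F 0\<close>.\<close>

lemma F_uniformly_continuous:
  assumes g: "g \<in> Lp_space p \<theta>" and e: "e > 0"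
  defines "f \<equiv> \<lambda>t. if t = 0 then g else F t g"
  obtains r where "r > 0" "\<And>s t. 0 \<le> s \<Longrightarrow> 0 \<le> t \<Longrightarrow> \<bar>s - t\<bar> < r \<Longrightarrow> Lp_norm p \<theta> (\<lambda>x. f s x - f t x) \<le> e"
proof -
  \<comment> \<open>Ensures \<open>M * e' \<le> e\<close> and also \<open>e' \<le> e\<close>, the
    latter for \<open>s = 0\<close>, where no operator stands in front of the difference.\<close>
  define e' where "e' = e / (M + 1)"
  have e': "e' > 0" using e M_pos by (simp add: e'_def)
  have Me: "M * e' \<le> e" "e' \<le> e" using e M_pos by (auto simp: e'_def field_simps)
  have "eventually (\<lambda>t. Lp_norm p \<theta> (\<lambda>x. F t g x - g x) < e') (at_right 0)"
    using order_tendstoD(2)[OF F_continuous[OF g] e'] .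
  then obtain r where r: "r > 0" "\<And>t. 0 < t \<Longrightarrow> t < r \<Longrightarrow> Lp_norm p \<theta> (\<lambda>x. F t g x - g x) < e'"
    by (auto simp: eventually_at_right_field)
  have fL: "f t \<in> Lp_space p \<theta>" if "t \<ge> 0" for t using that g F_Lp[of t g] by (auto simp: f_def)
  have *: "Lp_norm p \<theta> (\<lambda>x. f t x - f s x) \<le> e" if st: "0 \<le> s" "s \<le> t" "t - s < r" for s t
  proof (cases "s = t")
    case True
    then show ?thesis using e by (simp add: Lp_zero(2))
  next
    case False
    then have ts: "t - s > 0" using st by simp
    have N: "Lp_norm p \<theta> (\<lambda>x. F (t - s) g x - g x) < e'" using r(2)[OF ts st(3)] .
    show ?thesis
    proof (cases "s = 0")
      case True
      then show ?thesis using N Me False by (simp add: f_def)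
    next
      case False
      then have s: "s > 0" using st by simp
      have L: "(\<lambda>x. F (t - s) g x - g x) \<in> Lp_space p \<theta>" by (intro Lp_diff F_Lp ts g)
      have "(\<lambda>x. f t x - f s x) = F s (\<lambda>x. F (t - s) g x - g x)"
        using F_diff[OF s F_Lp[OF ts g] g] F_semigroup[OF s ts g] s st by (auto simp: f_def fun_eq_iff)
      then have "Lp_norm p \<theta> (\<lambda>x. f t x - f s x) \<le> M * exp (- \<delta> * s) * Lp_norm p \<theta> (\<lambda>x. F (t - s) g x - g x)"
        using F_bound[OF s L] by simp
      also have "\<dots> \<le> M * 1 * e'"
        using N M_pos \<delta>_pos s by (intro mult_mono) auto
      finally show ?thesis using Me by simp
    qed
  qed
  show ?thesis
  proof (rule that[OF r(1)])
    fix s t :: real assume st: "0 \<le> s" "0 \<le> t" "\<bar>s - t\<bar> < r"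
    show "Lp_norm p \<theta> (\<lambda>x. f s x - f t x) \<le> e"
    proof (cases "t \<le> s")
      case True then show ?thesis using * [of t s] st by simp
    next
      case False then show ?thesis using * [of s t] st Lp_diff(3)[OF fL fL, of s t] by simp
    qed
  qed
qed

text \<open>On a block \<open>K\<close> with tag \<open>t\<close> the error is the integral over
  \<open>K\<close> of the oscillation of \<open>f\<close>. Uniform continuity and Minkowski's
  inequality bound its norm by \<open>e'\<close> times the length of \<open>K\<close>, and the
  lengths add up to \<open>\<tau>\<close>.\<close>

lemma riemann_integral:
  assumes g: "g \<in> Lp_space p \<theta>" and \<tau>: "\<tau> \<ge> 0"
  shows "Lp_has_riemann_integral p \<theta> (\<lambda>t. if t = 0 then g else F t g) (I {0<..\<tau>} g) 0 \<tau>"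
  unfolding Lp_has_riemann_integral_def
proof (intro conjI ballI allI impI)
  let ?f = "\<lambda>t. if t = 0 then g else F t g"
  show IL: "I {0<..\<tau>} g \<in> Lp_space p \<theta>" by (rule I_initial(2)[OF g])
  show fL: "?f t \<in> Lp_space p \<theta>" if "t \<in> {0..\<tau>}" for t using that g F_Lp[of t g] by auto
  obtain g' where g': "g' \<in> borel_measurable borel" "AE x in lebesgue. g x = g' x" "g' \<in> Lp_space p \<theta>"
    using Lp_ex_borel[OF g] by blast
  \<comment> \<open>Changes only the value at time 0, where \<open>g\<close> need not be Borel
    measurable.\<close>
  define f' where "f' t = (if t = 0 then g' else F t g)" for t
  have f'm: "f' t \<in> borel_measurable borel" if "t \<ge> 0" for t
    using that g'(1) F_borel[OF _ g, of t] by (simp add: f'_def)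
  have f'eq: "AE x in lebesgue. ?f t x = f' t x" for t
    using g'(2) by eventually_elim (simp add: f'_def)
  have f'L: "f' t \<in> Lp_space p \<theta>" if "t \<ge> 0" for t using that g'(3) F_Lp[of t g] g by (auto simp: f'_def)
  fix e :: real assume e: "e > 0"
  \<comment> \<open>The added 1 makes the choice valid for \<open>\<tau> = 0\<close> too; in every
    case \<open>e' * \<tau> < e\<close>.\<close>
  define e' where "e' = e / (2 * (\<tau> + 1))"
  have e': "e' > 0" using e \<tau> by (simp add: e'_def)
  obtain r where r: "r > 0" "\<And>s t. 0 \<le> s \<Longrightarrow> 0 \<le> t \<Longrightarrow> \<bar>s - t\<bar> < r \<Longrightarrow> Lp_norm p \<theta> (\<lambda>x. ?f s x - ?f t x) \<le> e'"
    using F_uniformly_continuous[OF g e'] by blast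
  show "\<exists>r>0. \<forall>D. D tagged_division_of {0..\<tau>} \<and> (\<lambda>t. ball t r) fine D \<longrightarrow>
      Lp_norm p \<theta> (\<lambda>x. (\<Sum>(t, K)\<in>D. measure lborel K *\<^sub>R ?f t x) - I {0<..\<tau>} g x) < e"
  proof (intro exI[of _ r] conjI allI impI r(1))
    fix D assume D: "D tagged_division_of {0..\<tau>} \<and> (\<lambda>t. ball t r) fine D"
    then have D1: "D tagged_division_of cbox 0 \<tau>" and D2: "(\<lambda>t. ball t r) fine D" by (auto simp: cbox_interval)
    have fin: "finite D" using D1 by (rule tagged_division_of_finite)
    have tK: "t \<in> K" "K \<subseteq> {0..\<tau>}" "\<exists>a b. K = cbox a b" "K \<subseteq> ball t r" if "(t, K) \<in> D" for t K
      using tagged_division_ofD(2,3,4)[OF D1 that] D2 that by (auto simp: fine_def cbox_interval)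
    \<comment> \<open>The error of one block, up to a null set of points. Intersecting with the
      positive times discards the single time 0, about which \<open>F\<close> has no
      assumptions.\<close>
    define h where "h t K x = (LINT s|lborel. indicator (K \<inter> {0<..}) s *\<^sub>R (f' t x - F s g x))" for t K x
    have Kb: "K \<in> sets borel" "emeasure lborel K < \<infinity>" if tKD: "(t, K) \<in> D" for t K
    proof -
      obtain a b where "K = cbox a b" using tK(3)[OF tKD] by blast
      then show "K \<in> sets borel" "emeasure lborel K < \<infinity>"
        using emeasure_lborel_cbox_finite[of a b] by (simp_all only: borel_closed closed_cbox)
    qed
    have hL: "h t K \<in> Lp_space p \<theta>" "Lp_norm p \<theta> (h t K) \<le> e' * measure lborel K" if tKD: "(t, K) \<in> D" for t K
    proof -
      let ?S = "K \<inter> {0<..}"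
      have t0: "t \<ge> 0" using tK(1,2)[OF tKD] by auto
      have S: "?S \<in> sets borel" "?S \<subseteq> {0<..}" using Kb(1)[OF tKD] by auto
      have w: "(\<lambda>x. f' t x - F s g x) \<in> Lp_space p \<theta>" "Lp_norm p \<theta> (\<lambda>x. f' t x - F s g x) \<le> e'" if s: "s \<in> ?S" for s
      proof -
        have s0: "s > 0" using s by simp
        have "\<bar>t - s\<bar> < r" using s tK(4)[OF tKD] by (auto simp: dist_real_def)
        then have N: "Lp_norm p \<theta> (\<lambda>x. ?f t x - ?f s x) \<le> e'" using r(2)[of t s] t0 s0 by simp
        have L: "(\<lambda>x. ?f t x - ?f s x) \<in> Lp_space p \<theta>"
          using tK(1,2)[OF tKD] s by (intro Lp_diff fL) auto
        have "AE x in lebesgue. f' t x - F s g x = ?f t x - ?f s x"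
          using f'eq[of t] by eventually_elim (use s0 in simp)
        from Lp_cong_AE[OF L this] N
        show "(\<lambda>x. f' t x - F s g x) \<in> Lp_space p \<theta>" "Lp_norm p \<theta> (\<lambda>x. f' t x - F s g x) \<le> e'" by auto
      qed
      have wm: "(\<lambda>(s, x). indicator ?S s *\<^sub>R (f' t x - F s g x)) \<in> borel_measurable (borel \<Otimes>\<^sub>M borel)"
      proof -
        note [measurable] = S(1) f'm[OF t0]
        have "(\<lambda>z. indicator ?S (fst z) *\<^sub>R f' t (snd z)) \<in> borel_measurable (borel \<Otimes>\<^sub>M borel)" by measurable
        then have "(\<lambda>z. indicator ?S (fst z) *\<^sub>R f' t (snd z) - indicator ?S (fst z) *\<^sub>R F (fst z) g (snd z)) \<in> borel_measurable (borel \<Otimes>\<^sub>M borel)"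
          by (intro borel_measurable_diff F_measurable_on[OF S g])
        then show ?thesis by (simp add: case_prod_beta' scaleR_diff_right)
      qed
      have C: "(\<integral>\<^sup>+s. ennreal (indicator ?S s * e') \<partial>lborel) \<le> ennreal (e' * measure lborel K)"
      proof -
        have "(\<integral>\<^sup>+s. ennreal (indicator ?S s * e') \<partial>lborel) \<le> (\<integral>\<^sup>+s. ennreal e' * indicator K s \<partial>lborel)"
          using e' by (intro nn_integral_mono) (simp add: indicator_def)
        also have "\<dots> = ennreal e' * ennreal (measure lborel K)"
          using Kb[OF tKD] by (simp add: nn_integral_cmult_indicator emeasure_eq_ennreal_measure)
        finally show ?thesis using e' by (simp flip: ennreal_mult')
      qed
      show "h t K \<in> Lp_space p \<theta>" "Lp_norm p \<theta> (h t K) \<le> e' * measure lborel K"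
        unfolding h_def[abs_def]
        by (rule Lp_set_integral(3,4)[where c="\<lambda>_. e'", OF S wm _ _ w C], use e' in auto)+
    qed
    have sum: "(\<Sum>(t, K)\<in>D. measure lborel K) = \<tau>"
      using additive_content_tagged_division[OF D1] \<tau> by simp
    have hsum: "(\<lambda>x. \<Sum>z\<in>D. h (fst z) (snd z) x) \<in> Lp_space p \<theta>"
      "Lp_norm p \<theta> (\<lambda>x. \<Sum>z\<in>D. h (fst z) (snd z) x) \<le> (\<Sum>z\<in>D. Lp_norm p \<theta> (h (fst z) (snd z)))"
      using hL(1) by (intro Lp_sum fin; force)+
    have "AE x in lebesgue. integrable lborel (\<lambda>t. indicator {0<..} t *\<^sub>R F t g x)" by (rule R_facts(1)[OF g])
    moreover have "AE x in lebesgue. g x = g' x" by (rule g'(2))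
    ultimately have "AE x in lebesgue. (\<Sum>(t, K)\<in>D. measure lborel K *\<^sub>R ?f t x) - I {0<..\<tau>} g x = (\<Sum>z\<in>D. h (fst z) (snd z) x)"
    proof eventually_elim
      case (elim x)
      let ?\<phi> = "\<lambda>s. indicator {0<..} s *\<^sub>R F s g x"
      have int: "set_integrable lborel K ?\<phi>" if "K \<in> sets borel" for K
        using integrable_mult_indicator[of K lborel ?\<phi>] elim that by (simp add: set_integrable_def)
      have all: "?\<phi> integrable_on cbox 0 \<tau>"
        using set_borel_integral_eq_integral(1)[OF int[of "cbox 0 \<tau>"]] by simp
      have "I {0<..\<tau>} g x = (LINT s:cbox 0 \<tau>|lborel. ?\<phi> s)"
        unfolding I_def set_lebesgue_integral_def
        by (intro Bochner_Integration.integral_cong refl) (auto simp: indicator_def)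
      \<comment> \<open>Passing to the gauge integral makes additivity over tagged divisions
        available.\<close>
      also have "\<dots> = integral (cbox 0 \<tau>) ?\<phi>"
        by (rule set_borel_integral_eq_integral(2)[OF int]) simp
      also have "\<dots> = (\<Sum>(t, K)\<in>D. integral K ?\<phi>)"
        by (rule integral_combine_tagged_division_topdown[OF all D1])
      finally have I: "I {0<..\<tau>} g x = (\<Sum>(t, K)\<in>D. integral K ?\<phi>)" .
      have hx: "h t K x = measure lborel K *\<^sub>R ?f t x - integral K ?\<phi>" if tKD: "(t, K) \<in> D" for t K
      proof -
        have c: "has_bochner_integral lborel (\<lambda>s. indicator K s *\<^sub>R f' t x) (measure lborel K *\<^sub>R f' t x)"
          using Kb[OF tKD] by (intro has_bochner_integral_scaleR_left has_bochner_integral_real_indicator) auto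
        have ae: "AE s in lborel. s \<noteq> (0::real)" by (rule AE_lborel_singleton)
        have K0: "K \<subseteq> {0..}" using tK(2)[OF tKD] by auto
        have [measurable]: "K \<in> sets borel" using Kb[OF tKD] by simp
        have [measurable]: "?\<phi> \<in> borel_measurable borel"
          using borel_measurable_integrable[OF elim(1)] by simp
        have "h t K x = (LINT s|lborel. indicator K s *\<^sub>R f' t x - indicator K s *\<^sub>R ?\<phi> s)"
          unfolding h_def
        proof (rule integral_cong_AE)
          have "(\<lambda>s. indicator (K \<inter> {0<..}) s *\<^sub>R (f' t x - F s g x))
              = (\<lambda>s. indicator (K \<inter> {0<..}) s *\<^sub>R f' t x - indicator K s *\<^sub>R ?\<phi> s)"
            by (auto simp: indicator_def fun_eq_iff)
          also have "\<dots> \<in> borel_measurable lborel" by measurable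
          finally show "(\<lambda>s. indicator (K \<inter> {0<..}) s *\<^sub>R (f' t x - F s g x)) \<in> borel_measurable lborel" .
          show "(\<lambda>s. indicator K s *\<^sub>R f' t x - indicator K s *\<^sub>R ?\<phi> s) \<in> borel_measurable lborel" by measurable
          show "AE s in lborel. indicator (K \<inter> {0<..}) s *\<^sub>R (f' t x - F s g x) = indicator K s *\<^sub>R f' t x - indicator K s *\<^sub>R ?\<phi> s"
            using ae by eventually_elim (use K0 in \<open>auto simp: indicator_def\<close>)
        qed
        also have "\<dots> = measure lborel K *\<^sub>R f' t x - (LINT s:K|lborel. ?\<phi> s)"
          using c int[OF Kb(1)[OF tKD]] by (simp add: has_bochner_integral_iff set_integrable_def set_lebesgue_integral_def)
        also have "(LINT s:K|lborel. ?\<phi> s) = integral K ?\<phi>"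
          by (rule set_borel_integral_eq_integral(2)[OF int[OF Kb(1)[OF tKD]]])
        also have "f' t x = ?f t x" using elim(2) by (simp add: f'_def)
        finally show ?thesis .
      qed
      have "(\<Sum>z\<in>D. h (fst z) (snd z) x) = (\<Sum>(t, K)\<in>D. measure lborel K *\<^sub>R ?f t x - integral K ?\<phi>)"
        using hx by (intro sum.cong refl) auto
      also have "\<dots> = (\<Sum>(t, K)\<in>D. measure lborel K *\<^sub>R ?f t x) - I {0<..\<tau>} g x"
        unfolding I by (simp add: case_prod_beta' sum_subtractf)
      finally show ?case by simp
    qed
    from Lp_cong_AE(2)[OF hsum(1) this] hsum(2)
    have "Lp_norm p \<theta> (\<lambda>x. (\<Sum>(t, K)\<in>D. measure lborel K *\<^sub>R ?f t x) - I {0<..\<tau>} g x) \<le> (\<Sum>z\<in>D. Lp_norm p \<theta> (h (fst z) (snd z)))"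
      by simp
    also have "\<dots> \<le> (\<Sum>z\<in>D. e' * measure lborel (snd z))"
      using hL(2) by (intro sum_mono) auto
    also have "\<dots> = e' * \<tau>" using sum by (simp add: case_prod_beta' sum_distrib_left[symmetric])
    also have "\<dots> < e" using e \<tau> by (simp add: e'_def field_simps add_nonneg_pos)
    finally show "Lp_norm p \<theta> (\<lambda>x. (\<Sum>(t, K)\<in>D. measure lborel K *\<^sub>R ?f t x) - I {0<..\<tau>} g x) < e" .
  qed
qed

text \<open>The remainder is the integral over times beyond \<open>\<tau>\<close>, whose norm decays
  exponentially by \<open>I_facts\<close>.\<close>

lemma improper_integral:
  assumes g: "g \<in> Lp_space p \<theta>"
  shows "Lp_has_improper_integral p \<theta> (\<lambda>t. if t = 0 then g else F t g) (R g)"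
  unfolding Lp_has_improper_integral_def Lp_tendsto_def
proof (intro exI[of _ "\<lambda>\<tau>. I {0<..\<tau>} g"] conjI allI impI)
  show "Lp_has_riemann_integral p \<theta> (\<lambda>t. if t = 0 then g else F t g) (I {0<..\<tau>} g) 0 \<tau>" if "0 \<le> \<tau>" for \<tau>
    by (rule riemann_integral[OF g that])
  show "R g \<in> Lp_space p \<theta>" by (rule R_facts(3)[OF g])
  have IL: "I {0<..\<tau>} g \<in> Lp_space p \<theta>" for \<tau> by (rule I_initial(2)[OF g])
  then show "\<forall>\<^sub>F \<tau> in at_top. I {0<..\<tau>} g \<in> Lp_space p \<theta>" by simp
  have le: "Lp_norm p \<theta> (\<lambda>x. I {0<..\<tau>} g x - R g x) \<le> M * exp (- \<delta> * \<tau>) / \<delta> * Lp_norm p \<theta> g" if \<tau>: "\<tau> > 0" for \<tau>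
  proof -
    have tail: "I {\<tau><..} g \<in> Lp_space p \<theta>" "Lp_norm p \<theta> (I {\<tau><..} g) \<le> M * exp (- \<delta> * \<tau>) / \<delta> * Lp_norm p \<theta> g"
      using I_facts(3,4)[of "{\<tau><..}" \<tau>, OF _ _ _ g] \<tau> by auto
    have "AE x in lebesgue. R g x - I {0<..\<tau>} g x = I {\<tau><..} g x"
      using I_split[OF \<tau> g] by eventually_elim simp
    from Lp_cong_AE(2)[OF tail(1) this] tail(2) show ?thesis
      using Lp_diff(3)[OF R_facts(3)[OF g] IL] by simp
  qed
  have "((\<lambda>\<tau>. exp (- \<delta> * \<tau>)) \<longlongrightarrow> 0) at_top"
    using \<delta>_pos by (intro filterlim_compose[OF exp_at_bot] filterlim_tendsto_neg_mult_at_bot[OF tendsto_const] filterlim_ident) auto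
  then have "((\<lambda>\<tau>. M * exp (- \<delta> * \<tau>) / \<delta> * Lp_norm p \<theta> g) \<longlongrightarrow> M * 0 / \<delta> * Lp_norm p \<theta> g) at_top"
    using \<delta>_pos by (intro tendsto_intros) auto
  then have lim: "((\<lambda>\<tau>. M * exp (- \<delta> * \<tau>) / \<delta> * Lp_norm p \<theta> g) \<longlongrightarrow> 0) at_top" by simp
  show "((\<lambda>\<tau>. Lp_norm p \<theta> (\<lambda>x. I {0<..\<tau>} g x - R g x)) \<longlongrightarrow> 0) at_top"
  proof (rule tendsto_sandwich[OF _ _ tendsto_const lim])
    show "\<forall>\<^sub>F \<tau> in at_top. 0 \<le> Lp_norm p \<theta> (\<lambda>x. I {0<..\<tau>} g x - R g x)" by simp
    show "\<forall>\<^sub>F \<tau> in at_top. Lp_norm p \<theta> (\<lambda>x. I {0<..\<tau>} g x - R g x) \<le> M * exp (- \<delta> * \<tau>) / \<delta> * Lp_norm p \<theta> g"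
      by (rule eventually_mono[OF eventually_gt_at_top[of 0] le])
  qed
qed

end

section \<open>Simultaneously diagonalizable matrices\<close>

text \<open>For invertible \<open>Y\<close> an algebra homomorphism from functions of the index with
  pointwise operations. Powers, exponentials and inverses in the heat kernel stay in its image, so
  matrix identities become identities of eigenvalues.\<close>

definition conj_diag :: "complex ^ 'n ^ 'n \<Rightarrow> ('n \<Rightarrow> complex) \<Rightarrow> complex ^ 'n ^ 'n" where
  "conj_diag Y l = Y ** diag_mat l ** matrix_inv Y"

lemma conj_diag_entry: "conj_diag Y l $ i $ j = (\<Sum>k\<in>UNIV. Y $ i $ k * l k * matrix_inv Y $ k $ j)"
  unfolding conj_diag_def by (subst matrix_matrix_mult_def) (simp add: diag_mat_mult_right)

lemma conj_diag_vector: "conj_diag Y l *v x = Y *v (\<chi> k. l k * (matrix_inv Y *v x) $ k)"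
proof -
  have "diag_mat l *v u = (\<chi> k. l k * u $ k)" for u
    by (simp add: vec_eq_iff matrix_vector_mult_def diag_mat_def if_distrib[of "\<lambda>c. c * _"] cong: if_cong)
  then show ?thesis by (simp add: conj_diag_def flip: matrix_vector_mul_assoc)
qed

lemma conj_diag_algebra:
  "conj_diag Y l - conj_diag Y m = conj_diag Y (\<lambda>k. l k - m k)"
  "- conj_diag Y l = conj_diag Y (\<lambda>k. - l k)"
  "c *\<^sub>R conj_diag Y l = conj_diag Y (\<lambda>k. of_real c * l k)"
  by (auto simp: vec_eq_iff conj_diag_entry sum_subtractf[symmetric] sum_negf[symmetric] scaleR_conv_of_real[where 'a=complex]
      sum_distrib_left algebra_simps intro!: sum.cong)

lemma vector_mult_linear: "linear (\<lambda>x. (M :: complex ^ 'n ^ 'm) *v x)"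
  by (intro linearI) (simp_all add: vec_eq_iff matrix_vector_mult_def distrib_left sum.distrib scaleR_sum_right)

lemma vector_mult_bounded_linear: "bounded_linear (\<lambda>x. (M :: complex ^ 'n ^ 'm) *v x)"
  using vector_mult_linear by (simp add: linear_conv_bounded_linear)

lemma vector_mult_measurable [measurable]:
  "(\<lambda>x. (M :: complex ^ 'n ^ 'm) *v x) \<in> borel_measurable borel"
  by (intro borel_measurable_continuous_onI linear_continuous_on vector_mult_bounded_linear)

lemma norm_vector_mult_le: "norm (M *v x) \<le> spectral_norm M * norm x"
  unfolding spectral_norm_def by (rule onorm[OF vector_mult_bounded_linear])

lemma spectral_norm_nonneg: "0 \<le> spectral_norm M"
  unfolding spectral_norm_def by (rule onorm_pos_le[OF vector_mult_bounded_linear])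

lemma norm_diag_le:
  fixes w :: "complex ^ 'n"
  assumes "\<And>k. cmod (h k) \<le> C"
  shows "norm (\<chi> k. h k * w $ k) \<le> C * norm w"
proof -
  have C: "0 \<le> C" using assms[of undefined] norm_ge_zero order_trans by blast
  have "L2_set (\<lambda>k. cmod (h k * w $ k)) UNIV \<le> L2_set (\<lambda>k. C * cmod (w $ k)) UNIV"
    using assms by (intro L2_set_mono) (auto simp: norm_mult intro!: mult_right_mono)
  then show ?thesis using C by (simp add: norm_vec_def L2_set_right_distrib)
qed

text \<open>The place where \<open>kappa Y\<close> arises: a diagonal matrix has the maximum modulus
  of its entries as norm bound, and the two changes of basis contribute the remaining
  factors.\<close>

lemma norm_conj_diag_le:
  assumes "\<And>k. cmod (h k) \<le> C"
  shows "norm (conj_diag Y h *v x) \<le> kappa Y * C * norm x"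
proof -
  have C: "0 \<le> C" using assms[of undefined] norm_ge_zero order_trans by blast
  have "norm (conj_diag Y h *v x) \<le> spectral_norm Y * norm (\<chi> k. h k * (matrix_inv Y *v x) $ k)"
    unfolding conj_diag_vector by (rule norm_vector_mult_le)
  also have "\<dots> \<le> spectral_norm Y * (C * (spectral_norm (matrix_inv Y) * norm x))"
    using norm_diag_le[of h C "matrix_inv Y *v x", OF assms] norm_vector_mult_le[of "matrix_inv Y" x] C
    by (intro mult_left_mono spectral_norm_nonneg) (meson mult_left_mono order_trans)
  finally show ?thesis by (simp add: kappa_def mult_ac)
qed

lemma sum_axis: "(\<chi> k. f k) = (\<Sum>k\<in>UNIV. axis k (f k))"
  by (simp add: vec_eq_iff axis_def if_distrib cong: if_cong)

lemma axis_bounded_linear: "bounded_linear (axis k :: complex \<Rightarrow> complex ^ 'n)"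
  unfolding linear_conv_bounded_linear[symmetric]
  by (intro linearI) (auto simp: vec_eq_iff axis_def)

lemma vec_lambda_measurable:
  fixes f :: "'a \<Rightarrow> 'n::finite \<Rightarrow> complex"
  assumes "\<And>k. (\<lambda>x. f x k) \<in> borel_measurable M"
  shows "(\<lambda>x. \<chi> k. f x k) \<in> borel_measurable M"
proof -
  have m: "(axis k :: complex \<Rightarrow> complex ^ 'n) \<in> borel_measurable borel" for k :: 'n
    by (intro borel_measurable_continuous_onI linear_continuous_on axis_bounded_linear)
  show ?thesis
    unfolding sum_axis by (intro borel_measurable_sum measurable_compose[OF assms m])
qed

lemma vec_nth_measurable [measurable]: "(\<lambda>x :: complex ^ 'n. x $ k) \<in> borel_measurable borel"
  by (intro borel_measurable_continuous_onI linear_continuous_on bounded_linear_vec_nth)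

lemma has_bochner_integral_vec:
  fixes f :: "'a \<Rightarrow> 'n::finite \<Rightarrow> complex"
  assumes "\<And>k. has_bochner_integral M (\<lambda>x. f x k) (I k)"
  shows "has_bochner_integral M (\<lambda>x. \<chi> k. f x k) (\<chi> k. I k)"
  unfolding sum_axis
  by (intro has_bochner_integral_sum has_bochner_integral_bounded_linear[OF axis_bounded_linear] assms)

context
  fixes Y :: "complex ^ 'n ^ 'n"
  assumes Y: "invertible Y"
begin

lemma kappa_pos: "kappa Y > 0"
proof -
  let ?x = "\<chi> k. 1 :: complex ^ 'n"
  have x: "norm ?x > 0" by (simp add: vec_eq_iff)
  have "norm (Y *v (matrix_inv Y *v ?x)) \<le> spectral_norm Y * (spectral_norm (matrix_inv Y) * norm ?x)"
    using norm_vector_mult_le[of Y "matrix_inv Y *v ?x"] norm_vector_mult_le[of "matrix_inv Y" ?x]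
      mult_left_mono[OF _ spectral_norm_nonneg[of Y]] by (meson order_trans)
  then have "norm ?x \<le> kappa Y * norm ?x"
    by (simp add: kappa_def mult.assoc matrix_vector_mul_assoc matrix_inv_cancel[OF Y])
  then show ?thesis using x by (simp add: pos_le_divide_eq[symmetric])
qed

lemma diagonalizesE:
  assumes "diagonalizes Y M"
  obtains l where "M = conj_diag Y l"
proof -
  obtain l where l: "matrix_inv Y ** M ** Y = diag_mat l" using assms by (auto simp: diagonalizes_def)
  have "conj_diag Y l = (Y ** matrix_inv Y) ** M ** (Y ** matrix_inv Y)"
    unfolding conj_diag_def l[symmetric] by (simp only: matrix_mul_assoc)
  then show ?thesis using that[of l] by (simp add: matrix_inv_cancel[OF Y])
qed

lemma conj_diag_const: "conj_diag Y (\<lambda>_. c) = mat c"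
proof -
  have "diag_mat (\<lambda>_. c) = (mat c :: complex ^ 'n ^ 'n)" by (simp add: diag_mat_def mat_def)
  moreover have "Y ** mat c = mat c ** Y"
    by (simp add: vec_eq_iff matrix_matrix_mult_def mat_def if_distrib[of "\<lambda>u. u * _"] if_distrib[of "\<lambda>u. _ * u"] mult.commute cong: if_cong)
  ultimately show ?thesis
    unfolding conj_diag_def by (simp add: matrix_inv_cancel[OF Y] flip: matrix_mul_assoc)
qed

lemma conj_diag_mult: "conj_diag Y l ** conj_diag Y m = conj_diag Y (\<lambda>k. l k * m k)"
proof -
  have "diag_mat l ** diag_mat m = diag_mat (\<lambda>k. l k * m k)"
    by (simp add: vec_eq_iff diag_mat_mult_left) (simp add: diag_mat_def)
  moreover have "conj_diag Y l ** conj_diag Y m = Y ** diag_mat l ** (matrix_inv Y ** Y) ** diag_mat m ** matrix_inv Y"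
    unfolding conj_diag_def by (simp only: matrix_mul_assoc)
  ultimately show ?thesis
    by (simp add: conj_diag_def matrix_inv_cancel[OF Y] flip: matrix_mul_assoc)
qed

lemma conj_diag_invertible_iff: "invertible (conj_diag Y l) \<longleftrightarrow> (\<forall>k. l k \<noteq> 0)"
proof -
  have "det (diag_mat l) = (\<Prod>k\<in>UNIV. l k)"
    by (subst det_diagonal) (auto simp: diag_mat_def)
  moreover have "det Y * det (matrix_inv Y) = 1"
    using det_mul[of Y "matrix_inv Y"] by (simp add: matrix_inv_cancel[OF Y])
  ultimately have "det (conj_diag Y l) = (\<Prod>k\<in>UNIV. l k)"
    by (simp add: conj_diag_def det_mul mult.left_commute mult.assoc)
  then show ?thesis by (simp add: invertible_det_nz)
qed

text \<open>Invertibility is read off from the determinant, which is the product of the diagonal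
  entries. This turns the spectral constants into minima and maxima over a finite index set.\<close>

lemma mat_spectrum_conj_diag: "mat_spectrum (conj_diag Y l) = range l"
proof -
  have "mat z - conj_diag Y l = conj_diag Y (\<lambda>k. z - l k)" for z
    by (simp add: conj_diag_const[symmetric] conj_diag_algebra)
  then show ?thesis
    by (auto simp: mat_spectrum_def conj_diag_invertible_iff)
qed

lemma matrix_inv_conj_diag:
  assumes "\<And>k. l k \<noteq> 0"
  shows "matrix_inv (conj_diag Y l) = conj_diag Y (\<lambda>k. 1 / l k)"
proof -
  have inv: "invertible (conj_diag Y l)" using assms by (simp add: conj_diag_invertible_iff)
  have 1: "conj_diag Y l ** conj_diag Y (\<lambda>k. 1 / l k) = mat 1"
    using assms by (simp add: conj_diag_mult conj_diag_const)
  have "matrix_inv (conj_diag Y l) = matrix_inv (conj_diag Y l) ** (conj_diag Y l ** conj_diag Y (\<lambda>k. 1 / l k))"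
    by (simp add: 1)
  also have "\<dots> = conj_diag Y (\<lambda>k. 1 / l k)"
    by (simp add: matrix_mul_assoc matrix_inv_cancel[OF inv])
  finally show ?thesis .
qed

lemma mat_exp_conj_diag: "mat_exp (conj_diag Y l) = conj_diag Y (\<lambda>k. exp (l k))"
proof -
  have pow: "((\<lambda>X. conj_diag Y l ** X) ^^ k) (mat 1) = conj_diag Y (\<lambda>i. l i ^ k)" for k
    by (induction k) (simp_all add: conj_diag_const conj_diag_mult)
  have "(\<lambda>k. (1 / fact k) *\<^sub>R (((\<lambda>X. conj_diag Y l ** X) ^^ k) (mat 1))) sums conj_diag Y (\<lambda>k. exp (l k))"
  proof (intro sums_vecI)
    fix i j
    have "(\<lambda>k. \<Sum>m\<in>UNIV. Y $ i $ m * (l m ^ k /\<^sub>R fact k) * matrix_inv Y $ m $ j) sums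
        (\<Sum>m\<in>UNIV. Y $ i $ m * exp (l m) * matrix_inv Y $ m $ j)"
      by (intro sums_sum sums_mult2 sums_mult exp_converges)
    then show "(\<lambda>k. ((1 / fact k) *\<^sub>R (((\<lambda>X. conj_diag Y l ** X) ^^ k) (mat 1))) $ i $ j) sums conj_diag Y (\<lambda>k. exp (l k)) $ i $ j"
      unfolding pow by (simp add: conj_diag_entry scaleR_conv_of_real[where 'a=complex] sum_distrib_left divide_inverse mult_ac)
  qed
  then show ?thesis unfolding mat_exp_def by (rule sums_unique[symmetric])
qed

text \<open>Each factor of the matrix kernel is a function of the eigenvalues, so the kernel splits
  into scalar kernels. The value of \<open>mat_powr\<close> is the one of this particular
  diagonalization by \<open>mat_powr_diag\<close>.\<close>

lemma heat_kernel_conj_diag: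
  fixes S :: "real ^ 'd ^ 'd"
  assumes t: "t > 0" and a: "\<And>k. Re (a k) > 0"
  shows "heat_kernel (conj_diag Y a) (conj_diag Y b) S x \<xi> t
    = conj_diag Y (\<lambda>k. exp (- (b k * of_real t)) * gker (a k) t (rot S t x - \<xi>))"
proof -
  have a0: "a k \<noteq> 0" for k using a[of k] by auto
  let ?d = "real CARD('d) / 2" and ?r = "(norm (rot S t x - \<xi>))\<^sup>2"
  have 1: "mat_powr ((4 * pi * t) *\<^sub>R conj_diag Y a) (- ?d) = conj_diag Y (\<lambda>k. (of_real (4 * pi * t) * a k) powr of_real (- ?d))"
    unfolding conj_diag_algebra unfolding conj_diag_def by (rule mat_powr_diag[OF Y])
  have "matrix_inv ((4 * t) *\<^sub>R conj_diag Y a) = conj_diag Y (\<lambda>k. 1 / (of_real (4 * t) * a k))"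
    unfolding conj_diag_algebra by (rule matrix_inv_conj_diag) (use t a0 in simp)
  then have "- (t *\<^sub>R conj_diag Y b) - ?r *\<^sub>R matrix_inv ((4 * t) *\<^sub>R conj_diag Y a)
      = conj_diag Y (\<lambda>k. - (of_real t * b k) - of_real ?r * (1 / (of_real (4 * t) * a k)))"
    by (simp only: conj_diag_algebra)
  then have 2: "mat_exp (- (t *\<^sub>R conj_diag Y b) - ?r *\<^sub>R matrix_inv ((4 * t) *\<^sub>R conj_diag Y a))
      = conj_diag Y (\<lambda>k. exp (- (of_real t * b k) - of_real ?r * (1 / (of_real (4 * t) * a k))))"
    by (simp only: mat_exp_conj_diag)
  have 3: "(of_real (4 * pi * t) * a k) powr of_real (- ?d) * exp (- (of_real t * b k) - of_real ?r * (1 / (of_real (4 * t) * a k)))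
      = exp (- (b k * of_real t)) * gker (a k) t (rot S t x - \<xi>)" for k
  proof -
    have "(of_real (4 * pi * t) * a k) powr of_real (- ?d) = of_real ((4 * pi * t) powr - ?d) * a k powr - of_real ?d"
      using t a0 by (subst powr_of_real_mult) (auto simp: powr_of_real[symmetric])
    moreover have "- (of_real t * b k) - of_real ?r * (1 / (of_real (4 * t) * a k)) = - (b k * of_real t) + - of_real ?r / (4 * (of_real t * a k))"
      by (simp add: mult.commute mult.left_commute)
    moreover have "DIM(real ^ 'd) = CARD('d)" by simp
    ultimately show ?thesis unfolding gker_def by (simp only: exp_add mult_ac)
  qed
  show ?thesis unfolding heat_kernel_def 1 2 conj_diag_mult 3 ..
qed

end

section \<open>The matrix-valued semigroup\<close>

lemma norm_smult_vec: "norm (c *s (v :: complex ^ 'n)) = cmod c * norm v"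
  by (simp add: norm_vec_def norm_mult L2_set_right_distrib)

lemma smult_bounded_linear: "bounded_linear (\<lambda>v :: complex ^ 'n. c *s v)"
  unfolding linear_conv_bounded_linear[symmetric]
  by (intro linearI) (simp_all add: vec_eq_iff distrib_left)

lemma smult_measurable [measurable]: "(\<lambda>v :: complex ^ 'n. c *s v) \<in> borel_measurable borel"
  by (intro borel_measurable_continuous_onI linear_continuous_on smult_bounded_linear)

locale OU_system = OU_weight p \<theta> \<eta> C S
  for p :: real and \<theta> :: "real ^ 'd \<Rightarrow> real" and \<eta> C :: real and S :: "real ^ 'd ^ 'd" +
  fixes Y :: "complex ^ 'n ^ 'n" and a b :: "'n \<Rightarrow> complex" and z :: complex and \<epsilon> C_star :: real
  assumes Y: "invertible Y" and Re_a: "\<And>k. Re (a k) > 0"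
    and kummer: "kummer_growth_const CARD('d) (conj_diag Y a) \<eta> p \<epsilon> C_star"
    and Re_z: "Re z > omega_const (conj_diag Y a) (conj_diag Y b) \<eta> p \<epsilon>"
begin

abbreviation "A \<equiv> conj_diag Y a"
abbreviation "B \<equiv> conj_diag Y b"
abbreviation "Z \<equiv> matrix_inv Y"
abbreviation "\<delta> \<equiv> Re z - omega_const A B \<eta> p \<epsilon>"

definition M :: real where "M = M_const CARD('d) A Y C C_star"

text \<open>The scalar factor turns the growth rate of the semigroup into the decay rate
  \<open>\<delta>\<close>. In every eigencoordinate it merely shifts \<open>b k\<close> to
  \<open>b k + z\<close>.\<close>

definition F :: "real \<Rightarrow> (real ^ 'd \<Rightarrow> complex ^ 'n) \<Rightarrow> real ^ 'd \<Rightarrow> complex ^ 'n" where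
  "F t v x = exp (- z * of_real t) *s OU_semigroup A B S t v x"

abbreviation W :: "(real ^ 'd \<Rightarrow> complex ^ 'n) \<Rightarrow> 'n \<Rightarrow> real ^ 'd \<Rightarrow> complex" where
  "W v k \<equiv> \<lambda>\<xi>. (Z *v v \<xi>) $ k"

lemma norm_W_le: "cmod (W v k \<xi>) \<le> spectral_norm Z * norm (v \<xi>)"
  using norm_vector_mult_le[of Z "v \<xi>"] component_le_norm_cart order_trans
  by (metis Finite_Cartesian_Product.norm_nth_le)

lemma W_borel:
  assumes "v \<in> borel_measurable borel"
  shows "W v k \<in> borel_measurable borel"
  using measurable_compose[OF measurable_compose[OF assms vector_mult_measurable[of Z]] vec_nth_measurable[of k]]
  by simp

lemma W_Lp:
  assumes vm: "v \<in> borel_measurable borel" and v: "v \<in> Lp_space p \<theta>"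
  shows "W v k \<in> Lp_space p \<theta>"
  by (rule Lp_bound(1)[OF v borel_imp_lebesgue_measurable[OF W_borel[OF vm]], where c="spectral_norm Z"])
    (simp_all add: norm_W_le spectral_norm_nonneg)

lemma a_bounds:
  "a_min A > 0" "a_max A > 0" "min_Re_spectrum A > 0"
  "\<And>k. a_min A \<le> cmod (a k)" "\<And>k. cmod (a k) \<le> a_max A" "\<And>k. min_Re_spectrum A \<le> Re (a k)"
proof -
  have a0: "cmod (a k) > 0" for k using Re_a[of k] by auto
  show min: "a_min A > 0"
    unfolding a_min_def mat_spectrum_conj_diag[OF Y] using a0 by (subst Min_gr_iff) auto
  show Re: "min_Re_spectrum A > 0"
    unfolding min_Re_spectrum_def mat_spectrum_conj_diag[OF Y] using Re_a by (subst Min_gr_iff) auto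
  show *: "a_min A \<le> cmod (a k)" for k
    unfolding a_min_def mat_spectrum_conj_diag[OF Y] by (intro Min_le) auto
  show **: "cmod (a k) \<le> a_max A" for k
    unfolding a_max_def mat_spectrum_conj_diag[OF Y] by (intro Max_ge) auto
  show "a_max A > 0" using *[of undefined] **[of undefined] min by linarith
  show "min_Re_spectrum A \<le> Re (a k)" for k
    unfolding min_Re_spectrum_def mat_spectrum_conj_diag[OF Y] by (intro Min_le) auto
qed

lemma b_bound: "min_Re_spectrum B \<le> Re (b k)"
  unfolding min_Re_spectrum_def mat_spectrum_conj_diag[OF Y] by (intro Min_le) auto

text \<open>Rate and prefactor of one Gaussian dominating all scalar kernels: the slowest decay
  combines the least real part with the largest modulus, and the largest prefactor belongs to the
  least modulus because the power is negative.\<close>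

definition kernel_rate :: "real \<Rightarrow> real" where "kernel_rate t = min_Re_spectrum A / (4 * t * (a_max A)\<^sup>2)"
definition kernel_scale :: "real \<Rightarrow> real" where "kernel_scale t = (4 * pi * t * a_min A) powr - (real CARD('d) / 2)"

lemma kernel_bound:
  assumes t: "t > 0"
  shows "cmod (exp (- (b k * of_real t)) * gker (a k) t (y :: real ^ 'd))
    \<le> exp (- (min_Re_spectrum B * t)) * (kernel_scale t * exp (- (kernel_rate t * (norm y)\<^sup>2)))"
proof -
  have "0 < t * (cmod (a k))\<^sup>2" using t Re_a[of k] by (auto intro!: mult_pos_pos)
  then have "Re (a k) / (4 * t * (cmod (a k))\<^sup>2) \<ge> kernel_rate t"
    unfolding kernel_rate_def using t a_bounds(6)[of k] a_bounds(3,1) a_bounds(4)[of k] a_bounds(5)[of k]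
    by (intro frac_le mult_left_mono power_mono) auto
  from mult_right_mono[OF this zero_le_power2[of "norm y"]]
  have "exp (- (Re (a k) / (4 * t * (cmod (a k))\<^sup>2) * (norm y)\<^sup>2)) \<le> exp (- (kernel_rate t * (norm y)\<^sup>2))"
    by (simp only: exp_le_cancel_iff neg_le_iff_le)
  moreover have "(4 * pi * t * cmod (a k)) powr - (real CARD('d) / 2) \<le> kernel_scale t"
    unfolding kernel_scale_def using t a_bounds(4)[of k] a_bounds(1) by (intro powr_mono2') auto
  ultimately have "cmod (gker (a k) t y) \<le> kernel_scale t * exp (- (kernel_rate t * (norm y)\<^sup>2))"
    unfolding norm_gker[OF Re_a t] by (intro mult_mono) (auto simp: kernel_scale_def)
  moreover have "cmod (exp (- (b k * of_real t))) \<le> exp (- (min_Re_spectrum B * t))"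
    using b_bound[of k] t by (simp add: norm_exp_eq_Re mult_right_mono)
  ultimately show ?thesis unfolding norm_mult by (intro mult_mono) (auto simp: kernel_scale_def)
qed

text \<open>Elements of the weighted space are only Lebesgue measurable, and their Bochner integrals over \<open>lborel\<close> may be
  junk; for \<open>t > 0\<close> one can replace \<open>v\<close> by a Borel measurable representative \<open>v'\<close>.\<close>

lemma F_eq:
  assumes t: "t > 0" and v: "v \<in> Lp_space p \<theta>" and v'm: "v' \<in> borel_measurable borel"
    and ae: "AE x in lebesgue. v x = v' x"
  shows "integrable lebesgue (\<lambda>\<xi>. heat_kernel A B S x \<xi> t *v v \<xi>)"
    "F t v x = Y *v (\<chi> k. V (a k) (b k + z) t (W v' k) x)"
    "F t v x = exp (- z * of_real t) *s (LINT \<xi>|lborel. heat_kernel A B S x \<xi> t *v v' \<xi>)"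
    "integrable lborel (\<lambda>\<xi>. heat_kernel A B S x \<xi> t *v v' \<xi>)"
proof -
  have "AE x in lebesgue. v' x = v x" using ae by eventually_elim simp
  then have v': "v' \<in> Lp_space p \<theta>" by (rule Lp_cong_AE(1)[OF v])
  let ?h = "\<lambda>\<xi>. heat_kernel A B S x \<xi> t"
  let ?I = "Y *v (\<chi> k. exp (- (b k * of_real t)) * (LINT \<xi>|lborel. gker (a k) t (rot S t x - \<xi>) * W v' k \<xi>))"
  have "has_bochner_integral lborel (\<lambda>\<xi>. Y *v (\<chi> k. exp (- (b k * of_real t)) * (gker (a k) t (rot S t x - \<xi>) * W v' k \<xi>))) ?I"
    by (intro has_bochner_integral_bounded_linear[OF vector_mult_bounded_linear] has_bochner_integral_vec
        has_bochner_integral_mult_right has_bochner_integral_integrable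
        V_integrable[OF Re_a t W_borel[OF v'm] W_Lp[OF v'm v']])
  moreover have h: "?h \<xi> *v u = Y *v (\<chi> k. exp (- (b k * of_real t)) * (gker (a k) t (rot S t x - \<xi>) * (Z *v u) $ k))" for \<xi> u
    unfolding heat_kernel_conj_diag[OF Y t Re_a] conj_diag_vector by (simp only: mult.assoc)
  ultimately have I: "has_bochner_integral lborel (\<lambda>\<xi>. ?h \<xi> *v v' \<xi>) ?I" by simp
  then show I1: "integrable lborel (\<lambda>\<xi>. ?h \<xi> *v v' \<xi>)" by (simp add: has_bochner_integral_iff)
  then have m: "(\<lambda>\<xi>. ?h \<xi> *v v' \<xi>) \<in> borel_measurable borel"
    using borel_measurable_integrable by fastforce
  have I2: "integrable lebesgue (\<lambda>\<xi>. ?h \<xi> *v v' \<xi>)"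
    using I1 m by (simp add: integrable_completion)
  have aeh: "AE \<xi> in lebesgue. ?h \<xi> *v v \<xi> = ?h \<xi> *v v' \<xi>" using ae by eventually_elim simp
  have hm: "(\<lambda>\<xi>. ?h \<xi> *v v \<xi>) \<in> borel_measurable lebesgue"
    by (rule lebesgue_measurable_cong_AE[OF borel_imp_lebesgue_measurable[OF m] aeh])
  show "integrable lebesgue (\<lambda>\<xi>. ?h \<xi> *v v \<xi>)"
    using integrable_cong_AE[OF hm borel_imp_lebesgue_measurable[OF m] aeh] I2 by simp
  have "(LINT \<xi>|lebesgue. ?h \<xi> *v v \<xi>) = (LINT \<xi>|lebesgue. ?h \<xi> *v v' \<xi>)"
    by (rule integral_cong_AE[OF hm borel_imp_lebesgue_measurable[OF m] aeh])
  also have "\<dots> = (LINT \<xi>|lborel. ?h \<xi> *v v' \<xi>)" using m by (simp add: integral_completion)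
  finally have L: "OU_semigroup A B S t v x = (LINT \<xi>|lborel. ?h \<xi> *v v' \<xi>)" using t by (simp add: OU_semigroup_def)
  then show "F t v x = exp (- z * of_real t) *s (LINT \<xi>|lborel. ?h \<xi> *v v' \<xi>)" by (simp add: F_def)
  have "exp (- z * of_real t) *s (Y *v u) = Y *v (\<chi> k. exp (- z * of_real t) * u $ k)" for u
    by (simp add: vec_eq_iff matrix_vector_mult_def sum_distrib_left mult_ac)
  moreover have "exp (- z * of_real t) * exp (- (b k * of_real t)) = exp (- ((b k + z) * of_real t))" for k
    by (simp add: exp_add[symmetric] algebra_simps)
  ultimately show "F t v x = Y *v (\<chi> k. V (a k) (b k + z) t (W v' k) x)"
    using I unfolding F_def L by (simp add: has_bochner_integral_iff V_def mult.assoc[symmetric])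
qed

lemma F_joint_measurable:
  assumes v: "v \<in> Lp_space p \<theta>"
  shows "(\<lambda>y. indicator {0<..} (fst y) *\<^sub>R F (fst y) v (snd y)) \<in> borel_measurable (borel \<Otimes>\<^sub>M borel)"
proof -
  obtain v' where v': "v' \<in> borel_measurable borel" "AE x in lebesgue. v x = v' x"
    using Lp_ex_borel[OF v] by blast
  have "(\<lambda>y. \<chi> k. V (a k) (b k + z) (fst y) (W v' k) (snd y)) \<in> borel_measurable (borel \<Otimes>\<^sub>M borel)"
    by (intro vec_lambda_measurable V_jointly_measurable W_borel v')
  then have [measurable]: "(\<lambda>y. Y *v (\<chi> k. V (a k) (b k + z) (fst y) (W v' k) (snd y))) \<in> borel_measurable (borel \<Otimes>\<^sub>M borel)"
    by (rule measurable_compose[OF _ vector_mult_measurable])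
  have "(\<lambda>y. indicator {0<..} (fst y) *\<^sub>R F (fst y) v (snd y))
      = (\<lambda>y. indicator {0<..} (fst y) *\<^sub>R (Y *v (\<chi> k. V (a k) (b k + z) (fst y) (W v' k) (snd y))))"
    using F_eq(2)[OF _ v v'] by (auto simp: indicator_def fun_eq_iff)
  also have "\<dots> \<in> borel_measurable (borel \<Otimes>\<^sub>M borel)" by measurable
  finally show ?thesis .
qed

lemma F_borel:
  assumes t: "t > 0" and v: "v \<in> Lp_space p \<theta>"
  shows "F t v \<in> borel_measurable borel"
proof -
  have "Pair t \<in> borel \<rightarrow>\<^sub>M borel \<Otimes>\<^sub>M (borel :: (real ^ 'd) measure)" by (rule measurable_Pair1') simp
  from measurable_compose[OF this F_joint_measurable[OF v]] t show ?thesis by simp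
qed

lemma M_pos: "M > 0"
  unfolding M_def M_const_def a_one_def
  using C_pos kappa_pos[OF Y] a_bounds(1-3) kummer by (auto simp: kummer_growth_const_def)

lemma F_bound:
  assumes t: "t > 0" and v: "v \<in> Lp_space p \<theta>"
  shows "F t v \<in> Lp_space p \<theta>" "Lp_norm p \<theta> (F t v) \<le> M * exp (- \<delta> * t) * Lp_norm p \<theta> v"
proof -
  obtain v' where v': "v' \<in> borel_measurable borel" "AE x in lebesgue. v x = v' x" "v' \<in> Lp_space p \<theta>"
    "Lp_norm p \<theta> v' = Lp_norm p \<theta> v"
    using Lp_ex_borel[OF v] by blast
  define \<nu> where "\<nu> = nu_const A \<eta> p"
  define d where "d = real CARD('d)"
  have k: "kernel_rate t > 0" "kernel_scale t > 0" using t a_bounds by (auto simp: kernel_rate_def kernel_scale_def)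
  have hm: "(\<lambda>x. norm (v' x)) \<in> borel_measurable borel" using v'(1) by measurable
  note G = gauss_convolution_bound[OF k hm norm_ge_zero Lp_norm_fun[OF v'(3)], of t, folded d_def]
  let ?w = "\<lambda>x. LINT \<xi>|lborel. kernel_scale t * exp (- (kernel_rate t * (norm (rot S t x - \<xi>))\<^sup>2)) * norm (v' \<xi>)"
  \<comment> \<open>The mass of the dominating Gaussian. The time cancels, and the quotient of
    moduli and real part that remains is \<open>a_one A\<close>.\<close>
  have C1: "kernel_scale t * (pi / kernel_rate t) powr (d / 2) = a_one A powr (d / 2)"
  proof -
    have "kernel_scale t * (pi / kernel_rate t) powr (d / 2) = ((pi / kernel_rate t) / (4 * pi * t * a_min A)) powr (d / 2)"
      unfolding kernel_scale_def d_def powr_minus_divide by (simp only: powr_divide times_divide_eq_left mult_1_left)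
    also have "(pi / kernel_rate t) / (4 * pi * t * a_min A) = a_one A"
      using t a_bounds by (simp add: kernel_rate_def a_one_def)
    finally show ?thesis .
  qed
  \<comment> \<open>With the exponential rate \<open>\<eta> * p\<close> and the decay
    \<open>kernel_rate t\<close>, the argument of the Kummer functions becomes the one in the growth
    condition.\<close>
  have nu: "(\<eta> * p)\<^sup>2 / (4 * kernel_rate t) = \<nu> * t"
    using t a_bounds by (simp add: kernel_rate_def \<nu>_def nu_const_def power_mult_distrib field_simps)
  let ?E = "exp (- (Re z * t)) * (kappa Y * exp (- (min_Re_spectrum B * t)))"
  have E: "?E \<ge> 0" using kappa_pos[OF Y] by simp
  have le: "norm (F t v x) \<le> ?E * norm (?w x)" for x
  proof -
    have hb: "norm (heat_kernel A B S x \<xi> t *v u)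
        \<le> kappa Y * (exp (- (min_Re_spectrum B * t)) * (kernel_scale t * exp (- (kernel_rate t * (norm (rot S t x - \<xi>))\<^sup>2)))) * norm u" for \<xi> u
      unfolding heat_kernel_conj_diag[OF Y t Re_a] by (rule norm_conj_diag_le) (rule kernel_bound[OF t])
    have "norm (LINT \<xi>|lborel. heat_kernel A B S x \<xi> t *v v' \<xi>)
        \<le> (LINT \<xi>|lborel. norm (heat_kernel A B S x \<xi> t *v v' \<xi>))" by (rule integral_norm_bound)
    also have "\<dots> \<le> (LINT \<xi>|lborel. (kappa Y * exp (- (min_Re_spectrum B * t))) * (kernel_scale t * exp (- (kernel_rate t * (norm (rot S t x - \<xi>))\<^sup>2)) * norm (v' \<xi>)))"
    proof (rule integral_mono)
      show "integrable lborel (\<lambda>\<xi>. norm (heat_kernel A B S x \<xi> t *v v' \<xi>))"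
        by (rule integrable_norm[OF F_eq(4)[OF t v v'(1,2)]])
      show "integrable lborel (\<lambda>\<xi>. (kappa Y * exp (- (min_Re_spectrum B * t))) * (kernel_scale t * exp (- (kernel_rate t * (norm (rot S t x - \<xi>))\<^sup>2)) * norm (v' \<xi>)))"
        by (rule integrable_mult_right[OF G(1)])
      show "norm (heat_kernel A B S x \<xi> t *v v' \<xi>) \<le> (kappa Y * exp (- (min_Re_spectrum B * t))) * (kernel_scale t * exp (- (kernel_rate t * (norm (rot S t x - \<xi>))\<^sup>2)) * norm (v' \<xi>))" for \<xi>
        using hb[of \<xi> "v' \<xi>"] by (simp add: mult_ac)
    qed
    also have "\<dots> = (kappa Y * exp (- (min_Re_spectrum B * t))) * ?w x" by (rule integral_mult_right_zero)
    finally have "norm (F t v x) \<le> exp (- (Re z * t)) * ((kappa Y * exp (- (min_Re_spectrum B * t))) * ?w x)"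
      unfolding F_eq(3)[OF t v v'(1,2)] norm_smult_vec by (simp add: norm_exp_eq_Re)
    also have "\<dots> = ?E * ?w x" by simp
    also have "\<dots> \<le> ?E * norm (?w x)" by (intro mult_left_mono E) simp
    finally show ?thesis .
  qed
  note Fb = Lp_bound[OF G(2) borel_imp_lebesgue_measurable[OF F_borel[OF t v]] _ E]
  show "F t v \<in> Lp_space p \<theta>" by (rule Fb(1)) (use le in simp)
  have nut: "\<nu> * t \<ge> 0" using a_bounds t by (auto simp: \<nu>_def nu_const_def)
  have kg: "kummer_bracket d (\<nu> * t) powr (1 / p) \<le> C_star * exp ((1 + \<epsilon>) * (\<nu> / p) * t)"
    using kummer t unfolding kummer_growth_const_def kummer_bracket_def Let_def \<nu>_def d_def by simp
  have nv: "Lp_norm p \<theta> (\<lambda>x. norm (v' x)) = Lp_norm p \<theta> v" using v'(4) by (simp add: Lp_norm_def)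
  have "Lp_norm p \<theta> (F t v) \<le> ?E * Lp_norm p \<theta> ?w" by (rule Fb(2)) (use le in simp)
  also have "\<dots> \<le> ?E * (C * a_one A powr (d / 2) * kummer_bracket d (\<nu> * t) powr (1 / p) * Lp_norm p \<theta> v)"
    by (intro mult_left_mono E G(3)[unfolded C1 nu nv])
  also have "\<dots> \<le> ?E * (C * a_one A powr (d / 2) * (C_star * exp ((1 + \<epsilon>) * (\<nu> / p) * t)) * Lp_norm p \<theta> v)"
    using C_pos by (intro mult_left_mono mult_right_mono E kg) auto
  also have "\<dots> = M * exp (- \<delta> * t) * Lp_norm p \<theta> v"
  proof -
    have "\<nu> / p = (a_max A)\<^sup>2 * \<eta>\<^sup>2 * p / min_Re_spectrum A"
      using p_ge_1 by (simp add: \<nu>_def nu_const_def power2_eq_square)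
    \<comment> \<open>The three exponents are those of the factor with \<open>z\<close>, of the
      eigenvalues of \<open>B\<close>, and of the growth condition; since \<open>\<nu> / p\<close>
      has a single power of \<open>p\<close>, their sum is the definition of
      \<open>omega_const\<close>.\<close>
    then have "- \<delta> * t = - (Re z * t) + - (min_Re_spectrum B * t) + (1 + \<epsilon>) * (\<nu> / p) * t"
      by (simp add: omega_const_def algebra_simps)
    then have "exp (- \<delta> * t) = exp (- (Re z * t)) * exp (- (min_Re_spectrum B * t)) * exp ((1 + \<epsilon>) * (\<nu> / p) * t)"
      by (simp only: exp_add)
    then show ?thesis by (simp only: M_def M_const_def d_def mult_ac)
  qed
  finally show "Lp_norm p \<theta> (F t v) \<le> M * exp (- \<delta> * t) * Lp_norm p \<theta> v" .
qed

lemma F_linear: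
  assumes t: "t > 0" and g: "g \<in> Lp_space p \<theta>" and h: "h \<in> Lp_space p \<theta>"
  shows "F t (\<lambda>x. c *\<^sub>R g x + h x) x = c *\<^sub>R F t g x + F t h x"
proof -
  have int: "integrable lebesgue (\<lambda>\<xi>. heat_kernel A B S x \<xi> t *v v \<xi>)" if v: "v \<in> Lp_space p \<theta>" for v :: "real ^ 'd \<Rightarrow> complex ^ 'n"
  proof -
    obtain v' where v': "v' \<in> borel_measurable borel" "AE x in lebesgue. v x = v' x"
      by (rule Lp_ex_borel[OF v])
    show ?thesis by (rule F_eq(1)[OF t v v'])
  qed
  have 1: "heat_kernel A B S x \<xi> t *v (c *\<^sub>R g \<xi> + h \<xi>) = c *\<^sub>R (heat_kernel A B S x \<xi> t *v g \<xi>) + heat_kernel A B S x \<xi> t *v h \<xi>" for \<xi>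
    using vector_mult_linear[of "heat_kernel A B S x \<xi> t"] by (simp only: linear_add linear_scale)
  have "OU_semigroup A B S t (\<lambda>x. c *\<^sub>R g x + h x) x = c *\<^sub>R OU_semigroup A B S t g x + OU_semigroup A B S t h x"
    unfolding OU_semigroup_def 1 using t
    by (simp only: Bochner_Integration.integral_add[OF integrable_scaleR_right[OF int[OF g]] int[OF h]] integral_scaleR_right if_False less_imp_neq[symmetric])
  then show ?thesis
    unfolding F_def by (simp add: vec_eq_iff distrib_left)
qed

text \<open>In the coordinates of the eigenbasis the semigroup acts by the scalar operators
  \<open>V\<close>, so the laws below are proved one coordinate at a time.\<close>

lemma W_F:
  assumes t: "t > 0" and v: "v \<in> Lp_space p \<theta>" and v': "v' \<in> borel_measurable borel" "AE x in lebesgue. v x = v' x"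
  shows "W (F t v) k = V (a k) (b k + z) t (W v' k)"
  using F_eq(2)[OF t v v'] by (simp add: fun_eq_iff matrix_vector_mul_assoc matrix_inv_cancel[OF Y])

lemma F_semigroup:
  assumes t: "t > 0" and s: "s > 0" and v: "v \<in> Lp_space p \<theta>"
  shows "F t (F s v) x = F (t + s) v x"
proof -
  obtain v' where v': "v' \<in> borel_measurable borel" "AE x in lebesgue. v x = v' x" "v' \<in> Lp_space p \<theta>"
    using Lp_ex_borel[OF v] by blast
  have "F t (F s v) x = Y *v (\<chi> k. V (a k) (b k + z) t (W (F s v) k) x)"
    by (rule F_eq(2)[OF t F_bound(1)[OF s v] F_borel[OF s v]]) simp
  also have "\<dots> = Y *v (\<chi> k. V (a k) (b k + z) (t + s) (W v' k) x)"
    unfolding W_F[OF s v v'(1,2)] V_semigroup[OF Re_a t s W_borel[OF v'(1)] W_Lp[OF v'(1,3)]] ..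
  also have "\<dots> = F (t + s) v x" using t s by (intro F_eq(2)[symmetric] v v'(1,2)) simp
  finally show ?thesis .
qed

text \<open>Coordinates of a continuous function of compact support are again of this kind, and the
  norm of a vector is at most the sum of the moduli of its coordinates.\<close>

lemma F_continuous_compact_support:
  assumes u: "continuous_on UNIV u" "\<And>x. norm (u x) \<le> K * indicator (cball 0 R) x" "0 \<le> K" "0 \<le> R"
  shows "u \<in> Lp_space p \<theta>" "((\<lambda>t. Lp_norm p \<theta> (\<lambda>x. F t u x - u x)) \<longlongrightarrow> 0) (at_right 0)"
proof -
  have um: "u \<in> borel_measurable borel" using u(1) by (rule borel_measurable_continuous_onI)
  show uL: "u \<in> Lp_space p \<theta>" by (rule bounded_support_in_Lp[OF borel_imp_lebesgue_measurable[OF um] u(2)])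
  have Wc: "continuous_on UNIV (W u k)" for k
    by (intro bounded_linear.continuous_on[OF bounded_linear_vec_nth] bounded_linear.continuous_on[OF vector_mult_bounded_linear] u(1))
  have Wle: "cmod (W u k x) \<le> (spectral_norm Z * K) * indicator (cball 0 R) x" for k x
    using norm_W_le[of u x k] mult_left_mono[OF u(2)[of x] spectral_norm_nonneg[of Z]] by (simp add: mult.assoc)
  have K0: "0 \<le> spectral_norm Z * K" using u(3) by (intro mult_nonneg_nonneg spectral_norm_nonneg)
  note Vc = V_strongly_continuous_compact_support[OF Re_a Wc Wle K0 u(4)]
  let ?D = "\<lambda>t k x. V (a k) (b k + z) t (W u k) x - W u k x"
  have le: "Lp_norm p \<theta> (\<lambda>x. F t u x - u x) \<le> spectral_norm Y * (\<Sum>k\<in>UNIV. Lp_norm p \<theta> (?D t k))" if t: "0 < t" "t \<le> 1" for t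
  proof -
    have D: "?D t k \<in> Lp_space p \<theta>" for k by (intro Lp_diff Vc(2,3) t)
    have nD: "(\<lambda>x. norm (?D t k x)) \<in> Lp_space p \<theta>" "Lp_norm p \<theta> (\<lambda>x. norm (?D t k x)) = Lp_norm p \<theta> (?D t k)" for k
      using Lp_norm_fun[OF D] by (auto simp: Lp_norm_def)
    have "F t u x - u x = Y *v (\<chi> k. ?D t k x)" for x
    proof -
      have "F t u x = Y *v (\<chi> k. V (a k) (b k + z) t (W u k) x)" by (rule F_eq(2)[OF t(1) uL um]) simp
      moreover have "u x = Y *v (\<chi> k. W u k x)" by (simp add: matrix_vector_mul_assoc matrix_inv_cancel[OF Y])
      moreover have "(\<chi> k. ?D t k x) = (\<chi> k. V (a k) (b k + z) t (W u k) x) - (\<chi> k. W u k x)" by (simp add: vec_eq_iff)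
      ultimately show ?thesis by (simp add: matrix_vector_mult_diff_distrib)
    qed
    then have "norm (F t u x - u x) \<le> spectral_norm Y * norm (\<Sum>k\<in>UNIV. norm (?D t k x))" for x
    proof -
      assume eq: "\<And>x. F t u x - u x = Y *v (\<chi> k. ?D t k x)"
      have "norm (\<chi> k. ?D t k x) \<le> (\<Sum>k\<in>UNIV. norm ((\<chi> k. ?D t k x) $ k))"
        unfolding norm_vec_def by (rule L2_set_le_sum) simp
      also have "\<dots> = norm (\<Sum>k\<in>UNIV. norm (?D t k x))" by (simp add: sum_nonneg)
      finally show ?thesis
        unfolding eq using norm_vector_mult_le[of Y "\<chi> k. ?D t k x"] mult_left_mono[OF _ spectral_norm_nonneg[of Y]]
        by (meson order_trans)
    qed
    moreover have "(\<lambda>x. F t u x - u x) \<in> borel_measurable lebesgue"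
      using F_borel[OF t(1) uL] um by (intro borel_imp_lebesgue_measurable borel_measurable_diff)
    ultimately have "Lp_norm p \<theta> (\<lambda>x. F t u x - u x) \<le> spectral_norm Y * Lp_norm p \<theta> (\<lambda>x. \<Sum>k\<in>UNIV. norm (?D t k x))"
      by (intro Lp_bound(2)[OF Lp_sum(1)[OF nD(1) finite]] spectral_norm_nonneg) simp_all
    also have "\<dots> \<le> spectral_norm Y * (\<Sum>k\<in>UNIV. Lp_norm p \<theta> (?D t k))"
      unfolding nD(2)[symmetric] by (intro mult_left_mono spectral_norm_nonneg Lp_sum(2) nD(1) finite)
    finally show ?thesis .
  qed
  have lim: "((\<lambda>t. spectral_norm Y * (\<Sum>k\<in>UNIV. Lp_norm p \<theta> (?D t k))) \<longlongrightarrow> spectral_norm Y * (\<Sum>k\<in>(UNIV :: 'n set). 0)) (at_right 0)"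
    by (intro tendsto_intros Vc(1))
  show "((\<lambda>t. Lp_norm p \<theta> (\<lambda>x. F t u x - u x)) \<longlongrightarrow> 0) (at_right 0)"
  proof (rule tendsto_sandwich[OF _ _ tendsto_const])
    show "((\<lambda>t. spectral_norm Y * (\<Sum>k\<in>UNIV. Lp_norm p \<theta> (?D t k))) \<longlongrightarrow> 0) (at_right 0)" using lim by simp
    show "\<forall>\<^sub>F t in at_right 0. Lp_norm p \<theta> (\<lambda>x. F t u x - u x) \<le> spectral_norm Y * (\<Sum>k\<in>UNIV. Lp_norm p \<theta> (?D t k))"
      using le by (auto simp: eventually_at_right_field intro!: exI[of _ 1])
  qed simp
qed

lemma F_diff:
  assumes t: "t > 0" and g: "g \<in> Lp_space p \<theta>" and h: "h \<in> Lp_space p \<theta>"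
  shows "F t (\<lambda>x. g x - h x) x = F t g x - F t h x"
proof -
  have "(\<lambda>x. g x - h x) = (\<lambda>x. (-1) *\<^sub>R h x + g x)" by auto
  then show ?thesis using F_linear[OF t h g, of "-1" x] by simp
qed

lemma \<delta>_pos: "\<delta> > 0" using Re_z by simp

lemma F_continuous:
  assumes g: "g \<in> Lp_space p \<theta>"
  shows "((\<lambda>t. Lp_norm p \<theta> (\<lambda>x. F t g x - g x)) \<longlongrightarrow> 0) (at_right 0)"
proof (rule tendstoI)
  fix e :: real assume e: "e > 0"
  \<comment> \<open>The three errors of the approximation argument are \<open>M * e'\<close>,
    \<open>e'\<close> and \<open>e'\<close>; the factor 2 makes the final inequality strict.\<close>
  define e' where "e' = e / (2 * (M + 2))"
  have e': "e' > 0" using e M_pos by (simp add: e'_def)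
  have "(M + 2) * e' = e / 2" unfolding e'_def using M_pos by (simp add: divide_simps)
  then have ee: "(M + 2) * e' < e" using e by simp
  obtain u K R where u: "continuous_on UNIV u" "\<And>x. norm (u x) \<le> K * indicator (cball 0 R) x" "0 \<le> K" "0 \<le> R"
    "Lp_norm p \<theta> (\<lambda>x. u x - g x) < e'"
    by (rule Lp_dense_continuous[OF g e']) (rule that)
  note uc = F_continuous_compact_support[OF u(1-4)]
  have "\<forall>\<^sub>F t in at_right 0. Lp_norm p \<theta> (\<lambda>x. F t u x - u x) < e'"
    using order_tendstoD(2)[OF uc(2) e'] .
  then show "\<forall>\<^sub>F t in at_right 0. dist (Lp_norm p \<theta> (\<lambda>x. F t g x - g x)) 0 < e"
    using eventually_at_right_less[of "0::real"]
  proof eventually_elim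
    case (elim t)
    then have t: "t > 0" by simp
    have d: "(\<lambda>x. g x - u x) \<in> Lp_space p \<theta>" "(\<lambda>x. u x - g x) \<in> Lp_space p \<theta>" by (intro Lp_diff g uc(1))+
    have Fu: "(\<lambda>x. F t u x - u x) \<in> Lp_space p \<theta>" by (intro Lp_diff F_bound(1) t uc(1))
    have "(\<lambda>x. F t g x - g x) = (\<lambda>x. F t (\<lambda>x. g x - u x) x + ((F t u x - u x) + (u x - g x)))"
      by (simp add: F_diff[OF t g uc(1)])
    then have "Lp_norm p \<theta> (\<lambda>x. F t g x - g x) \<le> Lp_norm p \<theta> (F t (\<lambda>x. g x - u x)) + Lp_norm p \<theta> (\<lambda>x. (F t u x - u x) + (u x - g x))"
      using Lp_add(2)[OF F_bound(1)[OF t d(1)] Lp_add(1)[OF Fu d(2)]] by simp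
    moreover have "Lp_norm p \<theta> (\<lambda>x. (F t u x - u x) + (u x - g x)) \<le> Lp_norm p \<theta> (\<lambda>x. F t u x - u x) + Lp_norm p \<theta> (\<lambda>x. u x - g x)"
      by (rule Lp_add(2)[OF Fu d(2)])
    moreover have "Lp_norm p \<theta> (F t (\<lambda>x. g x - u x)) \<le> M * 1 * e'"
    proof (rule order_trans[OF F_bound(2)[OF t d(1)]])
      show "M * exp (- \<delta> * t) * Lp_norm p \<theta> (\<lambda>x. g x - u x) \<le> M * 1 * e'"
        using M_pos \<delta>_pos t u(5) Lp_diff(3)[OF g uc(1)]
        by (intro mult_mono) (auto simp: mult_nonpos_nonneg)
    qed
    moreover have "(M + 2) * e' = M * 1 * e' + e' + e'" by (simp add: distrib_right)
    ultimately have "Lp_norm p \<theta> (\<lambda>x. F t g x - g x) < (M + 2) * e'"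
      using elim(1) u(5) by linarith
    then show ?case using ee by (simp add: dist_real_def)
  qed
qed

text \<open>The scalar commutation result is applied in each coordinate of the eigenbasis, and the
  coordinates are reassembled. Its hypothesis on integrals of norms follows from the exponential
  decay.\<close>

lemma F_integral:
  assumes h: "h > 0" and g: "g \<in> Lp_space p \<theta>"
  shows "F h (\<lambda>x. LINT t|lborel. indicator {0<..} t *\<^sub>R F t g x) x = (LINT t|lborel. indicator {0<..} t *\<^sub>R F h (F t g) x)"
proof -
  let ?S = "{0<..} :: real set"
  define \<phi> where "\<phi> t x = indicator ?S t *\<^sub>R F t g x" for t x
  define w where "w k t \<xi> = W (\<phi> t) k \<xi>" for k t \<xi>
  define c where "c t = M * Lp_norm p \<theta> g * exp (- \<delta> * t)" for t
  have cm: "c \<in> borel_measurable borel" unfolding c_def by measurable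
  have c0: "0 \<le> c t" for t using M_pos by (simp add: c_def)
  define C0 where "C0 = M * Lp_norm p \<theta> g * (exp (- \<delta> * 0) / \<delta>)"
  have C0: "C0 \<ge> 0" using M_pos \<delta>_pos by (simp add: C0_def)
  have cC: "(\<integral>\<^sup>+t. ennreal (indicator ?S t * c t) \<partial>lborel) \<le> ennreal C0"
    unfolding c_def C0_def by (rule nn_integral_exp_tail) (use M_pos \<delta>_pos in auto)
  have \<phi>m: "(\<lambda>y. \<phi> (fst y) (snd y)) \<in> borel_measurable (borel \<Otimes>\<^sub>M borel)"
    unfolding \<phi>_def by (rule F_joint_measurable[OF g])
  have FL: "F t g \<in> Lp_space p \<theta>" "Lp_norm p \<theta> (F t g) \<le> c t" if "t \<in> ?S" for t
    using F_bound[of t g] that g by (auto simp: c_def mult_ac)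
  have S: "?S \<in> sets borel" "?S \<subseteq> {0<..}" by auto
  have "(\<lambda>(t, x). indicator ?S t *\<^sub>R F t g x) \<in> borel_measurable (borel \<Otimes>\<^sub>M borel)"
    using \<phi>m by (simp add: \<phi>_def case_prod_beta')
  note I = Lp_set_integral[OF S this cm c0 FL cC C0, folded \<phi>_def]
  have swap: "(\<lambda>y. (snd y, fst y)) \<in> borel \<Otimes>\<^sub>M lborel \<rightarrow>\<^sub>M borel \<Otimes>\<^sub>M borel" by measurable
  have wm: "(\<lambda>y. w k (snd y) (fst y)) \<in> borel_measurable (borel \<Otimes>\<^sub>M lborel)" for k
  proof -
    have "(\<lambda>y. \<phi> (snd y) (fst y)) \<in> borel_measurable (borel \<Otimes>\<^sub>M lborel)"
      using measurable_compose[OF swap \<phi>m] by simp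
    from measurable_compose[OF measurable_compose[OF this vector_mult_measurable[of Z]] vec_nth_measurable[of k]]
    show ?thesis by (simp add: w_def)
  qed
  have aew: "AE \<xi> in lborel. integrable lborel (\<lambda>t. \<phi> t \<xi>)" using I(1) by (simp add: AE_completion_iff)
  have wint: "integrable lborel (\<lambda>t. w k t \<xi>)" "(LINT t|lborel. w k t \<xi>) = W (\<lambda>x. LINT t|lborel. \<phi> t x) k \<xi>"
    if "integrable lborel (\<lambda>t. \<phi> t \<xi>)" for k \<xi>
    unfolding w_def using that
    by (simp_all add: integrable_bounded_linear[OF bounded_linear_compose[OF bounded_linear_vec_nth vector_mult_bounded_linear]]
        integral_bounded_linear[OF bounded_linear_compose[OF bounded_linear_vec_nth vector_mult_bounded_linear]])
  have aew': "AE \<xi> in lborel. integrable lborel (\<lambda>t. w k t \<xi>)" for k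
    using aew by eventually_elim (rule wint(1))
  \<comment> \<open>Minkowski's inequality for the moduli of the coordinates, each bounded by the
    norm of \<open>Z\<close> times the bound for \<open>F t g\<close>.\<close>
  have wL: "(\<lambda>\<xi>. LINT t|lborel. norm (w k t \<xi>)) \<in> Lp_space p \<theta>" for k
  proof -
    have eq: "norm (w k t \<xi>) = indicator ?S t *\<^sub>R norm (W (F t g) k \<xi>)" for t \<xi>
      using linear_scale[OF vector_mult_linear[of Z], of "indicator ?S t" "F t g \<xi>"] by (simp add: w_def \<phi>_def)
    have m1: "(\<lambda>(t, \<xi>). indicator ?S t *\<^sub>R norm (W (F t g) k \<xi>)) \<in> borel_measurable (borel \<Otimes>\<^sub>M borel)"
    proof -
      have "(\<lambda>y. norm ((Z *v \<phi> (fst y) (snd y)) $ k)) \<in> borel_measurable (borel \<Otimes>\<^sub>M borel)"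
        using measurable_compose[OF measurable_compose[OF \<phi>m vector_mult_measurable[of Z]] vec_nth_measurable[of k]] by measurable
      then show ?thesis unfolding eq[unfolded w_def, symmetric] by (simp add: case_prod_beta')
    qed
    let ?c = "\<lambda>t. spectral_norm Z * c t"
    have c': "?c \<in> borel_measurable borel" using cm by measurable
    have c'0: "0 \<le> ?c t" for t using c0 by (intro mult_nonneg_nonneg spectral_norm_nonneg)
    have n1: "(\<lambda>\<xi>. norm (W (F t g) k \<xi>)) \<in> Lp_space p \<theta>" "Lp_norm p \<theta> (\<lambda>\<xi>. norm (W (F t g) k \<xi>)) \<le> ?c t" if "t \<in> ?S" for t
    proof -
      have t: "t > 0" using that by simp
      have m2: "(\<lambda>\<xi>. norm (W (F t g) k \<xi>)) \<in> borel_measurable lebesgue"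
      proof -
        have "W (F t g) k \<in> borel_measurable borel" by (intro W_borel F_borel t g)
        from measurable_compose[OF this borel_measurable_norm] show ?thesis
          by (rule borel_imp_lebesgue_measurable)
      qed
      have "AE \<xi> in lebesgue. norm (norm (W (F t g) k \<xi>)) \<le> spectral_norm Z * norm (F t g \<xi>)"
        using norm_W_le[of "F t g"] by simp
      note b = Lp_bound[OF FL(1)[OF that] m2 this spectral_norm_nonneg]
      show "(\<lambda>\<xi>. norm (W (F t g) k \<xi>)) \<in> Lp_space p \<theta>" by (rule b(1))
      show "Lp_norm p \<theta> (\<lambda>\<xi>. norm (W (F t g) k \<xi>)) \<le> ?c t"
        using b(2) mult_left_mono[OF FL(2)[OF that] spectral_norm_nonneg[of Z]] by linarith
    qed
    have "(\<integral>\<^sup>+t. ennreal (indicator ?S t * ?c t) \<partial>lborel) = (\<integral>\<^sup>+t. ennreal (spectral_norm Z) * ennreal (indicator ?S t * c t) \<partial>lborel)"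
      by (intro nn_integral_cong) (subst mult.left_commute, rule ennreal_mult'[OF spectral_norm_nonneg])
    also have "\<dots> = ennreal (spectral_norm Z) * (\<integral>\<^sup>+t. ennreal (indicator ?S t * c t) \<partial>lborel)"
      using cm by (intro nn_integral_cmult) measurable
    also have "\<dots> \<le> ennreal (spectral_norm Z) * ennreal C0" using cC by (intro mult_left_mono) auto
    finally have cC': "(\<integral>\<^sup>+t. ennreal (indicator ?S t * ?c t) \<partial>lborel) \<le> ennreal (spectral_norm Z * C0)"
      by (simp add: ennreal_mult' spectral_norm_nonneg)
    have "0 \<le> spectral_norm Z * C0" using C0 by (intro mult_nonneg_nonneg spectral_norm_nonneg)
    from Lp_set_integral(3)[OF S m1 c' c'0 n1 cC' this] show ?thesis unfolding eq .
  qed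
  \<comment> \<open>Built from the integrals of the coordinates, so that its coordinates equal them
    at every point, also where the vector-valued integral does not exist. Almost everywhere it is
    the integral in question, which is all that \<open>F_eq\<close> asks for.\<close>
  define v' where "v' \<xi> = Y *v (\<chi> k. LINT t|lborel. w k t \<xi>)" for \<xi>
  have v'm: "v' \<in> borel_measurable borel"
  proof -
    have "(\<lambda>\<xi>. LINT t|lborel. w k t \<xi>) \<in> borel_measurable borel" for k
      using lborel.borel_measurable_lebesgue_integral[of "\<lambda>\<xi> t. w k t \<xi>" borel] wm[of k] by (simp add: case_prod_beta')
    from measurable_compose[OF vec_lambda_measurable[OF this] vector_mult_measurable[of Y]]
    show ?thesis by (simp add: v'_def[abs_def])
  qed
  have "AE \<xi> in lborel. (LINT t|lborel. \<phi> t \<xi>) = v' \<xi>"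
    using aew
  proof eventually_elim
    case (elim \<xi>)
    show ?case unfolding v'_def wint(2)[OF elim] by (simp add: matrix_vector_mul_assoc matrix_inv_cancel[OF Y])
  qed
  then have ae: "AE \<xi> in lebesgue. (LINT t|lborel. \<phi> t \<xi>) = v' \<xi>" by (simp add: AE_completion_iff)
  have W': "W v' k = (\<lambda>\<xi>. LINT t|lborel. w k t \<xi>)" for k
    by (simp add: fun_eq_iff v'_def matrix_vector_mul_assoc matrix_inv_cancel[OF Y])
  note Vi = V_commutes_with_integral[OF Re_a h lborel.sigma_finite_measure_axioms wm aew' wL]
  have "F h (\<lambda>x. LINT t|lborel. \<phi> t x) x = Y *v (\<chi> k. V (a k) (b k + z) h (W v' k) x)"
    by (rule F_eq(2)[OF h I(3) v'm ae])
  also have "\<dots> = Y *v (\<chi> k. LINT t|lborel. V (a k) (b k + z) h (w k t) x)"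
    unfolding W' Vi(1) ..
  also have "\<dots> = (LINT t|lborel. Y *v (\<chi> k. V (a k) (b k + z) h (w k t) x))"
  proof -
    have "has_bochner_integral lborel (\<lambda>t. Y *v (\<chi> k. V (a k) (b k + z) h (w k t) x)) (Y *v (\<chi> k. LINT t|lborel. V (a k) (b k + z) h (w k t) x))"
      by (intro has_bochner_integral_bounded_linear[OF vector_mult_bounded_linear] has_bochner_integral_vec
        has_bochner_integral_integrable Vi(2))
    then show ?thesis by (simp add: has_bochner_integral_iff)
  qed
  also have "\<dots> = (LINT t|lborel. indicator ?S t *\<^sub>R F h (F t g) x)"
  proof (rule Bochner_Integration.integral_cong[OF refl])
    fix t
    show "Y *v (\<chi> k. V (a k) (b k + z) h (w k t) x) = indicator ?S t *\<^sub>R F h (F t g) x"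
    proof (cases "t > 0")
      case True
      have "F h (F t g) x = Y *v (\<chi> k. V (a k) (b k + z) h (W (F t g) k) x)"
        by (rule F_eq(2)[OF h F_bound(1)[OF True g] F_borel[OF True g]]) simp
      moreover have "w k t = W (F t g) k" for k using True by (simp add: w_def \<phi>_def fun_eq_iff)
      ultimately show ?thesis using True by simp
    next
      case False
      then have "w k t = (\<lambda>_. 0)" for k by (simp add: w_def \<phi>_def fun_eq_iff)
      then have "(\<chi> k. V (a k) (b k + z) h (w k t) x) = 0" by (simp add: V_def vec_eq_iff)
      then show ?thesis using False by simp
    qed
  qed
  finally show ?thesis by (simp add: \<phi>_def)
qed

sublocale dec: decaying_semigroup p \<theta> F M \<delta>
  using M_pos \<delta>_pos F_bound F_linear F_semigroup F_continuous F_joint_measurable F_integral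
  by unfold_locales auto

end

section \<open>The generator and its resolvent\<close>

lemma exp_quotient_tendsto:
  fixes c :: complex
  shows "((\<lambda>t. (exp (c * of_real t) - 1) / of_real t) \<longlongrightarrow> c) (at_right 0)"
proof -
  have "((\<lambda>w. exp (c * w)) has_field_derivative c) (at 0)"
    by (auto intro!: derivative_eq_intros)
  then have "((\<lambda>w. (exp (c * w) - 1) / w) \<longlongrightarrow> c) (at 0)"
    by (simp add: has_field_derivative_iff)
  moreover have "filterlim (\<lambda>t. complex_of_real t) (at 0) (at_right 0)"
    unfolding filterlim_at
  proof
    have "((\<lambda>t. complex_of_real t) \<longlongrightarrow> of_real 0) (at_right 0)" by (intro tendsto_of_real tendsto_ident_at)
    then show "((\<lambda>t. complex_of_real t) \<longlongrightarrow> 0) (at_right 0)" by simp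
    show "\<forall>\<^sub>F t in at_right 0. complex_of_real t \<in> UNIV \<and> complex_of_real t \<noteq> 0"
      using eventually_at_right_less[of "0::real"] by eventually_elim auto
  qed
  ultimately show ?thesis by (rule filterlim_compose)
qed

context weighted_Lp
begin

lemma Lp_smult:
  fixes v :: "'a \<Rightarrow> complex ^ 'n"
  assumes v: "v \<in> Lp_space p \<theta>"
  shows "(\<lambda>x. c *s v x) \<in> Lp_space p \<theta>" "Lp_norm p \<theta> (\<lambda>x. c *s v x) \<le> cmod c * Lp_norm p \<theta> v"
proof -
  have m: "(\<lambda>x. c *s v x) \<in> borel_measurable lebesgue"
    by (rule measurable_compose[OF Lp_measurable[OF v] smult_measurable])
  have "AE x in lebesgue. norm (c *s v x) \<le> cmod c * norm (v x)" by (simp add: norm_smult_vec)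
  from Lp_bound[OF v m this norm_ge_zero] show "(\<lambda>x. c *s v x) \<in> Lp_space p \<theta>"
    "Lp_norm p \<theta> (\<lambda>x. c *s v x) \<le> cmod c * Lp_norm p \<theta> v" .
qed

text \<open>Makes the limits selected by \<open>SOME\<close> comparable: any two choices agree
  almost everywhere.\<close>

lemma Lp_tendsto_unique:
  fixes f :: "'i \<Rightarrow> 'a \<Rightarrow> 'b::euclidean_space"
  assumes f: "Lp_tendsto p \<theta> f w \<F>" and f': "Lp_tendsto p \<theta> f w' \<F>" and \<F>: "\<F> \<noteq> bot"
  shows "AE x in lebesgue. w x = w' x"
proof -
  have w: "w \<in> Lp_space p \<theta>" "w' \<in> Lp_space p \<theta>" using f f' by (auto simp: Lp_tendsto_def)
  have "((\<lambda>i. Lp_norm p \<theta> (\<lambda>x. f i x - w x) + Lp_norm p \<theta> (\<lambda>x. f i x - w' x)) \<longlongrightarrow> 0 + 0) \<F>"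
    using f f' by (intro tendsto_add) (auto simp: Lp_tendsto_def)
  moreover have "\<forall>\<^sub>F i in \<F>. f i \<in> Lp_space p \<theta>" using f by (simp add: Lp_tendsto_def)
  then have "\<forall>\<^sub>F i in \<F>. Lp_norm p \<theta> (\<lambda>x. w x - w' x) \<le> Lp_norm p \<theta> (\<lambda>x. f i x - w x) + Lp_norm p \<theta> (\<lambda>x. f i x - w' x)"
  proof eventually_elim
    case (elim i)
    have "Lp_norm p \<theta> (\<lambda>x. (f i x - w' x) - (f i x - w x)) \<le> Lp_norm p \<theta> (\<lambda>x. f i x - w' x) + Lp_norm p \<theta> (\<lambda>x. f i x - w x)"
      by (intro Lp_diff elim w)
    then show ?case by simp
  qed
  ultimately have "Lp_norm p \<theta> (\<lambda>x. w x - w' x) \<le> 0 + 0" using \<F> by (intro tendsto_lowerbound)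
  then have "Lp_norm p \<theta> (\<lambda>x. w x - w' x) = 0" by (simp add: antisym)
  from Lp_norm_eq_0_imp_AE[OF Lp_diff(1)[OF w] this] show ?thesis by eventually_elim simp
qed

text \<open>The product rule at time 0: a factor \<open>exp (c * t)\<close> adds \<open>c\<close> to
  the generator. It is used with \<open>c = z\<close> and with \<open>c = - z\<close>, to pass
  between \<open>F\<close> and the unscaled semigroup in both directions.\<close>

lemma quotient_rescale:
  fixes Q P :: "real \<Rightarrow> 'a \<Rightarrow> complex ^ 'n"
  assumes v: "v \<in> Lp_space p \<theta>" and w: "w \<in> Lp_space p \<theta>" and Q: "\<And>t. t > 0 \<Longrightarrow> Q t \<in> Lp_space p \<theta>"
    and P: "\<And>t x. t > 0 \<Longrightarrow> P t x = exp (c * of_real t) *s Q t x"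
    and lim: "((\<lambda>t. Lp_norm p \<theta> (\<lambda>x. (1 / t) *\<^sub>R (Q t x - v x) - w x)) \<longlongrightarrow> 0) (at_right 0)"
  shows "((\<lambda>t. Lp_norm p \<theta> (\<lambda>x. (1 / t) *\<^sub>R (P t x - v x) - (w x + c *s v x))) \<longlongrightarrow> 0) (at_right 0)"
proof -
  let ?E = "\<lambda>t. exp (c * of_real t)"
  let ?q = "\<lambda>t x. (1 / t) *\<^sub>R (Q t x - v x) - w x"
  let ?b = "\<lambda>t. cmod (?E t) * Lp_norm p \<theta> (?q t) + cmod (?E t - 1) * Lp_norm p \<theta> w
      + cmod ((?E t - 1) / of_real t - c) * Lp_norm p \<theta> v"
  have le: "Lp_norm p \<theta> (\<lambda>x. (1 / t) *\<^sub>R (P t x - v x) - (w x + c *s v x)) \<le> ?b t" if t: "t > 0" for t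
  proof -
    have q: "?q t \<in> Lp_space p \<theta>" by (intro Lp_diff Lp_scaleR Q t v w)
    \<comment> \<open>The three terms are small for different reasons: convergence of the given
      quotient, continuity of the exponential at 0, and its derivative there.\<close>
    have "(1 / t) *\<^sub>R (P t x - v x) - (w x + c *s v x)
        = (?E t *s ?q t x + (?E t - 1) *s w x) + ((?E t - 1) / of_real t - c) *s v x" for x
      using t by (simp add: P[OF t] vec_eq_iff scaleR_conv_of_real[where 'a=complex] field_simps)
    then have "Lp_norm p \<theta> (\<lambda>x. (1 / t) *\<^sub>R (P t x - v x) - (w x + c *s v x))
        = Lp_norm p \<theta> (\<lambda>x. (?E t *s ?q t x + (?E t - 1) *s w x) + ((?E t - 1) / of_real t - c) *s v x)" by (simp only:)
    also have "\<dots> \<le> Lp_norm p \<theta> (\<lambda>x. ?E t *s ?q t x + (?E t - 1) *s w x) + Lp_norm p \<theta> (\<lambda>x. ((?E t - 1) / of_real t - c) *s v x)"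
      by (intro Lp_add Lp_smult q v w)
    also have "Lp_norm p \<theta> (\<lambda>x. ?E t *s ?q t x + (?E t - 1) *s w x) \<le> Lp_norm p \<theta> (\<lambda>x. ?E t *s ?q t x) + Lp_norm p \<theta> (\<lambda>x. (?E t - 1) *s w x)"
      by (intro Lp_add Lp_smult q v w)
    finally show ?thesis
      using Lp_smult(2)[OF q, of "?E t"] Lp_smult(2)[OF w, of "?E t - 1"] Lp_smult(2)[OF v, of "(?E t - 1) / of_real t - c"]
      by linarith
  qed
  have e: "(?E \<longlongrightarrow> exp (c * of_real 0)) (at_right 0)" by (intro tendsto_intros)
  have "(?b \<longlongrightarrow> cmod (exp (c * of_real 0)) * 0 + cmod (exp (c * of_real 0) - 1) * Lp_norm p \<theta> w + cmod (c - c) * Lp_norm p \<theta> v) (at_right 0)"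
    by (intro tendsto_intros e lim exp_quotient_tendsto)
  then have b: "(?b \<longlongrightarrow> 0) (at_right 0)" by simp
  show ?thesis
  proof (rule tendsto_sandwich[OF _ _ tendsto_const b])
    show "\<forall>\<^sub>F t in at_right 0. Lp_norm p \<theta> (\<lambda>x. (1 / t) *\<^sub>R (P t x - v x) - (w x + c *s v x)) \<le> ?b t"
      by (rule eventually_mono[OF eventually_at_right_less le])
  qed simp
qed

end

context OU_system
begin

lemma OU_eq_F: "OU_semigroup A B S t v x = exp (z * of_real t) *s F t v x"
proof -
  have "exp (z * of_real t) * exp (- z * of_real t) = 1" by (simp add: exp_add[symmetric])
  then show ?thesis by (simp add: F_def vector_smult_assoc)
qed

lemma OU_Lp:
  assumes "t > 0" "v \<in> Lp_space p \<theta>"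
  shows "OU_semigroup A B S t v \<in> Lp_space p \<theta>"
proof -
  have "OU_semigroup A B S t v = (\<lambda>x. exp (z * of_real t) *s F t v x)" by (simp add: OU_eq_F fun_eq_iff)
  then show ?thesis using Lp_smult(1)[OF F_bound(1)[OF assms]] by simp
qed

text \<open>The generator of \<open>F\<close> is that of the semigroup minus \<open>z\<close>; a
  limit \<open>- g\<close> for \<open>F\<close> therefore means \<open>z v - g\<close> for the
  semigroup.\<close>

lemma generator_tendsto:
  assumes v: "v \<in> Lp_space p \<theta>" and g: "g \<in> Lp_space p \<theta>"
    and lim: "((\<lambda>t. Lp_norm p \<theta> (\<lambda>x. (1 / t) *\<^sub>R (F t v x - v x) + g x)) \<longlongrightarrow> 0) (at_right 0)"
  shows "Lp_tendsto p \<theta> (OU_difference_quotient A B S v) (\<lambda>x. z *s v x - g x) (at_right 0)"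
  unfolding Lp_tendsto_def
proof (intro conjI)
  show "(\<lambda>x. z *s v x - g x) \<in> Lp_space p \<theta>" by (intro Lp_diff Lp_smult v g)
  have "OU_difference_quotient A B S v t \<in> Lp_space p \<theta>" if "t > 0" for t
    unfolding OU_difference_quotient_def[abs_def] by (intro Lp_scaleR Lp_diff OU_Lp that v)
  then show "\<forall>\<^sub>F t in at_right 0. OU_difference_quotient A B S v t \<in> Lp_space p \<theta>"
    by (rule eventually_mono[OF eventually_at_right_less])
  have mg: "(\<lambda>x. - g x) \<in> Lp_space p \<theta>" using Lp_scaleR(1)[OF g, of "-1"] by simp
  have "((\<lambda>t. Lp_norm p \<theta> (\<lambda>x. (1 / t) *\<^sub>R (OU_semigroup A B S t v x - v x) - (- g x + z *s v x))) \<longlongrightarrow> 0) (at_right 0)"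
    by (rule quotient_rescale[OF v mg F_bound(1)[OF _ v] OU_eq_F]) (use lim in simp_all)
  then show "((\<lambda>t. Lp_norm p \<theta> (\<lambda>x. OU_difference_quotient A B S v t x - (z *s v x - g x))) \<longlongrightarrow> 0) (at_right 0)"
    by (simp add: OU_difference_quotient_def)
qed

lemma generator_tendsto_imp:
  assumes v: "v \<in> Lp_space p \<theta>" and w: "Lp_tendsto p \<theta> (OU_difference_quotient A B S v) w (at_right 0)"
  shows "((\<lambda>t. Lp_norm p \<theta> (\<lambda>x. (1 / t) *\<^sub>R (F t v x - v x) + (z *s v x - w x))) \<longlongrightarrow> 0) (at_right 0)"
proof -
  have wL: "w \<in> Lp_space p \<theta>" using w by (simp add: Lp_tendsto_def)
  have lim: "((\<lambda>t. Lp_norm p \<theta> (\<lambda>x. (1 / t) *\<^sub>R (OU_semigroup A B S t v x - v x) - w x)) \<longlongrightarrow> 0) (at_right 0)"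
    using w by (simp add: Lp_tendsto_def OU_difference_quotient_def)
  have "((\<lambda>t. Lp_norm p \<theta> (\<lambda>x. (1 / t) *\<^sub>R (F t v x - v x) - (w x + (- z) *s v x))) \<longlongrightarrow> 0) (at_right 0)"
    by (rule quotient_rescale[OF v wL OU_Lp[OF _ v] F_def lim]) simp
  moreover have "(1 / t) *\<^sub>R (F t v x - v x) - (w x + (- z) *s v x) = (1 / t) *\<^sub>R (F t v x - v x) + (z *s v x - w x)" for t x
    by (simp add: vec_eq_iff)
  ultimately show ?thesis by (simp only:)
qed

text \<open>One function serves for all clauses, the Laplace integral taken separately at each
  point. The objects chosen by \<open>SOME\<close> are compared with it only almost
  everywhere.\<close>

lemma resolvent_theorem:
  assumes g: "g \<in> Lp_space p \<theta>"
  shows "\<exists>v. solves_resolvent_eq A B S p \<theta> z g v \<and>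
      (\<forall>w. solves_resolvent_eq A B S p \<theta> z g w \<longrightarrow> (AE x in lebesgue. w x = v x)) \<and>
      (AE x in lebesgue. v x = OU_resolvent A B S p \<theta> z g x) \<and>
      Lp_has_improper_integral p \<theta> (\<lambda>t x. exp (- z * complex_of_real t) *s OU_semigroup A B S t g x) v \<and>
      (\<forall>t>0. \<forall>x. integrable lebesgue (\<lambda>\<xi>. heat_kernel A B S x \<xi> t *v g \<xi>)) \<and>
      (AE x in lebesgue.
         set_integrable lebesgue {0<..} (\<lambda>t. exp (- z * complex_of_real t) *s
           (LINT \<xi>|lebesgue. heat_kernel A B S x \<xi> t *v g \<xi>)) \<and>
         v x = (LINT t:{0<..}|lebesgue. exp (- z * complex_of_real t) *s
           (LINT \<xi>|lebesgue. heat_kernel A B S x \<xi> t *v g \<xi>))) \<and>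
      Lp_norm p \<theta> v \<le> M_const CARD('d) A Y C C_star / (Re z - omega_const A B \<eta> p \<epsilon>) * Lp_norm p \<theta> g"
proof (intro exI[of _ "dec.I {0<..} g"] conjI)
  let ?v = "dec.I {0<..} g"
  have vL: "?v \<in> Lp_space p \<theta>" by (rule dec.R_facts(3)[OF g])
  have lim: "Lp_tendsto p \<theta> (OU_difference_quotient A B S ?v) (\<lambda>x. z *s ?v x - g x) (at_right 0)"
    by (rule generator_tendsto[OF vL g dec.resolvent_quotient_tendsto[OF g]])
  then have dom: "?v \<in> OU_domain A B S p \<theta>" using vL by (auto simp: OU_domain_def)
  have gen: "Lp_tendsto p \<theta> (OU_difference_quotient A B S w) (OU_generator A B S p \<theta> w) (at_right 0)"
    if "w \<in> OU_domain A B S p \<theta>" for w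
  proof -
    have "\<exists>w'. Lp_tendsto p \<theta> (OU_difference_quotient A B S w) w' (at_right 0)"
      using that by (simp add: OU_domain_def)
    then show ?thesis unfolding OU_generator_def by (rule someI_ex)
  qed
  have "AE x in lebesgue. OU_generator A B S p \<theta> ?v x = z *s ?v x - g x"
    by (rule Lp_tendsto_unique[OF gen[OF dom] lim]) simp
  then have "AE x in lebesgue. z *s ?v x - OU_generator A B S p \<theta> ?v x = g x"
    by eventually_elim simp
  then show solves: "solves_resolvent_eq A B S p \<theta> z g ?v"
    using dom by (simp add: solves_resolvent_eq_def)
  have unique: "AE x in lebesgue. w x = ?v x" if w: "solves_resolvent_eq A B S p \<theta> z g w" for w
  proof -
    have wd: "w \<in> OU_domain A B S p \<theta>" and we: "AE x in lebesgue. z *s w x - OU_generator A B S p \<theta> w x = g x"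
      using w by (auto simp: solves_resolvent_eq_def)
    have wL: "w \<in> Lp_space p \<theta>" using wd by (simp add: OU_domain_def)
    let ?h = "\<lambda>x. z *s w x - OU_generator A B S p \<theta> w x"
    have "OU_generator A B S p \<theta> w \<in> Lp_space p \<theta>" using gen[OF wd] by (simp add: Lp_tendsto_def)
    then have hL: "?h \<in> Lp_space p \<theta>" by (intro Lp_diff Lp_smult wL)
    \<comment> \<open>A solution satisfies its equation only almost everywhere, so \<open>g\<close>
      is first exchanged for the function that the generator yields exactly.\<close>
    have "Lp_norm p \<theta> (\<lambda>x. (1 / t) *\<^sub>R (F t w x - w x) + g x) = Lp_norm p \<theta> (\<lambda>x. (1 / t) *\<^sub>R (F t w x - w x) + ?h x)"
      if t: "t > 0" for t
    proof (rule Lp_cong_AE(2))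
      show "(\<lambda>x. (1 / t) *\<^sub>R (F t w x - w x) + ?h x) \<in> Lp_space p \<theta>"
        by (intro Lp_add Lp_scaleR Lp_diff(1)[OF F_bound(1)[OF t wL] wL] hL)
      show "AE x in lebesgue. (1 / t) *\<^sub>R (F t w x - w x) + g x = (1 / t) *\<^sub>R (F t w x - w x) + ?h x"
        using we by eventually_elim simp
    qed
    then have "((\<lambda>t. Lp_norm p \<theta> (\<lambda>x. (1 / t) *\<^sub>R (F t w x - w x) + g x)) \<longlongrightarrow> 0) (at_right 0)"
      by (intro Lim_transform_eventually[OF generator_tendsto_imp[OF wL gen[OF wd]]]
          eventually_mono[OF eventually_at_right_less]) simp
    then show ?thesis by (rule dec.resolvent_unique[OF wL g])
  qed
  then show "\<forall>w. solves_resolvent_eq A B S p \<theta> z g w \<longrightarrow> (AE x in lebesgue. w x = ?v x)" by blast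
  have "solves_resolvent_eq A B S p \<theta> z g (OU_resolvent A B S p \<theta> z g)"
    unfolding OU_resolvent_def by (rule someI[of _ ?v]) (rule solves)
  from unique[OF this] show "AE x in lebesgue. ?v x = OU_resolvent A B S p \<theta> z g x"
    by eventually_elim simp
  \<comment> \<open>At time 0 both sides are \<open>g\<close>, since \<open>OU_semigroup\<close> is
    defined to be the identity there.\<close>
  have "(\<lambda>t x. exp (- z * complex_of_real t) *s OU_semigroup A B S t g x) = (\<lambda>t. if t = 0 then g else F t g)"
    by (auto simp: fun_eq_iff F_def OU_semigroup_def)
  then show "Lp_has_improper_integral p \<theta> (\<lambda>t x. exp (- z * complex_of_real t) *s OU_semigroup A B S t g x) ?v"
    using dec.improper_integral[OF g] by simp
  show "\<forall>t>0. \<forall>x. integrable lebesgue (\<lambda>\<xi>. heat_kernel A B S x \<xi> t *v g \<xi>)"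
  proof (intro allI impI)
    fix t :: real and x assume t: "t > 0"
    obtain g' where g': "g' \<in> borel_measurable borel" "AE x in lebesgue. g x = g' x"
      by (rule Lp_ex_borel[OF g])
    show "integrable lebesgue (\<lambda>\<xi>. heat_kernel A B S x \<xi> t *v g \<xi>)" by (rule F_eq(1)[OF t g g'])
  qed
  show "AE x in lebesgue.
         set_integrable lebesgue {0<..} (\<lambda>t. exp (- z * complex_of_real t) *s
           (LINT \<xi>|lebesgue. heat_kernel A B S x \<xi> t *v g \<xi>)) \<and>
         ?v x = (LINT t:{0<..}|lebesgue. exp (- z * complex_of_real t) *s
           (LINT \<xi>|lebesgue. heat_kernel A B S x \<xi> t *v g \<xi>))"
    using dec.R_facts(1)[OF g]
  proof eventually_elim
    case (elim x)
    \<comment> \<open>This integrand is measurable for \<open>lborel\<close>, so passing to the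
      completion changes neither integrability nor the value of the integral.\<close>
    let ?\<phi> = "\<lambda>t. indicator {0<..} t *\<^sub>R F t g x"
    have eq: "(\<lambda>t. indicator {0<..} t *\<^sub>R (exp (- z * complex_of_real t) *s
           (LINT \<xi>|lebesgue. heat_kernel A B S x \<xi> t *v g \<xi>))) = ?\<phi>"
      by (auto simp: fun_eq_iff F_def OU_semigroup_def indicator_def)
    have m: "?\<phi> \<in> borel_measurable lborel" using elim by (rule borel_measurable_integrable)
    show ?case
      unfolding set_integrable_def set_lebesgue_integral_def eq
      using elim integral_completion[OF m] integrable_completion[OF m] by (simp add: dec.I_def)
  qed
  show "Lp_norm p \<theta> ?v \<le> M_const CARD('d) A Y C C_star / (Re z - omega_const A B \<eta> p \<epsilon>) * Lp_norm p \<theta> g"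
    using dec.R_facts(4)[OF g] by (simp add: M_def)
qed

end

theorem corollary5p5:
  fixes A B Y :: "complex ^ 'n ^ 'n"
    and S :: "real ^ 'd ^ 'd"
    and \<theta> :: "real ^ 'd \<Rightarrow> real"
    and \<eta> C\<theta> p \<epsilon> C_star :: real
    and z :: complex
  assumes "CARD('d) \<ge> 2"
    and "diagonalizes Y A"
    and "diagonalizes Y B"
    and "\<forall>l\<in>mat_spectrum A. Re l > 0"
    and "transpose S = - S"
    and "1 \<le> p"
    and "weight_function \<theta> \<eta> C\<theta>"
    and "radial \<theta>"
    and "((\<lambda>\<psi>. SUP x. \<bar>(\<theta> (x + \<psi>) - \<theta> x) / \<theta> x\<bar>) \<longlongrightarrow> 0) (at 0)"
    and "\<epsilon> > 0"
    and "kummer_growth_const CARD('d) A \<eta> p \<epsilon> C_star"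
    and "Re z > omega_const A B \<eta> p \<epsilon>"
  shows "\<forall>g \<in> Lp_space p \<theta>. \<exists>v.
      solves_resolvent_eq A B S p \<theta> z g v \<and>
      (\<forall>w. solves_resolvent_eq A B S p \<theta> z g w \<longrightarrow> (AE x in lebesgue. w x = v x)) \<and>
      (AE x in lebesgue. v x = OU_resolvent A B S p \<theta> z g x) \<and>
      Lp_has_improper_integral p \<theta> (\<lambda>t x. exp (- z * complex_of_real t) *s OU_semigroup A B S t g x) v \<and>
      (\<forall>t>0. \<forall>x. integrable lebesgue (\<lambda>\<xi>. heat_kernel A B S x \<xi> t *v g \<xi>)) \<and>
      (AE x in lebesgue.
         set_integrable lebesgue {0<..} (\<lambda>t. exp (- z * complex_of_real t) *s
           (LINT \<xi>|lebesgue. heat_kernel A B S x \<xi> t *v g \<xi>)) \<and>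
         v x = (LINT t:{0<..}|lebesgue. exp (- z * complex_of_real t) *s
           (LINT \<xi>|lebesgue. heat_kernel A B S x \<xi> t *v g \<xi>))) \<and>
      Lp_norm p \<theta> v \<le> M_const CARD('d) A Y C\<theta> C_star / (Re z - omega_const A B \<eta> p \<epsilon>) * Lp_norm p \<theta> g"
proof -
  obtain a where A: "A = conj_diag Y a"
    using diagonalizesE assms(2) by (metis diagonalizes_def)
  obtain b where B: "B = conj_diag Y b"
    using diagonalizesE assms(3) by (metis diagonalizes_def)
  have Y: "invertible Y" using assms(2) by (simp add: diagonalizes_def)
  have w: "continuous_on UNIV \<theta>" "\<And>x. \<theta> x > 0" "\<eta> \<ge> 0" "C\<theta> > 0"
    "\<And>x y. \<theta> (x + y) \<le> C\<theta> * \<theta> x * exp (\<eta> * norm y)"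
    using assms(7) by (auto simp: weight_function_def)
  interpret OU_system p \<theta> \<eta> C\<theta> S Y a b z \<epsilon> C_star
  proof unfold_locales
    show "0 < Re (a k)" for k
      using assms(4) by (simp add: A mat_spectrum_conj_diag[OF Y])
  qed (use assms(5,6,8,11,12) w Y in \<open>simp_all add: A B\<close>)
  show ?thesis
    unfolding A B using resolvent_theorem by blast
qed

end
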